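(* Let $(\mathcal V,\otimes,\mathbf 1)$ be a monoidal category such that $\mathcal V$ is cocomplete and locally small and $\otimes$ is cocontinuous in each argument. Let $F\colon\mathcal I\to\mathrm{Cat}_{\mathcal V}$ be a small diagram. Then a colimit of $F$ in $\mathrm{Cat}_{\mathcal V}$ is given by the following $\mathcal V$-enriched category: - its set of objects is $\operatorname{colim}(\mathrm{Ob}\circ F)$; - its hom-object from $a$ to $b$ is $\operatorname{colim}_{\overline{\mathcal S}_F(a,b)}\big(\overline{\mathrm{ev}}_F^{a,b}\big)$; - its unit map at $a=[x]$, $x\in F(i)$, is the composite $\mathbf 1\xrightarrow{j_x}F(i)(x,x)\to\operatorname{colim}(\overline{\mathrm{ev}}_F^{a,a})$ of the unit map of $F(i)$ and the component of the colimiting cocone at the string $[(i,x,x)]$; - its composition $\circ_{a,b,c}$ is the composite $$\operatorname{colim}\big(\overline{\mathrm{ev}}_F^{b,c}\big)\otimes\operatorname{colim}\big(\overline{\mathrm{ev}}_F^{a,b}\big)\overset{\mu}{\cong}\operatorname{colim}\big(\overline{\mathrm{ev}}_F^{b,c}\boxtimes\overline{\mathrm{ev}}_F^{a,b}\big)\xrightarrow{\operatorname{colim}(\overline\star,\overline\theta)}\operatorname{colim}(\overline{\mathrm{ev}}_F^{a,c}).$$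
   Context: $\mathrm{Cat}_{\mathcal V}$ is the category of small $\mathcal V$-enriched categories and $\mathcal V$-enriched functors; composition in an enriched category $\mathcal C$ is $\circ\colon\mathcal C(b,c)\otimes\mathcal C(a,b)\to\mathcal C(a,c)$ and unit maps are $j_a\colon\mathbf 1\to\mathcal C(a,a)$. $\mathrm{Ob}\colon\mathrm{Cat}_{\mathcal V}\to\mathrm{Set}$ is the object-set functor. Iterated tensor products are left-associated. "Cocontinuous" means preserving small colimits. For $x\in \mathrm{Ob}(F(i))$, $[x]$ denotes its class in $\operatorname{colim}(\mathrm{Ob}\circ F)$. An $F$-edge is a triple $(i,x,y)$ with $i\in\mathcal I$, $x,y\in F(i)$; a morphism of $F$-edges $(i,x,y)\to(i',x',y')$ is a morphism $f\colon i\to i'$ of $\mathcal I$ with $(Ff)(x)=x'$, $(Ff)(y)=y'$. **Category of non-empty strings.** For $a,b\in\operatorname{colim}(\mathrm{Ob}\circ F)$, the category $\overline{\mathcal S}_F(a,b)$ has as objects the strings $[e_n,\dots,e_1]$, $n\ge1$, of $F$-edges $e_k=(i_k,x_k,y_k)$ with $[x_1]=a$, $[y_n]=b$ and $[y_{k-1}]=[x_k]$. Concatenation $t\,\overline\star\,s$ writes $t$ to the left of $s$. Morphisms are generated by transports $[\dots,f,\dots]\colon[\dots,e,\dots]\to[\dots,e',\dots]$ for a morphism of edges $f\colon e\to e'$, and contractions $[\dots,(i,y,z),(i,x,y),\dots]\to[\dots,(i,x,z),\dots]$, modulo the interchange relation $(\beta\,\overline\star\,\mathrm{id}_{s'})\circ(\mathrm{id}_t\,\overline\star\,\alpha)=(\mathrm{id}_{t'}\,\overline\star\,\alpha)\circ(\beta\,\overline\star\,\mathrm{id}_s)$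 for generators $\alpha\colon s\to s'$, $\beta\colon t\to t'$ of composable strings. Thus $\overline\star_{a,b,c}\colon\overline{\mathcal S}_F(b,c)\times\overline{\mathcal S}_F(a,b)\to\overline{\mathcal S}_F(a,c)$ is a functor. **String evaluation.** The functor $\overline{\mathrm{ev}}_F^{a,b}\colon\overline{\mathcal S}_F(a,b)\to\mathcal V$ sends $[(i_n,x_n,y_n),\dots,(i_1,x_1,y_1)]$ to $F(i_n)(x_n,y_n)\otimes\cdots\otimes F(i_1)(x_1,y_1)$, transports to tensor products of the hom-object maps of the functors $Ff$ (identities on the other factors), and contractions to $\circ\colon F(i)(y,z)\otimes F(i)(x,y)\to F(i)(x,z)$ on the relevant factors (up to canonical reassociation). **Structure maps.** For functors $G\colon\mathcal J\to\mathcal V$, $H\colon\mathcal K\to\mathcal V$, $G\boxtimes H\colon\mathcal J\times\mathcal K\to\mathcal V$ is $(j,k)\mapsto G(j)\otimes H(k)$. The isomorphism $\mu\colon\operatorname{colim}G\otimes\operatorname{colim}H\cong\operatorname{colim}(G\boxtimes H)$ is the inverse of the map induced by the cocone of tensor products of the two colimiting cocones. $\overline\theta_{a,b,c}$ is the natural isomorphism $\overline{\mathrm{ev}}_F^{b,c}(t)\otimes\overline{\mathrm{ev}}_F^{a,b}(s)\cong\overline{\mathrm{ev}}_F^{a,c}(t\,\overline\star\,s)$ given by iterated associators, and $\operatorname{colim}(\overline\star,\overline\theta)$ is the unique map whose precomposition with the colimiting cocone component at $(t,s)$ is $\overline\theta_{t,s}$ followed by the colimiting cocone component of $\operatorname{colim}(\overline{\mathrm{ev}}_F^{a,c})$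 at $t\,\overline\star\,s$. *)

theory Defs
  imports Main
begin

unbundle cardinal_syntax

section \<open>Size\<close>

text \<open>
  A type \<open>'u\<close> plays the role of the universe: a set (over any type) is small if its
  cardinality is strictly below that of \<open>'u\<close>. If the cardinality of \<open>'u\<close> is strongly
  inaccessible, this is smallness with respect to a Grothendieck universe. Only regularity and
  uncountability are required below, so all such universes are included.
\<close>

definition universe_type :: "'u itself \<Rightarrow> bool" where
  "universe_type U \<longleftrightarrow> |UNIV :: nat set| <o |UNIV :: 'u set| \<and> regularCard |UNIV :: 'u set|"

definition small :: "'u itself \<Rightarrow> 'a set \<Rightarrow> bool" where
  "small U A \<longleftrightarrow> |A| <o |UNIV :: 'u set|"


section \<open>Categories, functors, colimits\<close>

record ('o, 'm) category =
  Obj :: "'o set"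
  Arr :: "'m set"
  Dom :: "'m \<Rightarrow> 'o"
  Cod :: "'m \<Rightarrow> 'o"
  Ident :: "'o \<Rightarrow> 'm"
  Comp :: "'m \<Rightarrow> 'm \<Rightarrow> 'm"  \<comment> \<open>\<open>Comp C g f\<close> is \<open>g\<close> after \<open>f\<close>\<close>

definition Hom :: "('o, 'm, 'z) category_scheme \<Rightarrow> 'o \<Rightarrow> 'o \<Rightarrow> 'm set" where
  "Hom C a b = {f \<in> Arr C. Dom C f = a \<and> Cod C f = b}"

definition is_category :: "('o, 'm, 'z) category_scheme \<Rightarrow> bool" where
  "is_category C \<longleftrightarrow>
     (\<forall>f\<in>Arr C. Dom C f \<in> Obj C \<and> Cod C f \<in> Obj C) \<and>
     (\<forall>a\<in>Obj C. Ident C a \<in> Hom C a a) \<and>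
     (\<forall>f\<in>Arr C. \<forall>g\<in>Arr C. Cod C f = Dom C g \<longrightarrow> Comp C g f \<in> Hom C (Dom C f) (Cod C g)) \<and>
     (\<forall>f\<in>Arr C. Comp C f (Ident C (Dom C f)) = f \<and> Comp C (Ident C (Cod C f)) f = f) \<and>
     (\<forall>f\<in>Arr C. \<forall>g\<in>Arr C. \<forall>h\<in>Arr C. Cod C f = Dom C g \<and> Cod C g = Dom C h \<longrightarrow>
        Comp C h (Comp C g f) = Comp C (Comp C h g) f)"

definition small_category :: "'u itself \<Rightarrow> ('o, 'm, 'z) category_scheme \<Rightarrow> bool" where
  "small_category U C \<longleftrightarrow> is_category C \<and> small U (Obj C) \<and> small U (Arr C)"

definition locally_small :: "'u itself \<Rightarrow> ('o, 'm, 'z) category_scheme \<Rightarrow> bool" where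
  "locally_small U C \<longleftrightarrow> (\<forall>a\<in>Obj C. \<forall>b\<in>Obj C. small U (Hom C a b))"

definition inverse_arrows :: "('o, 'm, 'z) category_scheme \<Rightarrow> 'm \<Rightarrow> 'm \<Rightarrow> bool" where
  "inverse_arrows C f g \<longleftrightarrow> f \<in> Arr C \<and> g \<in> Hom C (Cod C f) (Dom C f) \<and>
     Comp C g f = Ident C (Dom C f) \<and> Comp C f g = Ident C (Cod C f)"

definition is_iso :: "('o, 'm, 'z) category_scheme \<Rightarrow> 'm \<Rightarrow> bool" where
  "is_iso C f \<longleftrightarrow> (\<exists>g. inverse_arrows C f g)"

definition inv_arr :: "('o, 'm, 'z) category_scheme \<Rightarrow> 'm \<Rightarrow> 'm" where
  "inv_arr C f = (THE g. inverse_arrows C f g)"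

definition prod_cat ::
  "('o, 'm, 'z) category_scheme \<Rightarrow> ('p, 'n, 'w) category_scheme \<Rightarrow> ('o \<times> 'p, 'm \<times> 'n) category" where
  "prod_cat C D = \<lparr>
     Obj = Obj C \<times> Obj D,
     Arr = Arr C \<times> Arr D,
     Dom = (\<lambda>(f, g). (Dom C f, Dom D g)),
     Cod = (\<lambda>(f, g). (Cod C f, Cod D g)),
     Ident = (\<lambda>(a, b). (Ident C a, Ident D b)),
     Comp = (\<lambda>(f', g') (f, g). (Comp C f' f, Comp D g' g))\<rparr>"

record ('o, 'm, 'p, 'n) func =
  Fo :: "'o \<Rightarrow> 'p"
  Fa :: "'m \<Rightarrow> 'n"

definition is_functor ::
  "('o, 'm, 'z) category_scheme \<Rightarrow> ('p, 'n, 'w) category_scheme \<Rightarrow> ('o, 'm, 'p, 'n) func \<Rightarrow> bool" where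
  "is_functor C D G \<longleftrightarrow> is_category C \<and> is_category D \<and>
     (\<forall>a\<in>Obj C. Fo G a \<in> Obj D) \<and>
     (\<forall>f\<in>Arr C. Fa G f \<in> Hom D (Fo G (Dom C f)) (Fo G (Cod C f))) \<and>
     (\<forall>a\<in>Obj C. Fa G (Ident C a) = Ident D (Fo G a)) \<and>
     (\<forall>f\<in>Arr C. \<forall>g\<in>Arr C. Cod C f = Dom C g \<longrightarrow> Fa G (Comp C g f) = Comp D (Fa G g) (Fa G f))"

definition comp_func ::
  "('p, 'n, 'q, 'l) func \<Rightarrow> ('o, 'm, 'p, 'n) func \<Rightarrow> ('o, 'm, 'q, 'l) func" where
  "comp_func H G = \<lparr>Fo = (\<lambda>a. Fo H (Fo G a)), Fa = (\<lambda>f. Fa H (Fa G f))\<rparr>"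

definition is_cocone ::
  "('j, 'k, 'z) category_scheme \<Rightarrow> ('o, 'm, 'w) category_scheme \<Rightarrow> ('j, 'k, 'o, 'm) func \<Rightarrow>
   'o \<Rightarrow> ('j \<Rightarrow> 'm) \<Rightarrow> bool" where
  "is_cocone J C G c \<iota> \<longleftrightarrow> is_functor J C G \<and> c \<in> Obj C \<and>
     (\<forall>j\<in>Obj J. \<iota> j \<in> Hom C (Fo G j) c) \<and>
     (\<forall>f\<in>Arr J. Comp C (\<iota> (Cod J f)) (Fa G f) = \<iota> (Dom J f))"

definition is_colimit ::
  "('j, 'k, 'z) category_scheme \<Rightarrow> ('o, 'm, 'w) category_scheme \<Rightarrow> ('j, 'k, 'o, 'm) func \<Rightarrow>
   'o \<Rightarrow> ('j \<Rightarrow> 'm) \<Rightarrow> bool" where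
  "is_colimit J C G c \<iota> \<longleftrightarrow> is_cocone J C G c \<iota> \<and>
     (\<forall>d \<kappa>. is_cocone J C G d \<kappa> \<longrightarrow>
        (\<exists>!u. u \<in> Hom C c d \<and> (\<forall>j\<in>Obj J. Comp C u (\<iota> j) = \<kappa> j)))"

definition induced_arr ::
  "('j, 'k, 'z) category_scheme \<Rightarrow> ('o, 'm, 'w) category_scheme \<Rightarrow>
   'o \<Rightarrow> ('j \<Rightarrow> 'm) \<Rightarrow> 'o \<Rightarrow> ('j \<Rightarrow> 'm) \<Rightarrow> 'm" where
  "induced_arr J C c \<iota> d \<kappa> = (THE u. u \<in> Hom C c d \<and> (\<forall>j\<in>Obj J. Comp C u (\<iota> j) = \<kappa> j))"

text \<open>
  Every small category is isomorphic to one whose objects and arrows are elements of \<open>'u\<close>, so it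
  suffices to let the index category range over those.
\<close>

definition cocomplete :: "'u itself \<Rightarrow> ('o, 'm, 'z) category_scheme \<Rightarrow> bool" where
  "cocomplete U C \<longleftrightarrow>
     (\<forall>(J :: ('u, 'u) category) G. small_category U J \<and> is_functor J C G \<longrightarrow>
        (\<exists>c \<iota>. is_colimit J C G c \<iota>))"

definition cocontinuous ::
  "'u itself \<Rightarrow> ('o, 'm, 'z) category_scheme \<Rightarrow> ('p, 'n, 'w) category_scheme \<Rightarrow>
   ('o, 'm, 'p, 'n) func \<Rightarrow> bool" where
  "cocontinuous U C D T \<longleftrightarrow> is_functor C D T \<and>
     (\<forall>(J :: ('u, 'u) category) G c \<iota>. small_category U J \<and> is_colimit J C G c \<iota> \<longrightarrow>
        is_colimit J D (comp_func T G) (Fo T c) (\<lambda>j. Fa T (\<iota> j)))"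

text \<open>The category of small subsets of \<open>'u\<close>; a map is its domain, graph function, codomain.\<close>

type_synonym 'u set_map = "'u set \<times> ('u \<Rightarrow> 'u) \<times> 'u set"

definition set_app :: "'u set_map \<Rightarrow> 'u \<Rightarrow> 'u" where
  "set_app f x = fst (snd f) x"

definition Set_cat :: "('u set, 'u set_map) category" where
  "Set_cat = \<lparr>
     Obj = {A. small TYPE('u) A},
     Arr = {(A, f, B). small TYPE('u) A \<and> small TYPE('u) B \<and>
                       (\<forall>x\<in>A. f x \<in> B) \<and> (\<forall>x. x \<notin> A \<longrightarrow> f x = undefined)},
     Dom = (\<lambda>(A, f, B). A),
     Cod = (\<lambda>(A, f, B). B),
     Ident = (\<lambda>A. (A, \<lambda>x. if x \<in> A then x else undefined, A)),
     Comp = (\<lambda>(B', g, C) (A, f, B). (A, \<lambda>x. if x \<in> A then g (f x) else undefined, C))\<rparr>"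


section \<open>Monoidal categories\<close>

record ('o, 'm) monoidal = "('o, 'm) category" +
  tens :: "('o \<times> 'o, 'm \<times> 'm, 'o, 'm) func"
  munit :: "'o"
  assoc :: "'o \<Rightarrow> 'o \<Rightarrow> 'o \<Rightarrow> 'm"  \<comment> \<open>\<open>(a \<otimes> b) \<otimes> c \<rightarrow> a \<otimes> (b \<otimes> c)\<close>\<close>
  lunit :: "'o \<Rightarrow> 'm"  \<comment> \<open>\<open>1 \<otimes> a \<rightarrow> a\<close>\<close>
  runit :: "'o \<Rightarrow> 'm"  \<comment> \<open>\<open>a \<otimes> 1 \<rightarrow> a\<close>\<close>

definition tens_o :: "('o, 'm, 'z) monoidal_scheme \<Rightarrow> 'o \<Rightarrow> 'o \<Rightarrow> 'o" where
  "tens_o V a b = Fo (tens V) (a, b)"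

definition tens_a :: "('o, 'm, 'z) monoidal_scheme \<Rightarrow> 'm \<Rightarrow> 'm \<Rightarrow> 'm" where
  "tens_a V f g = Fa (tens V) (f, g)"

definition monoidal_category :: "('o, 'm, 'z) monoidal_scheme \<Rightarrow> bool" where
  "monoidal_category V \<longleftrightarrow>
     is_category V \<and> is_functor (prod_cat V V) V (tens V) \<and> munit V \<in> Obj V \<and>
     (\<forall>a\<in>Obj V. \<forall>b\<in>Obj V. \<forall>c\<in>Obj V.
        assoc V a b c \<in> Hom V (tens_o V (tens_o V a b) c) (tens_o V a (tens_o V b c)) \<and>
        is_iso V (assoc V a b c)) \<and>
     (\<forall>a\<in>Obj V. lunit V a \<in> Hom V (tens_o V (munit V) a) a \<and> is_iso V (lunit V a)) \<and>
     (\<forall>a\<in>Obj V. runit V a \<in> Hom V (tens_o V a (munit V)) a \<and> is_iso V (runit V a)) \<and>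
     (\<forall>f\<in>Arr V. \<forall>g\<in>Arr V. \<forall>h\<in>Arr V.
        Comp V (assoc V (Cod V f) (Cod V g) (Cod V h)) (tens_a V (tens_a V f g) h) =
        Comp V (tens_a V f (tens_a V g h)) (assoc V (Dom V f) (Dom V g) (Dom V h))) \<and>
     (\<forall>f\<in>Arr V. Comp V (lunit V (Cod V f)) (tens_a V (Ident V (munit V)) f) =
                 Comp V f (lunit V (Dom V f))) \<and>
     (\<forall>f\<in>Arr V. Comp V (runit V (Cod V f)) (tens_a V f (Ident V (munit V))) =
                 Comp V f (runit V (Dom V f))) \<and>
     (\<forall>a\<in>Obj V. \<forall>b\<in>Obj V.
        Comp V (tens_a V (Ident V a) (lunit V b)) (assoc V a (munit V) b) =
        tens_a V (runit V a) (Ident V b)) \<and>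
     (\<forall>a\<in>Obj V. \<forall>b\<in>Obj V. \<forall>c\<in>Obj V. \<forall>d\<in>Obj V.
        Comp V (assoc V a b (tens_o V c d)) (assoc V (tens_o V a b) c d) =
        Comp V (tens_a V (Ident V a) (assoc V b c d))
          (Comp V (assoc V a (tens_o V b c) d) (tens_a V (assoc V a b c) (Ident V d))))"

definition tensor_left :: "('o, 'm, 'z) monoidal_scheme \<Rightarrow> 'o \<Rightarrow> ('o, 'm, 'o, 'm) func" where
  "tensor_left V a = \<lparr>Fo = (\<lambda>b. tens_o V a b), Fa = (\<lambda>f. tens_a V (Ident V a) f)\<rparr>"

definition tensor_right :: "('o, 'm, 'z) monoidal_scheme \<Rightarrow> 'o \<Rightarrow> ('o, 'm, 'o, 'm) func" where
  "tensor_right V a = \<lparr>Fo = (\<lambda>b. tens_o V b a), Fa = (\<lambda>f. tens_a V f (Ident V a))\<rparr>"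

definition tensor_cocontinuous :: "'u itself \<Rightarrow> ('o, 'm, 'z) monoidal_scheme \<Rightarrow> bool" where
  "tensor_cocontinuous U V \<longleftrightarrow>
     (\<forall>a\<in>Obj V. cocontinuous U V V (tensor_left V a) \<and> cocontinuous U V V (tensor_right V a))"

definition box_func ::
  "('o, 'm, 'z) monoidal_scheme \<Rightarrow> ('j, 'k, 'o, 'm) func \<Rightarrow> ('j', 'k', 'o, 'm) func \<Rightarrow>
   ('j \<times> 'j', 'k \<times> 'k', 'o, 'm) func" where
  "box_func V G H = \<lparr>
     Fo = (\<lambda>(j, k). tens_o V (Fo G j) (Fo H k)),
     Fa = (\<lambda>(f, g). tens_a V (Fa G f) (Fa H g))\<rparr>"


section \<open>Enriched categories\<close>

record ('u, 'o, 'm) vcat =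
  VOb :: "'u set"
  VHom :: "'u \<Rightarrow> 'u \<Rightarrow> 'o"
  VUnit :: "'u \<Rightarrow> 'm"
  VComp :: "'u \<Rightarrow> 'u \<Rightarrow> 'u \<Rightarrow> 'm"
    \<comment> \<open>\<open>VComp C a b c\<close> is \<open>C(b,c) \<otimes> C(a,b) \<rightarrow> C(a,c)\<close>\<close>

record ('u, 'o, 'm) vfun =
  VSrc :: "('u, 'o, 'm) vcat"
  VTgt :: "('u, 'o, 'm) vcat"
  VFo :: "'u \<Rightarrow> 'u"
  VFh :: "'u \<Rightarrow> 'u \<Rightarrow> 'm"

text \<open>
  All data are required to be \<open>undefined\<close> outside the object set, so that equality of records is
  equality of enriched categories and functors.
\<close>

definition is_vcat :: "('o, 'm, 'z) monoidal_scheme \<Rightarrow> ('u, 'o, 'm) vcat \<Rightarrow> bool" where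
  "is_vcat V C \<longleftrightarrow>
     (\<forall>a\<in>VOb C. \<forall>b\<in>VOb C. VHom C a b \<in> Obj V) \<and>
     (\<forall>a\<in>VOb C. VUnit C a \<in> Hom V (munit V) (VHom C a a)) \<and>
     (\<forall>a\<in>VOb C. \<forall>b\<in>VOb C. \<forall>c\<in>VOb C.
        VComp C a b c \<in> Hom V (tens_o V (VHom C b c) (VHom C a b)) (VHom C a c)) \<and>
     (\<forall>a\<in>VOb C. \<forall>b\<in>VOb C. \<forall>c\<in>VOb C. \<forall>d\<in>VOb C.
        Comp V (VComp C a b d) (tens_a V (VComp C b c d) (Ident V (VHom C a b))) =
        Comp V (VComp C a c d)
          (Comp V (tens_a V (Ident V (VHom C c d)) (VComp C a b c))
                  (assoc V (VHom C c d) (VHom C b c) (VHom C a b)))) \<and>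
     (\<forall>a\<in>VOb C. \<forall>b\<in>VOb C.
        Comp V (VComp C a b b) (tens_a V (VUnit C b) (Ident V (VHom C a b))) =
          lunit V (VHom C a b) \<and>
        Comp V (VComp C a a b) (tens_a V (Ident V (VHom C a b)) (VUnit C a)) =
          runit V (VHom C a b)) \<and>
     (\<forall>a b. \<not> (a \<in> VOb C \<and> b \<in> VOb C) \<longrightarrow> VHom C a b = undefined) \<and>
     (\<forall>a. a \<notin> VOb C \<longrightarrow> VUnit C a = undefined) \<and>
     (\<forall>a b c. \<not> (a \<in> VOb C \<and> b \<in> VOb C \<and> c \<in> VOb C) \<longrightarrow> VComp C a b c = undefined)"

definition is_vfun :: "('o, 'm, 'z) monoidal_scheme \<Rightarrow> ('u, 'o, 'm) vfun \<Rightarrow> bool" where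
  "is_vfun V T \<longleftrightarrow>
     (let C = VSrc T; D = VTgt T in
       is_vcat V C \<and> is_vcat V D \<and>
       (\<forall>a\<in>VOb C. VFo T a \<in> VOb D) \<and>
       (\<forall>a\<in>VOb C. \<forall>b\<in>VOb C. VFh T a b \<in> Hom V (VHom C a b) (VHom D (VFo T a) (VFo T b))) \<and>
       (\<forall>a\<in>VOb C. Comp V (VFh T a a) (VUnit C a) = VUnit D (VFo T a)) \<and>
       (\<forall>a\<in>VOb C. \<forall>b\<in>VOb C. \<forall>c\<in>VOb C.
          Comp V (VFh T a c) (VComp C a b c) =
          Comp V (VComp D (VFo T a) (VFo T b) (VFo T c)) (tens_a V (VFh T b c) (VFh T a b))) \<and>
       (\<forall>a. a \<notin> VOb C \<longrightarrow> VFo T a = undefined) \<and>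
       (\<forall>a b. \<not> (a \<in> VOb C \<and> b \<in> VOb C) \<longrightarrow> VFh T a b = undefined))"

definition vfun_id :: "('o, 'm, 'z) monoidal_scheme \<Rightarrow> ('u, 'o, 'm) vcat \<Rightarrow> ('u, 'o, 'm) vfun" where
  "vfun_id V C = \<lparr>VSrc = C, VTgt = C,
     VFo = (\<lambda>a. if a \<in> VOb C then a else undefined),
     VFh = (\<lambda>a b. if a \<in> VOb C \<and> b \<in> VOb C then Ident V (VHom C a b) else undefined)\<rparr>"

definition vfun_comp ::
  "('o, 'm, 'z) monoidal_scheme \<Rightarrow> ('u, 'o, 'm) vfun \<Rightarrow> ('u, 'o, 'm) vfun \<Rightarrow> ('u, 'o, 'm) vfun" where
  "vfun_comp V S T = \<lparr>VSrc = VSrc T, VTgt = VTgt S,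
     VFo = (\<lambda>a. if a \<in> VOb (VSrc T) then VFo S (VFo T a) else undefined),
     VFh = (\<lambda>a b. if a \<in> VOb (VSrc T) \<and> b \<in> VOb (VSrc T)
                    then Comp V (VFh S (VFo T a) (VFo T b)) (VFh T a b) else undefined)\<rparr>"

definition VCat ::
  "('o, 'm, 'z) monoidal_scheme \<Rightarrow> (('u, 'o, 'm) vcat, ('u, 'o, 'm) vfun) category" where
  "VCat V = \<lparr>
     Obj = {C. is_vcat V C \<and> small TYPE('u) (VOb C)},
     Arr = {T. is_vfun V T \<and> small TYPE('u) (VOb (VSrc T)) \<and> small TYPE('u) (VOb (VTgt T))},
     Dom = VSrc, Cod = VTgt, Ident = vfun_id V, Comp = vfun_comp V\<rparr>"

definition Ob_func :: "(('u, 'o, 'm) vcat, ('u, 'o, 'm) vfun, 'u set, 'u set_map) func" where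
  "Ob_func = \<lparr>Fo = VOb, Fa = (\<lambda>T. (VOb (VSrc T), VFo T, VOb (VTgt T)))\<rparr>"


section \<open>Categories presented by generators and relations\<close>

text \<open>A path is the list of its edges in order of traversal, i.e. the first edge is applied first.\<close>

fun is_path :: "'e set \<Rightarrow> ('e \<Rightarrow> 'v) \<Rightarrow> ('e \<Rightarrow> 'v) \<Rightarrow> 'v \<Rightarrow> 'e list \<Rightarrow> 'v \<Rightarrow> bool" where
  "is_path E src tgt v [] w \<longleftrightarrow> v = w"
| "is_path E src tgt v (e # p) w \<longleftrightarrow> e \<in> E \<and> src e = v \<and> is_path E src tgt (tgt e) p w"

definition path_cong :: "('e list \<times> 'e list) set \<Rightarrow> 'e list \<Rightarrow> 'e list \<Rightarrow> bool" where
  "path_cong R =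
     equivclp (\<lambda>p p'. \<exists>u r r' w. (r, r') \<in> R \<and> p = u @ r @ w \<and> p' = u @ r' @ w)"

definition path_class ::
  "'e set \<Rightarrow> ('e \<Rightarrow> 'v) \<Rightarrow> ('e \<Rightarrow> 'v) \<Rightarrow> ('e list \<times> 'e list) set \<Rightarrow> 'v \<Rightarrow> 'e list \<Rightarrow> 'v \<Rightarrow> 'e list set" where
  "path_class E src tgt R v p w = {p'. is_path E src tgt v p' w \<and> path_cong R p p'}"

text \<open>
  The free category on a graph modulo the congruence generated by a set \<open>R\<close> of pairs of parallel
  paths. An arrow is a triple of source, class of paths, and target.
\<close>

definition presented_cat ::
  "'v set \<Rightarrow> 'e set \<Rightarrow> ('e \<Rightarrow> 'v) \<Rightarrow> ('e \<Rightarrow> 'v) \<Rightarrow> ('e list \<times> 'e list) set \<Rightarrow>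
   ('v, 'v \<times> 'e list set \<times> 'v) category" where
  "presented_cat X E src tgt R = \<lparr>
     Obj = X,
     Arr = {(v, path_class E src tgt R v p w, w) | v p w. v \<in> X \<and> w \<in> X \<and> is_path E src tgt v p w},
     Dom = (\<lambda>(v, P, w). v),
     Cod = (\<lambda>(v, P, w). w),
     Ident = (\<lambda>v. (v, path_class E src tgt R v [] v, v)),
     Comp = (\<lambda>(v', Q, w) (v, P, w'). (v, \<Union>p\<in>P. \<Union>q\<in>Q. path_class E src tgt R v (p @ q) w, w))\<rparr>"


section \<open>The category of non-empty strings\<close>

type_synonym ('i, 'u) edge = "'i \<times> 'u \<times> 'u"

type_synonym ('i, 'f, 'u, 'o, 'm) vdiagram = "('i, 'f, ('u, 'o, 'm) vcat, ('u, 'o, 'm) vfun) func"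

definition F_edges ::
  "('i, 'f) category \<Rightarrow> ('i, 'f, 'u, 'o, 'm) vdiagram \<Rightarrow> ('i, 'u) edge set" where
  "F_edges I F = {(i, x, y). i \<in> Obj I \<and> x \<in> VOb (Fo F i) \<and> y \<in> VOb (Fo F i)}"

definition edge_arrow ::
  "('i, 'f) category \<Rightarrow> ('i, 'f, 'u, 'o, 'm) vdiagram \<Rightarrow> 'f \<Rightarrow> ('i, 'u) edge \<Rightarrow> ('i, 'u) edge \<Rightarrow> bool" where
  "edge_arrow I F f e e' \<longleftrightarrow>
     (case (e, e') of ((i, x, y), (i', x', y')) \<Rightarrow>
        e \<in> F_edges I F \<and> e' \<in> F_edges I F \<and> f \<in> Hom I i i' \<and>
        VFo (Fa F f) x = x' \<and> VFo (Fa F f) y = y')"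

text \<open>
  Strings are written as in \<open>[e\<^sub>n, \<dots>, e\<^sub>1]\<close>, so the head of the list is the last edge \<open>e\<^sub>n\<close> and
  concatenation of \<open>t\<close> to the left of \<open>s\<close> is \<open>t @ s\<close>. The argument \<open>cl\<close> sends \<open>i\<close> and
  \<open>x \<in> Ob (F i)\<close> to the class of \<open>x\<close> in the colimit of \<open>Ob \<circ> F\<close>.
\<close>

definition strings ::
  "('i, 'f) category \<Rightarrow> ('i, 'f, 'u, 'o, 'm) vdiagram \<Rightarrow> ('i \<Rightarrow> 'u \<Rightarrow> 'u) \<Rightarrow> 'u \<Rightarrow> 'u \<Rightarrow>
   ('i, 'u) edge list set" where
  "strings I F cl a b = {s. s \<noteq> [] \<and> set s \<subseteq> F_edges I F \<and>
     (case last s of (i, x, y) \<Rightarrow> cl i x = a) \<and>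
     (case hd s of (i, x, y) \<Rightarrow> cl i y = b) \<and>
     successively (\<lambda>(i', x', y') (i, x, y). cl i' x' = cl i y) s}"

text \<open>
  \<open>Transport l f e e' r\<close> is the transport from \<open>l @ [e] @ r\<close> to \<open>l @ [e'] @ r\<close> along \<open>f : e \<rightarrow> e'\<close>;
  \<open>Contract l i x y z r\<close> is the contraction from \<open>l @ [(i, y, z), (i, x, y)] @ r\<close> to
  \<open>l @ [(i, x, z)] @ r\<close>.
\<close>

datatype ('i, 'f, 'u) gen =
    Transport "('i, 'u) edge list" 'f "('i, 'u) edge" "('i, 'u) edge" "('i, 'u) edge list"
  | Contract "('i, 'u) edge list" 'i 'u 'u 'u "('i, 'u) edge list"

fun gen_src :: "('i, 'f, 'u) gen \<Rightarrow> ('i, 'u) edge list" where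
  "gen_src (Transport l f e e' r) = l @ [e] @ r"
| "gen_src (Contract l i x y z r) = l @ [(i, y, z), (i, x, y)] @ r"

fun gen_tgt :: "('i, 'f, 'u) gen \<Rightarrow> ('i, 'u) edge list" where
  "gen_tgt (Transport l f e e' r) = l @ [e'] @ r"
| "gen_tgt (Contract l i x y z r) = l @ [(i, x, z)] @ r"

fun gen_ok :: "('i, 'f) category \<Rightarrow> ('i, 'f, 'u, 'o, 'm) vdiagram \<Rightarrow> ('i, 'f, 'u) gen \<Rightarrow> bool" where
  "gen_ok I F (Transport l f e e' r) \<longleftrightarrow> edge_arrow I F f e e'"
| "gen_ok I F (Contract l i x y z r) \<longleftrightarrow> (i, y, z) \<in> F_edges I F \<and> (i, x, y) \<in> F_edges I F"

definition gens ::
  "('i, 'f) category \<Rightarrow> ('i, 'f, 'u, 'o, 'm) vdiagram \<Rightarrow> ('i \<Rightarrow> 'u \<Rightarrow> 'u) \<Rightarrow> 'u \<Rightarrow> 'u \<Rightarrow>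
   ('i, 'f, 'u) gen set" where
  "gens I F cl a b =
     {g. gen_ok I F g \<and> gen_src g \<in> strings I F cl a b \<and> gen_tgt g \<in> strings I F cl a b}"

text \<open>\<open>star_left t \<alpha>\<close> is \<open>id\<^sub>t \<star> \<alpha>\<close> and \<open>star_right \<beta> s\<close> is \<open>\<beta> \<star> id\<^sub>s\<close>.\<close>

fun star_left :: "('i, 'u) edge list \<Rightarrow> ('i, 'f, 'u) gen \<Rightarrow> ('i, 'f, 'u) gen" where
  "star_left t (Transport l f e e' r) = Transport (t @ l) f e e' r"
| "star_left t (Contract l i x y z r) = Contract (t @ l) i x y z r"

fun star_right :: "('i, 'f, 'u) gen \<Rightarrow> ('i, 'u) edge list \<Rightarrow> ('i, 'f, 'u) gen" where
  "star_right (Transport l f e e' r) s = Transport l f e e' (r @ s)"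
| "star_right (Contract l i x y z r) s = Contract l i x y z (r @ s)"

definition interchange ::
  "('i, 'f) category \<Rightarrow> ('i, 'f, 'u, 'o, 'm) vdiagram \<Rightarrow> ('i \<Rightarrow> 'u \<Rightarrow> 'u) \<Rightarrow> 'u \<Rightarrow> 'u \<Rightarrow>
   (('i, 'f, 'u) gen list \<times> ('i, 'f, 'u) gen list) set" where
  "interchange I F cl a c =
     {([star_left (gen_src \<beta>) \<alpha>, star_right \<beta> (gen_tgt \<alpha>)],
       [star_right \<beta> (gen_src \<alpha>), star_left (gen_tgt \<beta>) \<alpha>])
      | \<alpha> \<beta> b. \<alpha> \<in> gens I F cl a b \<and> \<beta> \<in> gens I F cl b c}"

type_synonym ('i, 'f, 'u) string_arr =
  "('i, 'u) edge list \<times> ('i, 'f, 'u) gen list set \<times> ('i, 'u) edge list"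

definition string_cat ::
  "('i, 'f) category \<Rightarrow> ('i, 'f, 'u, 'o, 'm) vdiagram \<Rightarrow> ('i \<Rightarrow> 'u \<Rightarrow> 'u) \<Rightarrow> 'u \<Rightarrow> 'u \<Rightarrow>
   (('i, 'u) edge list, ('i, 'f, 'u) string_arr) category" where
  "string_cat I F cl a b =
     presented_cat (strings I F cl a b) (gens I F cl a b) gen_src gen_tgt (interchange I F cl a b)"


section \<open>String evaluation\<close>

definition edge_hom :: "('i, 'f, 'u, 'o, 'm) vdiagram \<Rightarrow> ('i, 'u) edge \<Rightarrow> 'o" where
  "edge_hom F e = (case e of (i, x, y) \<Rightarrow> VHom (Fo F i) x y)"

definition ev_obj ::
  "('o, 'm) monoidal \<Rightarrow> ('i, 'f, 'u, 'o, 'm) vdiagram \<Rightarrow> ('i, 'u) edge list \<Rightarrow> 'o" where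
  "ev_obj V F s = foldl (\<lambda>A e. tens_o V A (edge_hom F e)) (edge_hom F (hd s)) (tl s)"

definition whisker_right ::
  "('o, 'm) monoidal \<Rightarrow> ('i, 'f, 'u, 'o, 'm) vdiagram \<Rightarrow> 'm \<Rightarrow> ('i, 'u) edge list \<Rightarrow> 'm" where
  "whisker_right V F m r = foldl (\<lambda>h e. tens_a V h (Ident V (edge_hom F e))) m r"

text \<open>
  With left-associated tensor products, a contraction after a non-empty prefix \<open>l\<close> acts on
  \<open>(ev l \<otimes> F i(y,z)) \<otimes> F i(x,y)\<close> and has to be reassociated first.
\<close>

fun ev_gen :: "('o, 'm) monoidal \<Rightarrow> ('i, 'f, 'u, 'o, 'm) vdiagram \<Rightarrow> ('i, 'f, 'u) gen \<Rightarrow> 'm" where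
  "ev_gen V F (Transport l f (i, x, y) e' r) =
     (let h = VFh (Fa F f) x y in
      whisker_right V F (if l = [] then h else tens_a V (Ident V (ev_obj V F l)) h) r)"
| "ev_gen V F (Contract l i x y z r) =
     (let h = VComp (Fo F i) x y z in
      whisker_right V F
        (if l = [] then h
         else Comp V (tens_a V (Ident V (ev_obj V F l)) h)
                (assoc V (ev_obj V F l) (VHom (Fo F i) y z) (VHom (Fo F i) x y))) r)"

fun ev_path ::
  "('o, 'm) monoidal \<Rightarrow> ('i, 'f, 'u, 'o, 'm) vdiagram \<Rightarrow> ('i, 'u) edge list \<Rightarrow> ('i, 'f, 'u) gen list \<Rightarrow> 'm" where
  "ev_path V F s [] = Ident V (ev_obj V F s)"
| "ev_path V F s (g # p) = Comp V (ev_path V F (gen_tgt g) p) (ev_gen V F g)"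

text \<open>By interchange in \<open>\<V>\<close>, the value on a class does not depend on the chosen representative.\<close>

definition ev ::
  "('o, 'm) monoidal \<Rightarrow> ('i, 'f, 'u, 'o, 'm) vdiagram \<Rightarrow>
   (('i, 'u) edge list, ('i, 'f, 'u) string_arr, 'o, 'm) func" where
  "ev V F = \<lparr>
     Fo = ev_obj V F,
     Fa = (\<lambda>(s, P, s'). ev_path V F s (SOME p. p \<in> P))\<rparr>"

text \<open>
  \<open>reassoc V F A B m r\<close> extends \<open>m : A \<otimes> B \<rightarrow> C\<close> to the map
  \<open>A \<otimes> ((B \<otimes> F d\<^sub>1) \<otimes> \<dots> \<otimes> F d\<^sub>k) \<rightarrow> (C \<otimes> F d\<^sub>1) \<otimes> \<dots> \<otimes> F d\<^sub>k\<close> where \<open>r = [d\<^sub>1, \<dots>, d\<^sub>k]\<close>.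
\<close>

fun reassoc ::
  "('o, 'm) monoidal \<Rightarrow> ('i, 'f, 'u, 'o, 'm) vdiagram \<Rightarrow> 'o \<Rightarrow> 'o \<Rightarrow> 'm \<Rightarrow> ('i, 'u) edge list \<Rightarrow> 'm" where
  "reassoc V F A B m [] = m"
| "reassoc V F A B m (d # r) =
     reassoc V F A (tens_o V B (edge_hom F d))
       (Comp V (tens_a V m (Ident V (edge_hom F d))) (inv_arr V (assoc V A B (edge_hom F d)))) r"

definition theta ::
  "('o, 'm) monoidal \<Rightarrow> ('i, 'f, 'u, 'o, 'm) vdiagram \<Rightarrow>
   ('i, 'u) edge list \<Rightarrow> ('i, 'u) edge list \<Rightarrow> 'm" where
  "theta V F t s =
     (let A = ev_obj V F t; B = edge_hom F (hd s)
      in reassoc V F A B (Ident V (tens_o V A B)) (tl s))"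


section \<open>The enriched category built from strings\<close>

text \<open>
  Colimits are determined only up to isomorphism, so the construction is parametrised by a choice
  of the colimiting cocones it uses: of the object sets, of the string evaluations, and of the
  functors \<open>ev \<boxtimes> ev\<close> occurring as the target of \<open>\<mu>\<close>.
\<close>

record ('i, 'u, 'o, 'm) colim_choice =
  Ob_colim :: "'u set"
  Ob_inj :: "'i \<Rightarrow> 'u set_map"
  Hom_colim :: "'u \<Rightarrow> 'u \<Rightarrow> 'o"
  Hom_inj :: "'u \<Rightarrow> 'u \<Rightarrow> ('i, 'u) edge list \<Rightarrow> 'm"
  Box_colim :: "'u \<Rightarrow> 'u \<Rightarrow> 'u \<Rightarrow> 'o"
  Box_inj :: "'u \<Rightarrow> 'u \<Rightarrow> 'u \<Rightarrow> ('i, 'u) edge list \<times> ('i, 'u) edge list \<Rightarrow> 'm"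

definition obj_class :: "('i, 'u, 'o, 'm) colim_choice \<Rightarrow> 'i \<Rightarrow> 'u \<Rightarrow> 'u" where
  "obj_class K i x = set_app (Ob_inj K i) x"

definition is_colim_choice ::
  "('o, 'm) monoidal \<Rightarrow> ('i, 'f) category \<Rightarrow> ('i, 'f, 'u, 'o, 'm) vdiagram \<Rightarrow>
   ('i, 'u, 'o, 'm) colim_choice \<Rightarrow> bool" where
  "is_colim_choice V I F K \<longleftrightarrow>
     is_colimit I Set_cat (comp_func Ob_func F) (Ob_colim K) (Ob_inj K) \<and>
     (\<forall>a\<in>Ob_colim K. \<forall>b\<in>Ob_colim K.
        is_colimit (string_cat I F (obj_class K) a b) V (ev V F) (Hom_colim K a b) (Hom_inj K a b)) \<and>
     (\<forall>a\<in>Ob_colim K. \<forall>b\<in>Ob_colim K. \<forall>c\<in>Ob_colim K.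
        is_colimit (prod_cat (string_cat I F (obj_class K) b c) (string_cat I F (obj_class K) a b)) V
          (box_func V (ev V F) (ev V F)) (Box_colim K a b c) (Box_inj K a b c))"

definition mu ::
  "('o, 'm) monoidal \<Rightarrow> ('i, 'f) category \<Rightarrow> ('i, 'f, 'u, 'o, 'm) vdiagram \<Rightarrow>
   ('i, 'u, 'o, 'm) colim_choice \<Rightarrow> 'u \<Rightarrow> 'u \<Rightarrow> 'u \<Rightarrow> 'm" where
  "mu V I F K a b c = inv_arr V
     (induced_arr
        (prod_cat (string_cat I F (obj_class K) b c) (string_cat I F (obj_class K) a b)) V
        (Box_colim K a b c) (Box_inj K a b c)
        (tens_o V (Hom_colim K b c) (Hom_colim K a b))
        (\<lambda>(t, s). tens_a V (Hom_inj K b c t) (Hom_inj K a b s)))"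

definition colim_star_theta ::
  "('o, 'm) monoidal \<Rightarrow> ('i, 'f) category \<Rightarrow> ('i, 'f, 'u, 'o, 'm) vdiagram \<Rightarrow>
   ('i, 'u, 'o, 'm) colim_choice \<Rightarrow> 'u \<Rightarrow> 'u \<Rightarrow> 'u \<Rightarrow> 'm" where
  "colim_star_theta V I F K a b c =
     induced_arr
       (prod_cat (string_cat I F (obj_class K) b c) (string_cat I F (obj_class K) a b)) V
       (Box_colim K a b c) (Box_inj K a b c)
       (Hom_colim K a c)
       (\<lambda>(t, s). Comp V (Hom_inj K a c (t @ s)) (theta V F t s))"

text \<open>The unit map at \<open>a\<close>, computed from a representative \<open>x \<in> Ob (F i)\<close> of \<open>a\<close>.\<close>

definition string_unit ::
  "('o, 'm) monoidal \<Rightarrow> ('i, 'f, 'u, 'o, 'm) vdiagram \<Rightarrow>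
   ('i, 'u, 'o, 'm) colim_choice \<Rightarrow> 'i \<Rightarrow> 'u \<Rightarrow> 'm" where
  "string_unit V F K i x =
     (let a = obj_class K i x in Comp V (Hom_inj K a a [(i, x, x)]) (VUnit (Fo F i) x))"

definition string_vcat ::
  "('o, 'm) monoidal \<Rightarrow> ('i, 'f) category \<Rightarrow> ('i, 'f, 'u, 'o, 'm) vdiagram \<Rightarrow>
   ('i, 'u, 'o, 'm) colim_choice \<Rightarrow> ('u, 'o, 'm) vcat" where
  "string_vcat V I F K = (let X = Ob_colim K in \<lparr>
     VOb = X,
     VHom = (\<lambda>a b. if a \<in> X \<and> b \<in> X then Hom_colim K a b else undefined),
     VUnit = (\<lambda>a. if a \<in> X
        then THE u. \<exists>i\<in>Obj I. \<exists>x\<in>VOb (Fo F i). obj_class K i x = a \<and> u = string_unit V F K i x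
        else undefined),
     VComp = (\<lambda>a b c. if a \<in> X \<and> b \<in> X \<and> c \<in> X
        then Comp V (colim_star_theta V I F K a b c) (mu V I F K a b c)
        else undefined)\<rparr>)"

definition string_inj ::
  "('o, 'm) monoidal \<Rightarrow> ('i, 'f) category \<Rightarrow> ('i, 'f, 'u, 'o, 'm) vdiagram \<Rightarrow>
   ('i, 'u, 'o, 'm) colim_choice \<Rightarrow> 'i \<Rightarrow> ('u, 'o, 'm) vfun" where
  "string_inj V I F K i = \<lparr>
     VSrc = Fo F i,
     VTgt = string_vcat V I F K,
     VFo = (\<lambda>x. if x \<in> VOb (Fo F i) then obj_class K i x else undefined),
     VFh = (\<lambda>x y. if x \<in> VOb (Fo F i) \<and> y \<in> VOb (Fo F i)
        then Hom_inj K (obj_class K i x) (obj_class K i y) [(i, x, y)]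
        else undefined)\<rparr>"

end

theory Submission
  imports Defs
begin

text \<open>
  Every fact about a string evaluation reduces to its behaviour on generators, and every
  generator is a transport or contraction at the right end of a string, tensored on the right with
  identities. Reassociation \<open>\<theta>\<close> is natural in both strings and coherently associative, so
  interchange in \<open>\<V>\<close> makes the evaluation functorial, and composition is characterised by
  \<open>cmp \<cdot> (\<iota> t \<star> \<iota> s) = \<iota> (t @ s) \<cdot> \<theta> t s\<close>: since \<open>\<otimes>\<close> is cocontinuous, tensor products of the
  colimiting cocones are again colimiting, hence jointly epic. The unit laws hold because
  inserting a unit edge and contracting it is the identity. A cocone \<open>\<Gamma>\<close> of enriched functors to
  \<open>D\<close> sends a string to the composite in \<open>D\<close> of the images of its edges; this is a cocone on the
  evaluation because each \<open>\<Gamma> i\<close> is a functor, and any enriched functor compatible with \<open>\<Gamma>\<close> is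
  forced to take these values since every string is a concatenation of edges.
\<close>

section \<open>Categories and colimits\<close>

text \<open>Left-associated evaluation makes the two ends of a string unlike: an edge appended on
  the right adds a tensor factor by definition, whereas an edge prepended on the left changes every
  bracketing. Inductions on strings therefore run from the right end, and the pentagon and the
  derived unit coherences enter where a left factor has to be moved through the bracketing.
  Cocompleteness and cocontinuity speak of index categories with objects and arrows in
  \<open>'u\<close>, while string categories consist of lists and of classes of paths; small index
  categories are therefore copied into \<open>'u\<close>. The unit at a class is defined from a
  representative, and its independence is an equation between arrows of \<open>V\<close>, whose type
  is unrelated to \<open>'u\<close>. The universal property in \<open>Set_cat\<close> does not reach
  such values. What is needed instead is that elements with the same class are joined by a zigzag of
  transports, for every choice of the colimit of object sets.\<close>

lemma in_Hom_iff [simp]: "f \<in> Hom C a b \<longleftrightarrow> f \<in> Arr C \<and> Dom C f = a \<and> Cod C f = b"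
  by (simp add: Hom_def)

locale cat =
  fixes C :: "('o, 'm, 'z) category_scheme"
  assumes is_category: "is_category C"
begin

abbreviation comp (infixr "\<cdot>" 55) where "g \<cdot> f \<equiv> Comp C g f"

lemma dom_obj [simp]: "f \<in> Arr C \<Longrightarrow> Dom C f \<in> Obj C"
  and cod_obj [simp]: "f \<in> Arr C \<Longrightarrow> Cod C f \<in> Obj C"
  using is_category by (auto simp: is_category_def)

lemma ident [simp]:
  assumes "a \<in> Obj C"
  shows "Ident C a \<in> Arr C" "Dom C (Ident C a) = a" "Cod C (Ident C a) = a"
  using is_category assms by (auto simp: is_category_def)

lemma comp_arr [simp]:
  assumes "f \<in> Arr C" "g \<in> Arr C" "Cod C f = Dom C g"
  shows "g \<cdot> f \<in> Arr C" "Dom C (g \<cdot> f) = Dom C f" "Cod C (g \<cdot> f) = Cod C g"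
  using is_category assms by (auto simp: is_category_def)

lemma comp_ident [simp]:
  assumes "f \<in> Arr C"
  shows "Dom C f = a \<Longrightarrow> f \<cdot> Ident C a = f" "Cod C f = a \<Longrightarrow> Ident C a \<cdot> f = f"
  using is_category assms by (auto simp: is_category_def)

lemma comp_assoc [simp]:
  assumes "f \<in> Arr C" "g \<in> Arr C" "h \<in> Arr C" "Cod C f = Dom C g" "Cod C g = Dom C h"
  shows "(h \<cdot> g) \<cdot> f = h \<cdot> g \<cdot> f"
  using is_category assms by (simp add: is_category_def)

text \<open>Composites are kept nested to the right, so an equation for \<open>g \<cdot> f\<close>
  no longer matches once a further arrow \<open>h\<close> is applied before it. This is its form in
  that context.\<close>

lemma comp_tail:
  assumes "g \<cdot> f = k" "f \<in> Arr C" "g \<in> Arr C" "h \<in> Arr C" "Cod C h = Dom C f" "Cod C f = Dom C g"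
  shows "g \<cdot> f \<cdot> h = k \<cdot> h"
  using assms by (simp flip: comp_assoc add: assms(1) del: comp_assoc)

section \<open>Inverses and isomorphisms\<close>

lemma inverse_unique:
  assumes "inverse_arrows C f g" "inverse_arrows C f h"
  shows "g = h"
proof -
  have [simp]: "f \<in> Arr C" "g \<in> Arr C" "Dom C g = Cod C f" "Cod C g = Dom C f"
    "h \<in> Arr C" "Dom C h = Cod C f" "Cod C h = Dom C f"
    and gf: "g \<cdot> f = Ident C (Dom C f)" and fh: "f \<cdot> h = Ident C (Cod C f)"
    using assms by (auto simp: inverse_arrows_def)
  have "g = g \<cdot> f \<cdot> h" by (simp add: fh)
  also have "\<dots> = (g \<cdot> f) \<cdot> h" by (simp del: comp_assoc add: comp_assoc[symmetric])
  also have "\<dots> = h" by (simp add: gf del: comp_assoc)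
  finally show ?thesis .
qed

lemma inv_arr_eq: "inverse_arrows C f g \<Longrightarrow> inv_arr C f = g"
  unfolding inv_arr_def by (blast intro: the_equality inverse_unique)

lemma inverse_arrows_inv_arr: "is_iso C f \<Longrightarrow> inverse_arrows C f (inv_arr C f)"
  using inv_arr_eq by (auto simp: is_iso_def)

lemma inv_arr_in [simp]:
  assumes "is_iso C f"
  shows "inv_arr C f \<in> Arr C" "Dom C (inv_arr C f) = Cod C f" "Cod C (inv_arr C f) = Dom C f"
  using inverse_arrows_inv_arr[OF assms] by (auto simp: inverse_arrows_def)

lemma comp_inv_arr [simp]:
  assumes "is_iso C f"
  shows "f \<cdot> inv_arr C f = Ident C (Cod C f)" "inv_arr C f \<cdot> f = Ident C (Dom C f)"
  using inverse_arrows_inv_arr[OF assms] by (auto simp: inverse_arrows_def)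

lemma is_iso_arr: "is_iso C f \<Longrightarrow> f \<in> Arr C"
  by (auto simp: is_iso_def inverse_arrows_def)

lemma comp_inv_arr_tail [simp]:
  assumes "is_iso C f" "h \<in> Arr C"
  shows "Cod C h = Cod C f \<Longrightarrow> f \<cdot> inv_arr C f \<cdot> h = h"
    and "Cod C h = Dom C f \<Longrightarrow> inv_arr C f \<cdot> f \<cdot> h = h"
  using assms is_iso_arr[OF assms(1)]
  by (simp_all add: comp_assoc[symmetric] del: comp_assoc)

lemma iso_cancel_left:
  assumes "is_iso C f" "f \<cdot> g = f \<cdot> h" "g \<in> Arr C" "h \<in> Arr C"
    "Cod C g = Dom C f" "Cod C h = Dom C f"
  shows "g = h"
  using assms comp_inv_arr_tail(2)[OF assms(1)] by metis

lemma iso_cancel_right: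
  assumes "is_iso C f" "g \<cdot> f = h \<cdot> f" "g \<in> Arr C" "h \<in> Arr C"
    "Dom C g = Cod C f" "Dom C h = Cod C f"
  shows "g = h"
proof -
  have "(g \<cdot> f) \<cdot> inv_arr C f = (h \<cdot> f) \<cdot> inv_arr C f" using assms(2) by simp
  then show ?thesis using assms(1,3-) is_iso_arr[OF assms(1)] by simp
qed

lemma is_isoI:
  assumes "f \<in> Arr C" "g \<in> Arr C" "Dom C g = Cod C f" "Cod C g = Dom C f"
    "g \<cdot> f = Ident C (Dom C f)" "f \<cdot> g = Ident C (Cod C f)"
  shows "is_iso C f"
  using assms by (auto simp: is_iso_def inverse_arrows_def)

lemma is_iso_ident [simp]: "a \<in> Obj C \<Longrightarrow> is_iso C (Ident C a)"
  by (rule is_isoI[where g = "Ident C a"]) auto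

lemma is_iso_comp [simp]:
  assumes "is_iso C f" "is_iso C g" "Cod C f = Dom C g"
  shows "is_iso C (g \<cdot> f)"
proof (rule is_isoI)
  note [simp] = is_iso_arr[OF assms(1)] is_iso_arr[OF assms(2)] assms
  show "(inv_arr C f \<cdot> inv_arr C g) \<cdot> g \<cdot> f = Ident C (Dom C (g \<cdot> f))"
    "(g \<cdot> f) \<cdot> inv_arr C f \<cdot> inv_arr C g = Ident C (Cod C (g \<cdot> f))"
    by simp_all
qed (use assms is_iso_arr[OF assms(1)] is_iso_arr[OF assms(2)] in simp_all)

lemma is_iso_inv_arr [simp]: "is_iso C f \<Longrightarrow> is_iso C (inv_arr C f)"
  by (rule is_isoI[where g = f]) (auto simp: is_iso_arr)

end

section \<open>Functors, cocones and mediating arrows\<close>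

lemma functorD:
  assumes "is_functor C D G"
  shows "is_category C" "is_category D"
    "\<And>a. a \<in> Obj C \<Longrightarrow> Fo G a \<in> Obj D"
    "\<And>f. f \<in> Arr C \<Longrightarrow> Fa G f \<in> Arr D"
    "\<And>f. f \<in> Arr C \<Longrightarrow> Dom D (Fa G f) = Fo G (Dom C f)"
    "\<And>f. f \<in> Arr C \<Longrightarrow> Cod D (Fa G f) = Fo G (Cod C f)"
    "\<And>a. a \<in> Obj C \<Longrightarrow> Fa G (Ident C a) = Ident D (Fo G a)"
    "\<And>f g. f \<in> Arr C \<Longrightarrow> g \<in> Arr C \<Longrightarrow> Cod C f = Dom C g \<Longrightarrow>
      Fa G (Comp C g f) = Comp D (Fa G g) (Fa G f)"
  using assms unfolding is_functor_def by auto

lemma is_functor_comp_func: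
  assumes "is_functor C D G" "is_functor D E H"
  shows "is_functor C E (comp_func H G)"
  using assms unfolding is_functor_def comp_func_def by auto

lemma coconeD:
  assumes "is_cocone J C G c \<iota>"
  shows "is_functor J C G" "c \<in> Obj C"
    "\<And>j. j \<in> Obj J \<Longrightarrow> \<iota> j \<in> Arr C"
    "\<And>j. j \<in> Obj J \<Longrightarrow> Dom C (\<iota> j) = Fo G j"
    "\<And>j. j \<in> Obj J \<Longrightarrow> Cod C (\<iota> j) = c"
    "\<And>f. f \<in> Arr J \<Longrightarrow> Comp C (\<iota> (Cod J f)) (Fa G f) = \<iota> (Dom J f)"
  using assms unfolding is_cocone_def by auto

lemma colimit_cocone: "is_colimit J C G c \<iota> \<Longrightarrow> is_cocone J C G c \<iota>"
  by (simp add: is_colimit_def)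

lemma induced_arr:
  assumes "is_colimit J C G c \<iota>" "is_cocone J C G d \<kappa>"
  shows "induced_arr J C c \<iota> d \<kappa> \<in> Arr C"
    "Dom C (induced_arr J C c \<iota> d \<kappa>) = c"
    "Cod C (induced_arr J C c \<iota> d \<kappa>) = d"
    "\<And>j. j \<in> Obj J \<Longrightarrow> Comp C (induced_arr J C c \<iota> d \<kappa>) (\<iota> j) = \<kappa> j"
proof -
  have "\<exists>!u. u \<in> Hom C c d \<and> (\<forall>j\<in>Obj J. Comp C u (\<iota> j) = \<kappa> j)"
    using assms unfolding is_colimit_def by blast
  from theI'[OF this] show "induced_arr J C c \<iota> d \<kappa> \<in> Arr C"
    "Dom C (induced_arr J C c \<iota> d \<kappa>) = c"
    "Cod C (induced_arr J C c \<iota> d \<kappa>) = d"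
    "\<And>j. j \<in> Obj J \<Longrightarrow> Comp C (induced_arr J C c \<iota> d \<kappa>) (\<iota> j) = \<kappa> j"
    unfolding induced_arr_def[symmetric] by auto
qed

lemma cocone_post:
  assumes "is_cocone J C G c \<iota>" "u \<in> Arr C" "Dom C u = c"
  shows "is_cocone J C G (Cod C u) (\<lambda>j. Comp C u (\<iota> j))"
proof -
  note G = functorD[OF coconeD(1)[OF assms(1)]]
  interpret cat C using G by unfold_locales
  have J: "Dom J f \<in> Obj J" "Cod J f \<in> Obj J" if "f \<in> Arr J" for f
    using G(1) that by (auto simp: is_category_def)
  show ?thesis
    using assms coconeD[OF assms(1)] G J by (simp add: is_cocone_def)
qed

text \<open>Both arrows mediate the cocone obtained from \<open>\<iota>\<close> by composing with
  \<open>u\<close>, so uniqueness identifies them: colimiting legs are jointly epic.\<close>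

lemma colimit_ext:
  assumes "is_colimit J C G c \<iota>" "u \<in> Arr C" "v \<in> Arr C"
    "Dom C u = c" "Dom C v = c" "Cod C u = Cod C v"
    "\<And>j. j \<in> Obj J \<Longrightarrow> Comp C u (\<iota> j) = Comp C v (\<iota> j)"
  shows "u = v"
proof -
  have "is_cocone J C G (Cod C u) (\<lambda>j. Comp C u (\<iota> j))"
    using assms by (intro cocone_post) (auto simp: is_colimit_def)
  then have "\<exists>!w. w \<in> Hom C c (Cod C u) \<and> (\<forall>j\<in>Obj J. Comp C w (\<iota> j) = Comp C u (\<iota> j))"
    using assms(1) unfolding is_colimit_def by blast
  moreover have "u \<in> Hom C c (Cod C u)" "v \<in> Hom C c (Cod C u)"
    using assms(2-6) by simp_all
  ultimately show ?thesis using assms(7) by metis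
qed

text \<open>Each composite agrees with an identity on jointly epic legs. For
  \<open>Box_colim\<close> and the tensor product of hom colimits this identifies \<open>mu\<close>;
  in \<open>Set_cat\<close> it compares an arbitrary colimit with the quotient construction.\<close>

lemma colimit_induced_inverse:
  assumes "is_colimit J C G c \<iota>" "is_colimit J C G c' \<iota>'"
  shows "inverse_arrows C (induced_arr J C c \<iota> c' \<iota>') (induced_arr J C c' \<iota>' c \<iota>)"
proof -
  note cc = colimit_cocone[OF assms(1)] colimit_cocone[OF assms(2)]
  interpret cat C using functorD[OF coconeD(1)[OF cc(1)]] by unfold_locales
  note u = induced_arr[OF assms(1) cc(2)] and v = induced_arr[OF assms(2) cc(1)]
  note [simp] = coconeD(2-5)[OF cc(1)] coconeD(2-5)[OF cc(2)] u v
  have "induced_arr J C c' \<iota>' c \<iota> \<cdot> induced_arr J C c \<iota> c' \<iota>' = Ident C c"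
    by (rule colimit_ext[OF assms(1)]) auto
  moreover have "induced_arr J C c \<iota> c' \<iota>' \<cdot> induced_arr J C c' \<iota>' c \<iota> = Ident C c'"
    by (rule colimit_ext[OF assms(2)]) auto
  ultimately show ?thesis by (simp add: inverse_arrows_def)
qed

lemma is_cocone_cong:
  assumes "is_category J" "\<And>j. j \<in> Obj J \<Longrightarrow> \<iota> j = \<iota>' j"
  shows "is_cocone J C G c \<iota> \<longleftrightarrow> is_cocone J C G c \<iota>'"
proof -
  interpret cat J using assms(1) by unfold_locales
  show ?thesis by (simp add: is_cocone_def assms(2) cong: conj_cong)
qed

text \<open>Legs are total functions of which only the values on objects matter. Reindexing back and
  forth returns the original legs on objects only.\<close>

lemma is_colimit_cong:
  assumes "is_category J" "\<And>j. j \<in> Obj J \<Longrightarrow> \<iota> j = \<iota>' j"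
  shows "is_colimit J C G c \<iota> \<longleftrightarrow> is_colimit J C G c \<iota>'"
  using is_cocone_cong[where \<iota> = \<iota> and \<iota>' = \<iota>' and C = C and G = G and c = c, OF assms] assms(2)
  by (simp add: is_colimit_def del: in_Hom_iff)

lemma is_colimitI:
  assumes "is_cocone J C G c \<iota>"
    "\<And>d \<kappa>. is_cocone J C G d \<kappa> \<Longrightarrow> \<exists>u. u \<in> Hom C c d \<and> (\<forall>j\<in>Obj J. Comp C u (\<iota> j) = \<kappa> j)"
    "\<And>u v. u \<in> Arr C \<Longrightarrow> v \<in> Arr C \<Longrightarrow> Dom C u = c \<Longrightarrow> Dom C v = c \<Longrightarrow> Cod C u = Cod C v \<Longrightarrow>
      (\<And>j. j \<in> Obj J \<Longrightarrow> Comp C u (\<iota> j) = Comp C v (\<iota> j)) \<Longrightarrow> u = v"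
  shows "is_colimit J C G c \<iota>"
  unfolding is_colimit_def
proof (intro conjI allI impI ex_ex1I)
  fix d \<kappa> u v
  assume "u \<in> Hom C c d \<and> (\<forall>j\<in>Obj J. Comp C u (\<iota> j) = \<kappa> j)"
    "v \<in> Hom C c d \<and> (\<forall>j\<in>Obj J. Comp C v (\<iota> j) = \<kappa> j)"
  then show "u = v" by - (rule assms(3), auto)
qed (use assms(1,2) in blast)+


subsection \<open>Reindexing along an isomorphism of categories\<close>

text \<open>The inverse laws are strict but required on the carriers only. Colimits transport along
  such a pair in both directions, which brings small index categories over other types within reach
  of \<open>cocomplete\<close> and \<open>cocontinuous\<close>.\<close>

locale cat_isomorphism =
  fixes J :: "('j, 'k, 'z) category_scheme" and J' :: "('j', 'k', 'y) category_scheme"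
    and P :: "('j, 'k, 'j', 'k') func" and Q :: "('j', 'k', 'j, 'k) func"
  assumes P: "is_functor J J' P" and Q: "is_functor J' J Q"
    and QP: "\<And>j. j \<in> Obj J \<Longrightarrow> Fo Q (Fo P j) = j" "\<And>f. f \<in> Arr J \<Longrightarrow> Fa Q (Fa P f) = f"
    and PQ: "\<And>j. j \<in> Obj J' \<Longrightarrow> Fo P (Fo Q j) = j" "\<And>f. f \<in> Arr J' \<Longrightarrow> Fa P (Fa Q f) = f"
begin

lemma cocone_reindex:
  assumes "is_cocone J C G c \<iota>"
  shows "is_cocone J' C (comp_func G Q) c (\<lambda>j. \<iota> (Fo Q j))"
proof -
  have "Comp C (\<iota> (Fo Q (Cod J' f))) (Fa G (Fa Q f)) = \<iota> (Fo Q (Dom J' f))" if "f \<in> Arr J'" for f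
    using coconeD(6)[OF assms, of "Fa Q f"] that functorD(4-6)[OF Q] by simp
  then show ?thesis
    using coconeD(2-5)[OF assms] is_functor_comp_func[OF Q coconeD(1)[OF assms]] functorD(3)[OF Q]
    by (simp add: is_cocone_def comp_func_def)
qed

lemma cocone_reindex_back:
  assumes "is_cocone J' C (comp_func G Q) c \<kappa>" "is_functor J C G"
  shows "is_cocone J C G c (\<lambda>j. \<kappa> (Fo P j))"
proof -
  have "Comp C (\<kappa> (Fo P (Cod J f))) (Fa G f) = \<kappa> (Fo P (Dom J f))" if "f \<in> Arr J" for f
    using coconeD(6)[OF assms(1), of "Fa P f"] that functorD(4-6)[OF P] QP(2)
    by (simp add: comp_func_def)
  then show ?thesis
    using coconeD(2-5)[OF assms(1)] assms(2) functorD(3)[OF P] QP(1)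
    by (simp add: is_cocone_def comp_func_def)
qed

lemma colimit_reindex:
  assumes "is_colimit J C G c \<iota>"
  shows "is_colimit J' C (comp_func G Q) c (\<lambda>j. \<iota> (Fo Q j))"
proof (rule is_colimitI)
  show "is_cocone J' C (comp_func G Q) c (\<lambda>j. \<iota> (Fo Q j))"
    using assms by (intro cocone_reindex) (simp add: is_colimit_def)
next
  fix d \<kappa> assume "is_cocone J' C (comp_func G Q) d \<kappa>"
  then have "is_cocone J C G d (\<lambda>j. \<kappa> (Fo P j))"
    using assms by (intro cocone_reindex_back) (auto simp: is_colimit_def is_cocone_def)
  note u = induced_arr[OF assms this]
  show "\<exists>u. u \<in> Hom C c d \<and> (\<forall>j\<in>Obj J'. Comp C u (\<iota> (Fo Q j)) = \<kappa> j)"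
    by (intro exI[of _ "induced_arr J C c \<iota> d (\<lambda>j. \<kappa> (Fo P j))"])
       (simp add: u functorD[OF Q] PQ)
next
  fix u v
  assume uv: "u \<in> Arr C" "v \<in> Arr C" "Dom C u = c" "Dom C v = c" "Cod C u = Cod C v"
    and eq: "\<And>j. j \<in> Obj J' \<Longrightarrow> Comp C u (\<iota> (Fo Q j)) = Comp C v (\<iota> (Fo Q j))"
  show "u = v"
    by (rule colimit_ext[OF assms uv]) (use eq[OF functorD(3)[OF P]] QP(1) in simp)
qed

lemma colimit_reindex_back:
  assumes "is_colimit J' C (comp_func G Q) c \<kappa>" "is_functor J C G"
  shows "is_colimit J C G c (\<lambda>j. \<kappa> (Fo P j))"
proof (rule is_colimitI)
  show "is_cocone J C G c (\<lambda>j. \<kappa> (Fo P j))"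
    using assms by (intro cocone_reindex_back) (auto simp: is_colimit_def)
next
  fix d \<iota> assume "is_cocone J C G d \<iota>"
  note u = induced_arr[OF assms(1) cocone_reindex[OF this]]
  show "\<exists>u. u \<in> Hom C c d \<and> (\<forall>j\<in>Obj J. Comp C u (\<kappa> (Fo P j)) = \<iota> j)"
    by (intro exI[of _ "induced_arr J' C c \<kappa> d (\<lambda>j. \<iota> (Fo Q j))"])
       (simp add: u functorD[OF P] QP)
next
  fix u v
  assume uv: "u \<in> Arr C" "v \<in> Arr C" "Dom C u = c" "Dom C v = c" "Cod C u = Cod C v"
    and eq: "\<And>j. j \<in> Obj J \<Longrightarrow> Comp C u (\<kappa> (Fo P j)) = Comp C v (\<kappa> (Fo P j))"
  show "u = v"
    by (rule colimit_ext[OF assms(1) uv]) (use eq[OF functorD(3)[OF Q]] PQ(1) in simp)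
qed

end

text \<open>Smallness gives injections of objects and arrows into \<open>'u\<close>; the structure
  is carried over along them, and \<open>inv_into\<close> provides the inverse functor.\<close>

lemma small_copy:
  fixes J :: "('j, 'k, 'z) category_scheme"
  assumes "small_category TYPE('u) J"
  obtains J' :: "('u, 'u) category" and P Q
  where "small_category TYPE('u) J'" "cat_isomorphism J J' P Q"
proof -
  interpret cat J using assms by unfold_locales (simp add: small_category_def)
  obtain h :: "'j \<Rightarrow> 'u" where h: "inj_on h (Obj J)"
    using assms card_of_ordLeq[of "Obj J" "UNIV :: 'u set"]
    by (auto simp: small_category_def small_def dest: ordLess_imp_ordLeq)
  obtain k :: "'k \<Rightarrow> 'u" where k: "inj_on k (Arr J)"
    using assms card_of_ordLeq[of "Arr J" "UNIV :: 'u set"]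
    by (auto simp: small_category_def small_def dest: ordLess_imp_ordLeq)
  define h' where "h' = inv_into (Obj J) h"
  define k' where "k' = inv_into (Arr J) k"
  have [simp]: "h' (h a) = a" if "a \<in> Obj J" for a using that h by (simp add: h'_def)
  have [simp]: "k' (k a) = a" if "a \<in> Arr J" for a using that k by (simp add: k'_def)
  define J' :: "('u, 'u) category" where
    "J' = \<lparr>Obj = h ` Obj J, Arr = k ` Arr J, Dom = (\<lambda>f. h (Dom J (k' f))),
      Cod = (\<lambda>f. h (Cod J (k' f))), Ident = (\<lambda>a. k (Ident J (h' a))),
      Comp = (\<lambda>g f. k (Comp J (k' g) (k' f)))\<rparr>"
  define P where "P = \<lparr>Fo = h, Fa = k\<rparr>"
  define Q where "Q = \<lparr>Fo = h', Fa = k'\<rparr>"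
  have [simp]: "h a = h b \<longleftrightarrow> a = b" if "a \<in> Obj J" "b \<in> Obj J" for a b
    using that h by (auto simp: inj_on_def)
  have J': "is_category J'"
    by (simp add: is_category_def J'_def)
  have "is_functor J J' P"
    using J' is_category by (simp add: is_functor_def J'_def P_def)
  moreover have "is_functor J' J Q"
    using J' is_category by (simp add: is_functor_def J'_def Q_def)
  ultimately have "cat_isomorphism J J' P Q"
    by unfold_locales (auto simp: J'_def P_def Q_def)
  moreover have "small_category TYPE('u) J'"
    using assms J' by (auto simp: small_category_def small_def J'_def
      intro: ordLeq_ordLess_trans[OF card_of_image])
  ultimately show thesis using that by blast
qed

lemma cocomplete_small:
  assumes "cocomplete TYPE('u) C" "small_category TYPE('u) J" "is_functor J C G"
  shows "\<exists>c \<iota>. is_colimit J C G c \<iota>"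
proof -
  obtain J' :: "('u, 'u) category" and P Q
    where J': "small_category TYPE('u) J'" and iso: "cat_isomorphism J J' P Q"
    using small_copy[OF assms(2)] .
  interpret cat_isomorphism J J' P Q by (rule iso)
  obtain c \<iota> where "is_colimit J' C (comp_func G Q) c \<iota>"
    using assms(1) J' is_functor_comp_func[OF Q assms(3)] unfolding cocomplete_def by blast
  from colimit_reindex_back[OF this assms(3)] show ?thesis by blast
qed

lemma cocontinuous_small:
  assumes "cocontinuous TYPE('u) C D T" "small_category TYPE('u) J" "is_colimit J C G c \<iota>"
  shows "is_colimit J D (comp_func T G) (Fo T c) (\<lambda>j. Fa T (\<iota> j))"
proof -
  obtain J' :: "('u, 'u) category" and P Q
    where J': "small_category TYPE('u) J'" and iso: "cat_isomorphism J J' P Q"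
    using small_copy[OF assms(2)] .
  interpret cat_isomorphism J J' P Q by (rule iso)
  have "is_colimit J' D (comp_func T (comp_func G Q)) (Fo T c) (\<lambda>j. Fa T (\<iota> (Fo Q j)))"
    using assms(1) J' colimit_reindex[OF assms(3)] unfolding cocontinuous_def by blast
  then have "is_colimit J' D (comp_func (comp_func T G) Q) (Fo T c) (\<lambda>j. Fa T (\<iota> (Fo Q j)))"
    by (simp add: comp_func_def)
  moreover have G: "is_functor J C G"
    using assms(3) by (simp add: is_colimit_def is_cocone_def)
  moreover have "is_functor C D T" using assms(1) by (simp add: cocontinuous_def)
  \<comment> \<open>Reindexing back yields legs at \<open>Fo Q (Fo P j)\<close>, which equals
    \<open>j\<close> on objects only; the congruence that follows removes this detour.\<close>
  ultimately have "is_colimit J D (comp_func T G) (Fo T c) (\<lambda>j. Fa T (\<iota> (Fo Q (Fo P j))))"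
    using is_functor_comp_func by (intro colimit_reindex_back) auto
  moreover have "is_colimit J D (comp_func T G) (Fo T c) (\<lambda>j. Fa T (\<iota> (Fo Q (Fo P j)))) \<longleftrightarrow>
    is_colimit J D (comp_func T G) (Fo T c) (\<lambda>j. Fa T (\<iota> j))"
    by (rule is_colimit_cong) (simp_all add: QP(1) functorD(1)[OF P])
  ultimately show ?thesis by simp
qed


subsection \<open>Size\<close>

context
  fixes U :: "'u itself"
  assumes universe: "universe_type TYPE('u)"
begin

lemma infinite_universe: "infinite (UNIV :: 'u set)"
  using universe by (metis card_of_ordLeq_infinite infinite_UNIV_nat ordLess_imp_ordLeq universe_type_def)

lemma small_subset: "small TYPE('u) B \<Longrightarrow> A \<subseteq> B \<Longrightarrow> small TYPE('u) A"
  unfolding small_def by (meson card_of_mono1 ordLeq_ordLess_trans)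

lemma small_image: "small TYPE('u) A \<Longrightarrow> small TYPE('u) (f ` A)"
  unfolding small_def by (meson card_of_image ordLeq_ordLess_trans)

lemma small_nat: "small TYPE('u) (UNIV :: nat set)"
  using universe by (simp add: small_def universe_type_def)

lemma small_countable: "small TYPE('u) (A :: nat set)"
  using small_subset[OF small_nat] by simp

text \<open>This is where regularity of the universe enters. Closure under dependent sums, binary
  unions and lists is derived from it.\<close>

lemma small_UN:
  assumes "small TYPE('u) A" "\<And>a. a \<in> A \<Longrightarrow> small TYPE('u) (B a)"
  shows "small TYPE('u) (\<Union>a\<in>A. B a)"
  unfolding small_def
proof (rule card_of_UNION_ordLess_infinite_Field_regularCard)
  show "Cinfinite |UNIV :: 'u set|"
    unfolding cinfinite_def using infinite_universe
    by (intro conjI card_of_Card_order) (simp add: Field_card_of)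
qed (use assms universe in \<open>auto simp: small_def universe_type_def\<close>)

lemma small_Sigma:
  assumes "small TYPE('u) A" "\<And>a. a \<in> A \<Longrightarrow> small TYPE('u) (B a)"
  shows "small TYPE('u) (Sigma A B)"
proof -
  have "Sigma A B = (\<Union>a\<in>A. Pair a ` B a)" by auto
  then show ?thesis using assms by (simp add: small_UN small_image)
qed

lemma small_Un:
  assumes "small TYPE('u) A" "small TYPE('u) B"
  shows "small TYPE('u) (A \<union> B)"
proof -
  have "A \<union> B = (\<Union>b\<in>{0::nat, 1}. if b = 0 then A else B)" by auto
  then show ?thesis using assms by (simp only:) (rule small_UN, auto intro: small_countable)
qed

text \<open>Lists are sorted by length. That the set of lengths is a small index set is the
  uncountability of the universe.\<close>

lemma small_lists:
  assumes "small TYPE('u) A"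
  shows "small TYPE('u) (lists A)"
proof -
  have "small TYPE('u) {xs \<in> lists A. length xs = n}" for n
  proof (induction n)
    case 0
    have "{xs \<in> lists A. length xs = 0} = (\<lambda>_. []) ` {0::nat}" by auto
    then show ?case by (simp only:) (rule small_image[OF small_countable])
  next
    case (Suc n)
    have "{xs \<in> lists A. length xs = Suc n} =
      (\<lambda>(x, xs). x # xs) ` (A \<times> {xs \<in> lists A. length xs = n})"
      by (auto simp: length_Suc_conv image_iff)
    then show ?case using assms Suc by (simp only:) (intro small_image small_Sigma)
  qed
  then have "small TYPE('u) (\<Union>n. {xs \<in> lists A. length xs = n})"
    by (intro small_UN[OF small_nat])
  then show ?thesis by (rule small_subset) auto
qed

end


section \<open>Colimits of sets\<close>

lemma Set_cat_simps [simp]: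
  "A \<in> Obj (Set_cat :: ('u set, 'u set_map) category) \<longleftrightarrow> small TYPE('u) A"
  "Dom Set_cat f = fst f" "Cod Set_cat f = snd (snd f)"
  "Ident Set_cat A = (A, \<lambda>x. if x \<in> A then x else undefined, A)"
  "Comp Set_cat g f = (fst f, \<lambda>x. if x \<in> fst f then set_app g (set_app f x) else undefined, snd (snd g))"
  by (auto simp: Set_cat_def set_app_def split: prod.splits)

lemma Set_cat_arr:
  "f \<in> Arr (Set_cat :: ('u set, 'u set_map) category) \<longleftrightarrow>
     small TYPE('u) (fst f) \<and> small TYPE('u) (snd (snd f)) \<and>
     (\<forall>x\<in>fst f. set_app f x \<in> snd (snd f)) \<and> (\<forall>x. x \<notin> fst f \<longrightarrow> set_app f x = undefined)"
  by (cases f) (auto simp: Set_cat_def set_app_def)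

lemma set_app_simp [simp]: "set_app (A, f, B) = f"
  by (simp add: set_app_def fun_eq_iff)

lemma set_map_eqI:
  assumes "f \<in> Arr Set_cat" "g \<in> Arr Set_cat" "fst f = fst g" "snd (snd f) = snd (snd g)"
    "\<And>x. x \<in> fst f \<Longrightarrow> set_app f x = set_app g x"
  shows "f = g"
proof -
  have "set_app f = set_app g"
    using assms by (intro ext) (metis Set_cat_arr)
  then show ?thesis using assms(3,4) by (simp add: prod_eq_iff set_app_def fun_eq_iff)
qed

lemma is_category_Set_cat: "is_category Set_cat"
  unfolding is_category_def
proof (intro conjI ballI impI)
  fix f :: "'u set_map" assume f: "f \<in> Arr Set_cat"
  then show "Dom Set_cat f \<in> Obj Set_cat" "Cod Set_cat f \<in> Obj Set_cat"
    by (auto simp: Set_cat_arr)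
  show "Comp Set_cat f (Ident Set_cat (Dom Set_cat f)) = f"
    "Comp Set_cat (Ident Set_cat (Cod Set_cat f)) f = f"
    using f by (auto intro!: set_map_eqI simp: Set_cat_arr)
qed (auto intro!: set_map_eqI simp: Set_cat_arr)

text \<open>Only single forward steps along an arrow are recorded; \<open>equivclp\<close> supplies
  composites and inverses, and then describes equality in the colimit of sets.\<close>

definition colim_gen ::
  "('i, 'f, 'z) category_scheme \<Rightarrow> ('i, 'f, 'u set, 'u set_map) func \<Rightarrow> 'i \<times> 'u \<Rightarrow> 'i \<times> 'u \<Rightarrow> bool" where
  "colim_gen I G p q \<longleftrightarrow>
     (\<exists>f\<in>Arr I. fst p = Dom I f \<and> snd p \<in> Fo G (Dom I f) \<and> q = (Cod I f, set_app (Fa G f) (snd p)))"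

text \<open>The type of values of \<open>t\<close> is arbitrary. This matters later, when
  \<open>t\<close> takes values in the arrows of \<open>V\<close> rather than in
  \<open>'u\<close>.\<close>

lemma colim_gen_invariant:
  assumes "equivclp (colim_gen I G) p q"
    "\<And>f x. f \<in> Arr I \<Longrightarrow> x \<in> Fo G (Dom I f) \<Longrightarrow> t (Cod I f) (set_app (Fa G f) x) = t (Dom I f) x"
  shows "t (fst p) (snd p) = t (fst q) (snd q)"
  using assms(1)
proof (induction rule: equivclp_induct)
  case (step y z)
  then show ?case using assms(2) by (auto simp: colim_gen_def)
qed simp

text \<open>The colimit is the disjoint union modulo the closure of \<open>colim_gen\<close>. Its
  classes are sets of pairs, whereas objects of \<open>Set_cat\<close> are subsets of
  \<open>'u\<close>, so the classes are encoded by an injection \<open>h\<close>, available because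
  there are few enough of them.\<close>

lemma set_colimit_quotient:
  fixes G :: "('i, 'f, 'u set, 'u set_map) func"
  assumes U: "universe_type TYPE('u)" and I: "small_category TYPE('u) I"
    and G: "is_functor I Set_cat G"
  obtains X \<iota> where "is_colimit I Set_cat G X \<iota>"
    "\<And>a. a \<in> X \<Longrightarrow> \<exists>i\<in>Obj I. \<exists>x\<in>Fo G i. a = set_app (\<iota> i) x"
    "\<And>i j x y. i \<in> Obj I \<Longrightarrow> j \<in> Obj I \<Longrightarrow> x \<in> Fo G i \<Longrightarrow> y \<in> Fo G j \<Longrightarrow>
       set_app (\<iota> i) x = set_app (\<iota> j) y \<Longrightarrow> equivclp (colim_gen I G) (i, x) (j, y)"
proof -
  note G' = functorD[OF G]
  interpret I: cat I using G' by unfold_locales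
  have Garr: "Fa G f \<in> Arr Set_cat" "fst (Fa G f) = Fo G (Dom I f)" "snd (snd (Fa G f)) = Fo G (Cod I f)"
    if "f \<in> Arr I" for f using G'(4-6) that by auto
  have Gin: "set_app (Fa G f) x \<in> Fo G (Cod I f)" if "f \<in> Arr I" "x \<in> Fo G (Dom I f)" for f x
    using Garr[OF that(1)] that by (simp add: Set_cat_arr)
  define S where "S = Sigma (Obj I) (Fo G)"
  define cls where "cls p = {q. equivclp (colim_gen I G) p q}" for p
  have S: "small TYPE('u) (cls ` S)"
    using I G'(3) unfolding S_def small_category_def by (intro small_image[OF U] small_Sigma[OF U]) auto
  then obtain h :: "('i \<times> 'u) set \<Rightarrow> 'u" where h: "inj_on h (cls ` S)"
    using card_of_ordLeq[of "cls ` S" "UNIV :: 'u set"]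
    by (auto simp: small_def dest: ordLess_imp_ordLeq)
  have cls_eq: "cls p = cls q" if "equivclp (colim_gen I G) p q" for p q
    using that unfolding cls_def by (blast intro: equivclp_trans equivclp_sym)
  have h_eq: "equivclp (colim_gen I G) p q" if "p \<in> S" "q \<in> S" "h (cls p) = h (cls q)" for p q
  proof -
    have "cls p = cls q" using that h by (auto simp: inj_on_def)
    moreover have "q \<in> cls q" by (simp add: cls_def)
    ultimately have "q \<in> cls p" by simp
    then show ?thesis by (simp add: cls_def)
  qed
  define X where "X = h ` cls ` S"
  define \<iota> where "\<iota> i = (Fo G i, \<lambda>x. if x \<in> Fo G i then h (cls (i, x)) else undefined, X)" for i
  have X: "small TYPE('u) X" using S by (simp add: X_def small_image[OF U])
  have \<iota>: "\<iota> i \<in> Arr Set_cat" if "i \<in> Obj I" for i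
    using that X G'(3)[OF that] by (auto simp: Set_cat_arr \<iota>_def X_def S_def)
  have cocone: "is_cocone I Set_cat G X \<iota>"
    unfolding is_cocone_def
  proof (intro conjI ballI)
    fix f assume f: "f \<in> Arr I"
    show "Comp Set_cat (\<iota> (Cod I f)) (Fa G f) = \<iota> (Dom I f)"
    proof (rule set_map_eqI)
      show "Comp Set_cat (\<iota> (Cod I f)) (Fa G f) \<in> Arr Set_cat"
        using cat.comp_arr(1)[OF cat.intro[OF is_category_Set_cat], of "Fa G f" "\<iota> (Cod I f)"] f Garr[OF f] \<iota>
        by (simp add: \<iota>_def)
      show "\<iota> (Dom I f) \<in> Arr Set_cat" using f \<iota> by simp
      fix x assume "x \<in> fst (Comp Set_cat (\<iota> (Cod I f)) (Fa G f))"
      then have x: "x \<in> Fo G (Dom I f)" using Garr f by simp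
      then have "colim_gen I G (Dom I f, x) (Cod I f, set_app (Fa G f) x)"
        using f by (auto simp: colim_gen_def)
      then have "cls (Cod I f, set_app (Fa G f) x) = cls (Dom I f, x)"
        by (intro cls_eq[symmetric] r_into_equivclp)
      then show "set_app (Comp Set_cat (\<iota> (Cod I f)) (Fa G f)) x = set_app (\<iota> (Dom I f)) x"
        using x f Garr Gin by (simp add: \<iota>_def)
    qed (use Garr f in \<open>simp_all add: \<iota>_def\<close>)
  qed (use G X \<iota> in \<open>auto simp: \<iota>_def\<close>)
  have colim: "is_colimit I Set_cat G X \<iota>"
  proof (rule is_colimitI[OF cocone])
    fix d \<kappa> assume "is_cocone I Set_cat G d \<kappa>"
    note \<kappa> = coconeD[OF this]
    have \<kappa>': "\<kappa> i \<in> Arr Set_cat" "fst (\<kappa> i) = Fo G i" "snd (snd (\<kappa> i)) = d" if "i \<in> Obj I" for i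
      using \<kappa>(3-5)[OF that] by auto
    have inv: "set_app (\<kappa> (Cod I f)) (set_app (Fa G f) x) = set_app (\<kappa> (Dom I f)) x"
      if f: "f \<in> Arr I" and x: "x \<in> Fo G (Dom I f)" for f x
      using arg_cong[OF \<kappa>(6)[OF f], of "\<lambda>m. set_app m x"] x Garr[OF f] by simp
    \<comment> \<open>Any pair coding \<open>y\<close> will do: by \<open>h_eq\<close> two of them
      are joined by a zigzag, along which the legs \<open>\<kappa>\<close> agree.\<close>
    define r where "r y = (SOME p. p \<in> S \<and> h (cls p) = y)" for y
    have r: "r y \<in> S \<and> h (cls (r y)) = y" if "y \<in> X" for y
      unfolding r_def by (rule someI_ex) (use that in \<open>auto simp: X_def\<close>)
    define u where "u = (X, \<lambda>y. if y \<in> X then set_app (\<kappa> (fst (r y))) (snd (r y)) else undefined, d)"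
    have u: "u \<in> Arr Set_cat"
    proof -
      have "set_app (\<kappa> (fst (r y))) (snd (r y)) \<in> d" if "y \<in> X" for y
      proof -
        have "fst (r y) \<in> Obj I" "snd (r y) \<in> Fo G (fst (r y))"
          using r[OF that] by (auto simp: S_def)
        then show ?thesis using \<kappa>'[of "fst (r y)"] by (simp add: Set_cat_arr)
      qed
      then show ?thesis using X \<kappa>(2) by (simp add: u_def Set_cat_arr)
    qed
    have "Comp Set_cat u (\<iota> i) = \<kappa> i" if i: "i \<in> Obj I" for i
    proof (rule set_map_eqI)
      show "Comp Set_cat u (\<iota> i) \<in> Arr Set_cat"
        using cat.comp_arr(1)[OF cat.intro[OF is_category_Set_cat], of "\<iota> i" u] u \<iota>[OF i]
        by (simp add: \<iota>_def u_def)
      fix x assume "x \<in> fst (Comp Set_cat u (\<iota> i))"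
      then have x: "x \<in> Fo G i" by (simp add: \<iota>_def)
      then have p: "(i, x) \<in> S" using i by (simp add: S_def)
      then have X: "h (cls (i, x)) \<in> X" by (simp add: X_def)
      have "equivclp (colim_gen I G) (r (h (cls (i, x)))) (i, x)"
        using r[OF X] p by (intro h_eq) auto
      from colim_gen_invariant[OF this, of "\<lambda>i. set_app (\<kappa> i)"] inv
      show "set_app (Comp Set_cat u (\<iota> i)) x = set_app (\<kappa> i) x"
        using x X by (simp add: \<iota>_def u_def)
    qed (use \<kappa>'[OF i] in \<open>simp_all add: u_def \<iota>_def\<close>)
    then show "\<exists>u. u \<in> Hom Set_cat X d \<and> (\<forall>j\<in>Obj I. Comp Set_cat u (\<iota> j) = \<kappa> j)"
      using u by (intro exI[of _ u]) (simp add: u_def)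
  next
    fix u v :: "'u set_map"
    assume uv: "u \<in> Arr Set_cat" "v \<in> Arr Set_cat" "Dom Set_cat u = X" "Dom Set_cat v = X"
        "Cod Set_cat u = Cod Set_cat v"
      and eq: "\<And>j. j \<in> Obj I \<Longrightarrow> Comp Set_cat u (\<iota> j) = Comp Set_cat v (\<iota> j)"
    show "u = v"
    proof (rule set_map_eqI)
      fix y assume "y \<in> fst u"
      then obtain i x where "i \<in> Obj I" "x \<in> Fo G i" "y = h (cls (i, x))"
        using uv(3) by (auto simp: X_def S_def)
      with arg_cong[OF eq[of i], of "\<lambda>m. set_app m x"] show "set_app u y = set_app v y"
        by (simp add: \<iota>_def)
    qed (use uv in auto)
  qed
  show thesis
  proof (rule that[OF colim])
    show "\<exists>i\<in>Obj I. \<exists>x\<in>Fo G i. a = set_app (\<iota> i) x" if "a \<in> X" for a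
      using that by (force simp: X_def S_def \<iota>_def)
    show "equivclp (colim_gen I G) (i, x) (j, y)"
      if "i \<in> Obj I" "j \<in> Obj I" "x \<in> Fo G i" "y \<in> Fo G j" "set_app (\<iota> i) x = set_app (\<iota> j) y" for i j x y
      using that by (intro h_eq) (auto simp: S_def \<iota>_def)
  qed
qed

text \<open>Both facts are transferred from the quotient along the comparison map.\<close>

lemma set_colimit:
  fixes G :: "('i, 'f, 'u set, 'u set_map) func"
  assumes U: "universe_type TYPE('u)" and I: "small_category TYPE('u) I"
    and colim: "is_colimit I Set_cat G X \<iota>"
  shows set_colimit_surj: "a \<in> X \<Longrightarrow> \<exists>i\<in>Obj I. \<exists>x\<in>Fo G i. set_app (\<iota> i) x = a"
    and set_colimit_eq: "i \<in> Obj I \<Longrightarrow> j \<in> Obj I \<Longrightarrow> x \<in> Fo G i \<Longrightarrow> y \<in> Fo G j \<Longrightarrow>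
      set_app (\<iota> i) x = set_app (\<iota> j) y \<Longrightarrow> equivclp (colim_gen I G) (i, x) (j, y)"
proof -
  note cc = colimit_cocone[OF colim]
  obtain Y \<kappa> where Y: "is_colimit I Set_cat G Y \<kappa>"
    and surj: "\<And>a. a \<in> Y \<Longrightarrow> \<exists>i\<in>Obj I. \<exists>x\<in>Fo G i. a = set_app (\<kappa> i) x"
    and eq: "\<And>i j x y. i \<in> Obj I \<Longrightarrow> j \<in> Obj I \<Longrightarrow> x \<in> Fo G i \<Longrightarrow> y \<in> Fo G j \<Longrightarrow>
       set_app (\<kappa> i) x = set_app (\<kappa> j) y \<Longrightarrow> equivclp (colim_gen I G) (i, x) (j, y)"
    using set_colimit_quotient[OF U I coconeD(1)[OF cc]] by blast
  note cc' = colimit_cocone[OF Y]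
  define u where "u = induced_arr I Set_cat X \<iota> Y \<kappa>"
  define v where "v = induced_arr I Set_cat Y \<kappa> X \<iota>"
  note u = induced_arr[OF colim cc', folded u_def] and v = induced_arr[OF Y cc, folded v_def]
  have app: "set_app u (set_app (\<iota> i) x) = set_app (\<kappa> i) x"
    "set_app v (set_app (\<kappa> i) x) = set_app (\<iota> i) x" if "i \<in> Obj I" "x \<in> Fo G i" for i x
    using arg_cong[OF u(4)[OF that(1)], of "\<lambda>m. set_app m x"]
      arg_cong[OF v(4)[OF that(1)], of "\<lambda>m. set_app m x"]
      coconeD(4)[OF cc that(1)] coconeD(4)[OF cc' that(1)] that by simp_all
  show "\<exists>i\<in>Obj I. \<exists>x\<in>Fo G i. set_app (\<iota> i) x = a" if a: "a \<in> X"
  proof -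
    have "Comp Set_cat v u = Ident Set_cat X"
      using colimit_induced_inverse[OF colim Y, folded u_def v_def] u(2)
      by (simp only: inverse_arrows_def)
    from arg_cong[OF this, of "\<lambda>m. set_app m a"] have "set_app v (set_app u a) = a"
      using a u(2) by simp
    moreover have "set_app u a \<in> Y" using u(1-3) a by (simp add: Set_cat_arr)
    ultimately show ?thesis using surj app(2) by metis
  qed
  show "equivclp (colim_gen I G) (i, x) (j, y)"
    if "i \<in> Obj I" "j \<in> Obj I" "x \<in> Fo G i" "y \<in> Fo G j" "set_app (\<iota> i) x = set_app (\<iota> j) y"
    using eq[OF that(1-4)] app(1)[OF that(1,3)] app(1)[OF that(2,4)] that(5) by simp
qed


section \<open>Categories presented by generators and relations\<close>

lemma is_path_append:
  "is_path E src tgt v (p @ q) w \<longleftrightarrow> (\<exists>u. is_path E src tgt v p u \<and> is_path E src tgt u q w)"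
  by (induction p arbitrary: v) auto

lemma path_cong_refl [simp]: "path_cong R p p"
  by (simp add: path_cong_def)

lemma path_cong_sym: "path_cong R p q \<Longrightarrow> path_cong R q p"
  unfolding path_cong_def by (rule equivclp_sym)

lemma path_cong_trans: "path_cong R p q \<Longrightarrow> path_cong R q r \<Longrightarrow> path_cong R p r"
  unfolding path_cong_def by (rule equivclp_trans)

text \<open>The anonymous relation inside \<open>path_cong\<close>, named so that single steps can
  be inspected in inductions over the closure.\<close>

definition path_step :: "('e list \<times> 'e list) set \<Rightarrow> 'e list \<Rightarrow> 'e list \<Rightarrow> bool" where
  "path_step R p p' \<longleftrightarrow> (\<exists>u r r' w. (r, r') \<in> R \<and> p = u @ r @ w \<and> p' = u @ r' @ w)"

lemma path_cong_step: "path_cong R = equivclp (path_step R)"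
  by (simp add: path_cong_def path_step_def[abs_def])

lemma path_step_context: "path_step R p q \<Longrightarrow> path_step R (u @ p @ w) (u @ q @ w)"
  unfolding path_step_def
proof (elim exE conjE)
  fix u' r r' w' assume "(r, r') \<in> R" "p = u' @ r @ w'" "q = u' @ r' @ w'"
  then show "\<exists>u' r r' w'. (r, r') \<in> R \<and> u @ p @ w = u' @ r @ w' \<and> u @ q @ w = u' @ r' @ w'"
    by (intro exI[of _ "u @ u'"] exI[of _ r] exI[of _ r'] exI[of _ "w' @ w"]) simp
qed

lemma path_cong_context: "path_cong R p q \<Longrightarrow> path_cong R (u @ p @ w) (u @ q @ w)"
  unfolding path_cong_step
proof (induction rule: equivclp_induct)
  case (step y z)
  then have "path_step R (u @ y @ w) (u @ z @ w) \<or> path_step R (u @ z @ w) (u @ y @ w)"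
    using path_step_context by blast
  with step(3) show ?case by (rule equivclp_into_equivclp)
qed simp

lemma path_cong_append:
  assumes "path_cong R p p'" "path_cong R q q'"
  shows "path_cong R (p @ q) (p' @ q')"
  using path_cong_context[OF assms(1), of "[]" q] path_cong_context[OF assms(2), of p' "[]"]
  by (simp only: append_Nil append_Nil2) (rule path_cong_trans)

text \<open>\<open>parallel\<close> is an equivalence for all endpoints because the congruence uses
  relations in both directions and inside arbitrary contexts, and must never change whether a path
  runs from \<open>v\<close> to \<open>w\<close>.\<close>

locale presentation =
  fixes X :: "'v set" and E :: "'e set" and src tgt :: "'e \<Rightarrow> 'v" and R :: "('e list \<times> 'e list) set"
  assumes edge_ends: "e \<in> E \<Longrightarrow> src e \<in> X \<and> tgt e \<in> X"
    and parallel: "(r, r') \<in> R \<Longrightarrow> is_path E src tgt v r w \<longleftrightarrow> is_path E src tgt v r' w"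
begin

abbreviation path where "path \<equiv> is_path E src tgt"
abbreviation cls where "cls \<equiv> path_class E src tgt R"
abbreviation P where "P \<equiv> presented_cat X E src tgt R"

lemma path_end: "path v p w \<Longrightarrow> v \<in> X \<Longrightarrow> w \<in> X"
  by (induction p arbitrary: v) (auto dest: edge_ends)

lemma cong_path:
  assumes "path_cong R p q"
  shows "path v p w \<longleftrightarrow> path v q w"
  using assms unfolding path_cong_step
proof (induction rule: equivclp_induct)
  case (step y z)
  then have "path v y w \<longleftrightarrow> path v z w"
    by (auto simp: path_step_def is_path_append parallel)
  with step(3) show ?case by simp
qed simp

lemma path_class_eqI: "path_cong R p q \<Longrightarrow> cls v p w = cls v q w"
  unfolding path_class_def by (blast intro: path_cong_trans path_cong_sym)

lemma path_class_self: "path v p w \<Longrightarrow> p \<in> cls v p w"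
  by (simp add: path_class_def)

lemma path_classD: "q \<in> cls v p w \<Longrightarrow> path v q w \<and> path_cong R p q"
  by (simp add: path_class_def)

lemma P_simps [simp]:
  "Obj P = X" "Dom P (v, A, w) = v" "Cod P (v, A, w) = w" "Ident P v = (v, cls v [] v, v)"
  by (simp_all add: presented_cat_def)

lemma P_arr: "f \<in> Arr P \<longleftrightarrow> (\<exists>v p w. v \<in> X \<and> w \<in> X \<and> path v p w \<and> f = (v, cls v p w, w))"
  by (auto simp: presented_cat_def)

lemma P_arrI [simp]: "path v p w \<Longrightarrow> v \<in> X \<Longrightarrow> w \<in> X \<Longrightarrow> (v, cls v p w, w) \<in> Arr P"
  unfolding P_arr by blast

text \<open>Composition is a union over all pairs of representatives. Congruence makes the united
  classes coincide, and \<open>p\<close> and \<open>q\<close> show that there is at least one pair,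
  so the union collapses.\<close>

lemma P_comp:
  assumes "path v p u" "path u q w"
  shows "Comp P (u, cls u q w, w) (v, cls v p u, u) = (v, cls v (p @ q) w, w)"
proof -
  have "cls v (p' @ q') w = cls v (p @ q) w" if "p' \<in> cls v p u" "q' \<in> cls u q w" for p' q'
    using that by (intro path_class_eqI[OF path_cong_append, symmetric]) (simp_all add: path_class_def)
  then have "(\<Union>p'\<in>cls v p u. \<Union>q'\<in>cls u q w. cls v (p' @ q') w) =
      (\<Union>p'\<in>cls v p u. \<Union>q'\<in>cls u q w. cls v (p @ q) w)"
    by (intro SUP_cong refl)
  also have "\<dots> = cls v (p @ q) w"
    using path_class_self[OF assms(1)] path_class_self[OF assms(2)] by blast
  finally show ?thesis by (simp add: presented_cat_def)
qed

lemma is_category_P: "is_category P"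
  unfolding is_category_def
proof (intro conjI ballI impI)
  fix f assume "f \<in> Arr P"
  then obtain v p w where f: "v \<in> X" "w \<in> X" "path v p w" "f = (v, cls v p w, w)"
    unfolding P_arr by blast
  show "Dom P f \<in> Obj P" "Cod P f \<in> Obj P" using f by auto
  show "Comp P f (Ident P (Dom P f)) = f" "Comp P (Ident P (Cod P f)) f = f"
    using f P_comp[of v "[]" v p w] P_comp[of v p w "[]" w] by simp_all
  fix g assume g_arr: "g \<in> Arr P"
  obtain w' q x where g': "w' \<in> X" "x \<in> X" "path w' q x" "g = (w', cls w' q x, x)"
    using g_arr unfolding P_arr by blast
  {
    assume "Cod P f = Dom P g"
    then have [simp]: "w' = w" using f(4) g'(4) by simp
    have "path v (p @ q) x" using f(3) g'(3) unfolding is_path_append by auto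
    then show "Comp P g f \<in> Hom P (Dom P f) (Cod P g)"
      using f g' by (simp add: P_comp)
  }
  fix h assume h_arr: "h \<in> Arr P" and eq: "Cod P f = Dom P g \<and> Cod P g = Dom P h"
  obtain x' r y where h': "y \<in> X" "path x' r y" "h = (x', cls x' r y, y)"
    using h_arr unfolding P_arr by blast
  have [simp]: "w' = w" "x' = x" using eq f(4) g'(4) h'(3) by simp_all
  have "path v (p @ q) x" "path w (q @ r) y"
    using f(3) g'(3) h'(2) unfolding is_path_append by auto
  then show "Comp P h (Comp P g f) = Comp P (Comp P h g) f"
    using f g' h' by (simp add: P_comp)
qed simp

text \<open>An arrow is determined by its two ends and one representing path, hence by a list of
  edges.\<close>

lemma small_P:
  assumes "universe_type TYPE('u)" "small TYPE('u) X" "small TYPE('u) E"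
  shows "small_category TYPE('u) P"
proof -
  have "Arr P \<subseteq> (\<lambda>(v, p, w). (v, cls v p w, w)) ` (X \<times> lists E \<times> X)"
  proof
    fix f assume "f \<in> Arr P"
    then obtain v p w where f: "v \<in> X" "w \<in> X" "path v p w" "f = (v, cls v p w, w)"
      unfolding P_arr by blast
    have "p \<in> lists E" using f(3) by (induction p arbitrary: v) auto
    with f show "f \<in> (\<lambda>(v, p, w). (v, cls v p w, w)) ` (X \<times> lists E \<times> X)" by force
  qed
  moreover have "small TYPE('u) ((\<lambda>(v, p, w). (v, cls v p w, w)) ` (X \<times> lists E \<times> X))"
    using assms by (intro small_image small_Sigma small_lists)
  ultimately have "small TYPE('u) (Arr P)" by (rule small_subset[OF assms(1), rotated])
  then show ?thesis using assms(2) is_category_P by (simp add: small_category_def)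
qed

end

text \<open>The action on paths is a parameter \<open>fp\<close> constrained by recursion equations
  instead of being defined here, so that \<open>ev_path\<close> can be supplied for it and
  \<open>G\<close> becomes literally \<open>ev\<close>.\<close>

locale presentation_functor =
  presentation X E src tgt R + cat C
  for X :: "'v set" and E :: "'e set" and src tgt :: "'e \<Rightarrow> 'v" and R :: "('e list \<times> 'e list) set"
    and C :: "('o, 'm, 'z) category_scheme" +
  fixes fo :: "'v \<Rightarrow> 'o" and fe :: "'e \<Rightarrow> 'm" and fp :: "'v \<Rightarrow> 'e list \<Rightarrow> 'm"
  assumes fo: "v \<in> X \<Longrightarrow> fo v \<in> Obj C"
    and fe: "e \<in> E \<Longrightarrow> fe e \<in> Hom C (fo (src e)) (fo (tgt e))"
    and fp_Nil: "fp v [] = Ident C (fo v)"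
    and fp_Cons: "fp v (e # p) = Comp C (fp (tgt e) p) (fe e)"
    and fp_rel: "(r, r') \<in> R \<Longrightarrow> is_path E src tgt v r w \<Longrightarrow> fp v r = fp v r'"
begin

definition G where "G = \<lparr>Fo = fo, Fa = (\<lambda>(v, A, w). fp v (SOME p. p \<in> A))\<rparr>"

lemma fp_in: "path v p w \<Longrightarrow> v \<in> X \<Longrightarrow> fp v p \<in> Hom C (fo v) (fo w)"
proof (induction p arbitrary: v)
  case Nil
  then show ?case by (simp add: fp_Nil fo)
next
  case (Cons e p)
  then show ?case using fe[of e] edge_ends[of e] by (simp add: fp_Cons)
qed

lemma fp_append: "path v p u \<Longrightarrow> path u q w \<Longrightarrow> v \<in> X \<Longrightarrow> fp v (p @ q) = fp u q \<cdot> fp v p"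
proof (induction p arbitrary: v)
  case Nil
  then show ?case using fp_in[of u q w] by (simp add: fp_Nil fo)
next
  case (Cons e p)
  then have p: "path (tgt e) p u" and e: "tgt e \<in> X" and "u \<in> X"
    using edge_ends[of e] path_end[of "tgt e" p u] by simp_all
  then have *: "fp (tgt e) p \<in> Hom C (fo (tgt e)) (fo u)" "fp u q \<in> Hom C (fo u) (fo w)"
    "fe e \<in> Hom C (fo v) (fo (tgt e))"
    using fe[of e] Cons.prems fp_in[OF p e] fp_in[of u q w] by simp_all
  have "fp (tgt e) (p @ q) = fp u q \<cdot> fp (tgt e) p"
    using Cons edge_ends[of e] by simp
  then show ?case using * by (simp add: fp_Cons)
qed

text \<open>A relation in a context \<open>u @ r @ w'\<close> is handled by splitting the composite
  at both joints, so that \<open>fp_rel\<close> is applied to the middle part alone.\<close>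

lemma fp_cong:
  assumes "path_cong R p q" "path v p w" "v \<in> X"
  shows "fp v p = fp v q"
proof -
  have eq: "fp v y = fp v z"
    if "path_step R y z" "path v y w" for y z
  proof -
    from that(1) obtain u r r' w' where r: "(r, r') \<in> R" "y = u @ r @ w'" "z = u @ r' @ w'"
      by (auto simp: path_step_def)
    with that(2) obtain x x' where p: "path v u x" "path x r x'" "path x' w' w"
      by (auto simp: is_path_append)
    have p': "path x r' x'" using p(2) parallel[OF r(1)] by simp
    have x: "x \<in> X" using path_end p(1) assms(3) by blast
    have "fp v (u @ r @ w') = fp v (u @ r' @ w')"
      using p p' x fp_rel[OF r(1) p(2)] assms(3)
      by (subst (1 2) fp_append[of v u x _ w]) (auto simp: is_path_append fp_append[of x _ x' w' w])
    then show ?thesis using r by simp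
  qed
  \<comment> \<open>The path condition is carried along because steps of the closure run in either
    direction, and \<open>eq\<close> needs a valid path at the end from which it starts.\<close>
  have "path v q w \<and> fp v p = fp v q"
    using assms(1) unfolding path_cong_step
  proof (induction rule: equivclp_induct)
    case base
    then show ?case using assms(2) by simp
  next
    case (step y z)
    have "path_cong R y z"
      unfolding path_cong_step using step(2) by (blast intro: equivclp_sym)
    then have "path v z w" using step(3) cong_path by blast
    then show ?case using step(2,3) eq[of y z] eq[of z y] by metis
  qed
  then show ?thesis by blast
qed

text \<open>The path picked by \<open>SOME\<close> is congruent to \<open>p\<close>, and
  \<open>fp\<close> is constant on congruence classes.\<close>

lemma G_class:
  assumes "path v p w" "v \<in> X"
  shows "Fa G (v, cls v p w, w) = fp v p"
proof -
  have "(SOME q. q \<in> cls v p w) \<in> cls v p w"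
    by (rule someI[of _ p]) (rule path_class_self[OF assms(1)])
  from path_classD[OF this] show ?thesis
    using fp_cong[of p "SOME q. q \<in> cls v p w" v w] assms by (simp add: G_def)
qed

lemma G_simps [simp]: "Fo G = fo"
  by (simp add: G_def)

lemma is_functor_G: "is_functor P C G"
  unfolding is_functor_def
proof (intro conjI ballI impI)
  fix f assume "f \<in> Arr P"
  then obtain v p w where f: "v \<in> X" "w \<in> X" "path v p w" "f = (v, cls v p w, w)"
    unfolding P_arr by blast
  show "Fa G f \<in> Hom C (Fo G (Dom P f)) (Fo G (Cod P f))"
    using f fp_in[OF f(3,1)] by (simp add: G_class)
  fix g assume g_arr: "g \<in> Arr P" and fg: "Cod P f = Dom P g"
  obtain w' q x where g': "w' \<in> X" "x \<in> X" "path w' q x" "g = (w', cls w' q x, x)"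
    using g_arr unfolding P_arr by blast
  have [simp]: "w' = w" using fg f(4) g'(4) by simp
  have "path v (p @ q) x" using f(3) g'(3) unfolding is_path_append by auto
  then show "Fa G (Comp P g f) = Comp C (Fa G g) (Fa G f)"
    using f g' by (simp add: P_comp G_class fp_append[of v p w q x])
qed (auto simp: is_category_P is_category fo G_class fp_Nil)

text \<open>Compatibility with single edges propagates to paths by induction, so cocones need
  checking on generators only. Conversely, the condition at an edge is read off the path consisting
  of it.\<close>

lemma is_cocone_G:
  "is_cocone P C G c \<kappa> \<longleftrightarrow> c \<in> Obj C \<and> (\<forall>x\<in>X. \<kappa> x \<in> Hom C (fo x) c) \<and>
     (\<forall>e\<in>E. \<kappa> (tgt e) \<cdot> fe e = \<kappa> (src e))" (is "?L \<longleftrightarrow> ?R")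
proof
  assume L: ?L
  have "\<kappa> (tgt e) \<cdot> fe e = \<kappa> (src e)" if e: "e \<in> E" for e
  proof -
    have p: "path (src e) [e] (tgt e)" "src e \<in> X" "tgt e \<in> X" using e edge_ends by auto
    then have "(src e, cls (src e) [e] (tgt e), tgt e) \<in> Arr P" by (rule P_arrI)
    from coconeD(6)[OF L this] show ?thesis
      using p fe[OF e] by (simp add: G_class fp_Cons fp_Nil)
  qed
  with coconeD[OF L] show ?R by simp
next
  assume R: ?R
  have "\<kappa> w \<cdot> fp v p = \<kappa> v" if "path v p w" "v \<in> X" for v p w
    using that
  proof (induction p arbitrary: v)
    case Nil
    then show ?case using R by (simp add: fp_Nil)
  next
    case (Cons e p)
    then have p: "path (tgt e) p w" and e: "tgt e \<in> X"
      using edge_ends[of e] by simp_all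
    then have *: "fp (tgt e) p \<in> Hom C (fo (tgt e)) (fo w)" "w \<in> X" "\<kappa> w \<cdot> fp (tgt e) p = \<kappa> (tgt e)"
      using Cons.IH fp_in[OF p e] path_end[OF p e] by simp_all
    have "\<kappa> w \<cdot> fp (tgt e) p \<cdot> fe e = (\<kappa> w \<cdot> fp (tgt e) p) \<cdot> fe e"
      using * R fe[of e] Cons.prems by (intro comp_assoc[symmetric]) auto
    then show ?case using Cons R by (simp add: fp_Cons *(3))
  qed
  then have "\<kappa> (Cod P f) \<cdot> Fa G f = \<kappa> (Dom P f)" if "f \<in> Arr P" for f
    using that unfolding P_arr by (elim exE conjE) (simp add: G_class)
  then show ?L using R is_functor_G by (simp add: is_cocone_def)
qed

text \<open>The same propagation after applying \<open>T\<close>, which will be tensoring with a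
  fixed object on one side. It gives naturality of concatenation in one string while the other stays
  fixed.\<close>

lemma natural_endofunctor:
  assumes T: "is_functor C C T"
    and \<phi>: "\<And>x. x \<in> X \<Longrightarrow> \<phi> x \<in> Hom C (Fo T (fo x)) d"
    and nat: "\<And>e. e \<in> E \<Longrightarrow> \<phi> (tgt e) \<cdot> Fa T (fe e) = \<phi> (src e)"
    and f: "f \<in> Arr P"
  shows "\<phi> (Cod P f) \<cdot> Fa T (Fa G f) = \<phi> (Dom P f)"
proof -
  have "\<phi> w \<cdot> Fa T (fp v p) = \<phi> v" if "path v p w" "v \<in> X" for v p w
    using that
  proof (induction p arbitrary: v)
    case Nil
    then show ?case using \<phi> by (simp add: fp_Nil functorD(7)[OF T] fo)
  next
    case (Cons e p)
    then have p: "path (tgt e) p w" and e: "tgt e \<in> X" "e \<in> E" "src e = v"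
      using edge_ends[of e] by simp_all
    note [simp] = fp_in[OF p e(1), simplified] fe[OF e(2), simplified] \<phi>[OF path_end[OF p e(1)], simplified]
      functorD(4-6)[OF T]
    have "\<phi> w \<cdot> Fa T (fp v (e # p)) = \<phi> w \<cdot> Fa T (fp (tgt e) p) \<cdot> Fa T (fe e)"
      by (simp add: fp_Cons functorD(8)[OF T])
    also have "\<dots> = \<phi> (tgt e) \<cdot> Fa T (fe e)"
      by (rule comp_tail[OF Cons.IH[OF p e(1)]]) simp_all
    finally show ?case using nat[OF e(2)] e(3) by simp
  qed
  then show ?thesis using f unfolding P_arr by (elim exE conjE) (simp add: G_class)
qed

end


section \<open>Monoidal categories\<close>

locale mon = cat V for V :: "('o, 'm) monoidal" +
  assumes monoidal: "monoidal_category V"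
begin

notation comp (infixr "\<cdot>" 55)

abbreviation tensor_obj (infixl "\<otimes>" 70) where "A \<otimes> B \<equiv> tens_o V A B"
abbreviation tensor_arr (infixl "\<star>" 70) where "f \<star> g \<equiv> tens_a V f g"
abbreviation ident_arr ("\<one>") where "\<one> \<equiv> Ident V"
abbreviation \<a> where "\<a> \<equiv> assoc V"
abbreviation \<b> where "\<b> A B C \<equiv> inv_arr V (assoc V A B C)"
abbreviation \<I> where "\<I> \<equiv> munit V"

lemma tensor_functor: "is_functor (prod_cat V V) V (tens V)"
  using monoidal by (simp add: monoidal_category_def)

lemma tens_obj [simp]: "A \<in> Obj V \<Longrightarrow> B \<in> Obj V \<Longrightarrow> A \<otimes> B \<in> Obj V"
  using functorD(3)[OF tensor_functor, of "(A, B)"] by (simp add: tens_o_def prod_cat_def)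

lemma tens_arr [simp]:
  assumes "f \<in> Arr V" "g \<in> Arr V"
  shows "f \<star> g \<in> Arr V" "Dom V (f \<star> g) = Dom V f \<otimes> Dom V g" "Cod V (f \<star> g) = Cod V f \<otimes> Cod V g"
  using functorD(4-6)[OF tensor_functor, of "(f, g)"] assms
  by (simp_all add: tens_o_def tens_a_def prod_cat_def)

lemma tens_ident [simp]: "A \<in> Obj V \<Longrightarrow> B \<in> Obj V \<Longrightarrow> \<one> A \<star> \<one> B = \<one> (A \<otimes> B)"
  using functorD(7)[OF tensor_functor, of "(A, B)"] by (simp add: tens_o_def tens_a_def prod_cat_def)

text \<open>Oriented to fuse adjacent tensor products. With the identity laws, both orders of
  applying arrows to separate factors then normalise to one tensor product, so interchange in
  \<open>V\<close> rarely needs an explicit step.\<close>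

lemma tens_comp [simp]:
  assumes "f \<in> Arr V" "g \<in> Arr V" "f' \<in> Arr V" "g' \<in> Arr V" "Cod V f = Dom V g" "Cod V f' = Dom V g'"
  shows "(g \<star> g') \<cdot> (f \<star> f') = (g \<cdot> f) \<star> (g' \<cdot> f')"
  using functorD(8)[OF tensor_functor, of "(f, f')" "(g, g')"] assms
  by (simp add: tens_a_def prod_cat_def)

lemma tens_comp_tail [simp]:
  assumes "f \<in> Arr V" "g \<in> Arr V" "f' \<in> Arr V" "g' \<in> Arr V" "Cod V f = Dom V g" "Cod V f' = Dom V g'"
    "h \<in> Arr V" "Cod V h = Dom V f \<otimes> Dom V f'"
  shows "(g \<star> g') \<cdot> (f \<star> f') \<cdot> h = ((g \<cdot> f) \<star> (g' \<cdot> f')) \<cdot> h"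
  using assms by (intro comp_tail) simp_all

lemma munit_obj [simp]: "\<I> \<in> Obj V"
  using monoidal by (simp add: monoidal_category_def)

lemma assoc_arr [simp]:
  assumes "A \<in> Obj V" "B \<in> Obj V" "C \<in> Obj V"
  shows "\<a> A B C \<in> Arr V" "Dom V (\<a> A B C) = A \<otimes> B \<otimes> C" "Cod V (\<a> A B C) = A \<otimes> (B \<otimes> C)"
    "is_iso V (\<a> A B C)"
  using monoidal assms by (simp_all add: monoidal_category_def)

lemma lunit_arr [simp]:
  assumes "A \<in> Obj V"
  shows "lunit V A \<in> Arr V" "Dom V (lunit V A) = \<I> \<otimes> A" "Cod V (lunit V A) = A" "is_iso V (lunit V A)"
  using monoidal assms by (simp_all add: monoidal_category_def)

lemma runit_arr [simp]:
  assumes "A \<in> Obj V"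
  shows "runit V A \<in> Arr V" "Dom V (runit V A) = A \<otimes> \<I>" "Cod V (runit V A) = A" "is_iso V (runit V A)"
  using monoidal assms by (simp_all add: monoidal_category_def)

lemma assoc_nat:
  "f \<in> Arr V \<Longrightarrow> g \<in> Arr V \<Longrightarrow> h \<in> Arr V \<Longrightarrow>
    \<a> (Cod V f) (Cod V g) (Cod V h) \<cdot> (f \<star> g \<star> h) = (f \<star> (g \<star> h)) \<cdot> \<a> (Dom V f) (Dom V g) (Dom V h)"
  using monoidal unfolding monoidal_category_def by blast

lemma lunit_nat: "f \<in> Arr V \<Longrightarrow> lunit V (Cod V f) \<cdot> (\<one> \<I> \<star> f) = f \<cdot> lunit V (Dom V f)"
  using monoidal unfolding monoidal_category_def by blast

lemma runit_nat: "f \<in> Arr V \<Longrightarrow> runit V (Cod V f) \<cdot> (f \<star> \<one> \<I>) = f \<cdot> runit V (Dom V f)"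
  using monoidal unfolding monoidal_category_def by blast

lemma triangle:
  "A \<in> Obj V \<Longrightarrow> B \<in> Obj V \<Longrightarrow> (\<one> A \<star> lunit V B) \<cdot> \<a> A \<I> B = runit V A \<star> \<one> B"
  using monoidal unfolding monoidal_category_def by blast

lemma pentagon:
  "A \<in> Obj V \<Longrightarrow> B \<in> Obj V \<Longrightarrow> C \<in> Obj V \<Longrightarrow> D \<in> Obj V \<Longrightarrow>
    (\<one> A \<star> \<a> B C D) \<cdot> \<a> A (B \<otimes> C) D \<cdot> (\<a> A B C \<star> \<one> D) = \<a> A B (C \<otimes> D) \<cdot> \<a> (A \<otimes> B) C D"
  using monoidal unfolding monoidal_category_def by metis

lemma is_iso_tens [simp]:
  assumes "is_iso V f" "is_iso V g"
  shows "is_iso V (f \<star> g)"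
  using assms is_iso_arr[OF assms(1)] is_iso_arr[OF assms(2)]
  by (intro is_isoI[where g = "inv_arr V f \<star> inv_arr V g"]) simp_all

section \<open>Inverse associators and derived coherence laws\<close>

lemma assoc_inv_nat:
  assumes "f \<in> Arr V" "g \<in> Arr V" "h \<in> Arr V"
  shows "\<b> (Cod V f) (Cod V g) (Cod V h) \<cdot> (f \<star> (g \<star> h)) = (f \<star> g \<star> h) \<cdot> \<b> (Dom V f) (Dom V g) (Dom V h)"
proof (rule iso_cancel_left[where f = "\<a> (Cod V f) (Cod V g) (Cod V h)"])
  show "\<a> (Cod V f) (Cod V g) (Cod V h) \<cdot> \<b> (Cod V f) (Cod V g) (Cod V h) \<cdot> (f \<star> (g \<star> h)) =
    \<a> (Cod V f) (Cod V g) (Cod V h) \<cdot> (f \<star> g \<star> h) \<cdot> \<b> (Dom V f) (Dom V g) (Dom V h)"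
    using assms comp_tail[OF assoc_nat[OF assms], of "\<b> (Dom V f) (Dom V g) (Dom V h)"] by simp
qed (use assms in simp_all)

lemma assoc_inv_nat_tail:
  assumes "f \<in> Arr V" "g \<in> Arr V" "h \<in> Arr V" "k \<in> Arr V" "Cod V k = Dom V f \<otimes> (Dom V g \<otimes> Dom V h)"
  shows "\<b> (Cod V f) (Cod V g) (Cod V h) \<cdot> (f \<star> (g \<star> h)) \<cdot> k =
    (f \<star> g \<star> h) \<cdot> \<b> (Dom V f) (Dom V g) (Dom V h) \<cdot> k"
  using assms comp_tail[OF assoc_inv_nat[OF assms(1-3)], of k] by simp

lemma assoc_nat_tail:
  assumes "f \<in> Arr V" "g \<in> Arr V" "h \<in> Arr V" "k \<in> Arr V" "Cod V k = Dom V f \<otimes> Dom V g \<otimes> Dom V h"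
  shows "\<a> (Cod V f) (Cod V g) (Cod V h) \<cdot> (f \<star> g \<star> h) \<cdot> k =
    (f \<star> (g \<star> h)) \<cdot> \<a> (Dom V f) (Dom V g) (Dom V h) \<cdot> k"
  using assms comp_tail[OF assoc_nat[OF assms(1-3)], of k] by simp

text \<open>The pentagon solved for inverse associators: both sides are composed with invertible
  arrows until the pentagon itself appears, and these are then cancelled. In this form it moves a
  left factor past a contraction.\<close>

lemma pentagon_inv:
  assumes [simp]: "A \<in> Obj V" "B \<in> Obj V" "C \<in> Obj V" "D \<in> Obj V"
  shows "\<a> (A \<otimes> B) C D \<cdot> (\<b> A B C \<star> \<one> D) \<cdot> \<b> A (B \<otimes> C) D = \<b> A B (C \<otimes> D) \<cdot> (\<one> A \<star> \<a> B C D)"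
proof -
  let ?p = "\<a> A (B \<otimes> C) D \<cdot> (\<a> A B C \<star> \<one> D)"
  have "\<a> A B (C \<otimes> D) \<cdot> (\<a> (A \<otimes> B) C D \<cdot> (\<b> A B C \<star> \<one> D) \<cdot> \<b> A (B \<otimes> C) D) \<cdot> ?p =
    \<a> A B (C \<otimes> D) \<cdot> \<a> (A \<otimes> B) C D"
    by simp
  also have "\<dots> = (\<one> A \<star> \<a> B C D) \<cdot> ?p"
    by (simp only: pentagon assms)
  also have "\<dots> = \<a> A B (C \<otimes> D) \<cdot> (\<b> A B (C \<otimes> D) \<cdot> (\<one> A \<star> \<a> B C D)) \<cdot> ?p"
    by simp
  finally have "(\<a> (A \<otimes> B) C D \<cdot> (\<b> A B C \<star> \<one> D) \<cdot> \<b> A (B \<otimes> C) D) \<cdot> ?p =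
      (\<b> A B (C \<otimes> D) \<cdot> (\<one> A \<star> \<a> B C D)) \<cdot> ?p"
    by (rule iso_cancel_left[rotated]) simp_all
  then show ?thesis
    by (rule iso_cancel_right[rotated]) simp_all
qed

text \<open>Companion form, needed for the coherence of \<open>theta\<close> under one more edge on
  the right.\<close>

lemma pentagon_inv':
  assumes [simp]: "A \<in> Obj V" "B \<in> Obj V" "C \<in> Obj V" "D \<in> Obj V"
  shows "\<b> A (B \<otimes> C) D \<cdot> (\<one> A \<star> \<b> B C D) \<cdot> \<a> A B (C \<otimes> D) = (\<a> A B C \<star> \<one> D) \<cdot> \<b> (A \<otimes> B) C D"
proof -
  let ?p = "\<a> (A \<otimes> B) C D"
  have "(\<b> A (B \<otimes> C) D \<cdot> (\<one> A \<star> \<b> B C D) \<cdot> \<a> A B (C \<otimes> D)) \<cdot> ?p =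
    \<b> A (B \<otimes> C) D \<cdot> (\<one> A \<star> \<b> B C D) \<cdot> \<a> A B (C \<otimes> D) \<cdot> ?p"
    by simp
  also have "\<dots> = \<b> A (B \<otimes> C) D \<cdot> (\<one> A \<star> \<b> B C D) \<cdot>
      (\<one> A \<star> \<a> B C D) \<cdot> \<a> A (B \<otimes> C) D \<cdot> (\<a> A B C \<star> \<one> D)"
    by (simp only: pentagon assms)
  also have "\<dots> = ((\<a> A B C \<star> \<one> D) \<cdot> \<b> (A \<otimes> B) C D) \<cdot> ?p"
    by simp
  finally show ?thesis
    by (rule iso_cancel_right[rotated]) simp_all
qed

text \<open>The classical derivation from pentagon and triangle: naturality of the invertible
  \<open>lunit\<close> makes tensoring with \<open>\<I>\<close> on the left faithful, so it suffices
  to compare the two arrows after that operation, where both axioms apply.\<close>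

lemma lunit_tens:
  assumes [simp]: "A \<in> Obj V" "B \<in> Obj V"
  shows "lunit V (A \<otimes> B) \<cdot> \<a> \<I> A B = lunit V A \<star> \<one> B"
proof -
  let ?p = "\<a> \<I> (\<I> \<otimes> A) B \<cdot> (\<a> \<I> \<I> A \<star> \<one> B)"
  have "(\<one> \<I> \<star> (lunit V (A \<otimes> B) \<cdot> \<a> \<I> A B)) \<cdot> ?p =
      (\<one> \<I> \<star> lunit V (A \<otimes> B)) \<cdot> (\<one> \<I> \<star> \<a> \<I> A B) \<cdot> ?p"
    by simp
  also have "\<dots> = (\<one> \<I> \<star> lunit V (A \<otimes> B)) \<cdot> \<a> \<I> \<I> (A \<otimes> B) \<cdot> \<a> (\<I> \<otimes> \<I>) A B"
    by (simp only: pentagon assms munit_obj)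
  also have "\<dots> = (runit V \<I> \<star> \<one> (A \<otimes> B)) \<cdot> \<a> (\<I> \<otimes> \<I>) A B"
    by (rule comp_tail[OF triangle]) simp_all
  also have "\<dots> = \<a> \<I> A B \<cdot> ((runit V \<I> \<star> \<one> A) \<star> \<one> B)"
    using assoc_nat[of "runit V \<I>" "\<one> A" "\<one> B"] by simp
  also have "\<dots> = \<a> \<I> A B \<cdot> (((\<one> \<I> \<star> lunit V A) \<cdot> \<a> \<I> \<I> A) \<star> \<one> B)"
    by (simp only: triangle assms munit_obj)
  also have "\<dots> = \<a> \<I> A B \<cdot> ((\<one> \<I> \<star> lunit V A) \<star> \<one> B) \<cdot> (\<a> \<I> \<I> A \<star> \<one> B)"
    by simp
  also have "\<dots> = (\<one> \<I> \<star> (lunit V A \<star> \<one> B)) \<cdot> ?p"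
    using assoc_nat_tail[of "\<one> \<I>" "lunit V A" "\<one> B" "\<a> \<I> \<I> A \<star> \<one> B"] by simp
  finally have "\<one> \<I> \<star> (lunit V (A \<otimes> B) \<cdot> \<a> \<I> A B) = \<one> \<I> \<star> (lunit V A \<star> \<one> B)"
    by (rule iso_cancel_right[rotated]) simp_all
  then have "(lunit V (A \<otimes> B) \<cdot> \<a> \<I> A B) \<cdot> lunit V (\<I> \<otimes> A \<otimes> B) = (lunit V A \<star> \<one> B) \<cdot> lunit V (\<I> \<otimes> A \<otimes> B)"
    using lunit_nat[of "lunit V (A \<otimes> B) \<cdot> \<a> \<I> A B"] lunit_nat[of "lunit V A \<star> \<one> B"]
    by (simp del: comp_assoc)
  then show ?thesis
    by (rule iso_cancel_right[rotated]) simp_all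
qed

text \<open>Mirror image of the preceding argument: tensoring with \<open>\<I>\<close> on the right
  is faithful by naturality of \<open>runit\<close>, and the associator put in front at the start is
  cancelled again.\<close>

lemma runit_tens:
  assumes [simp]: "A \<in> Obj V" "B \<in> Obj V"
  shows "(\<one> A \<star> runit V B) \<cdot> \<a> A B \<I> = runit V (A \<otimes> B)"
proof -
  have "\<a> A B \<I> \<cdot> (((\<one> A \<star> runit V B) \<cdot> \<a> A B \<I>) \<star> \<one> \<I>) =
      \<a> A B \<I> \<cdot> (\<one> A \<star> runit V B \<star> \<one> \<I>) \<cdot> (\<a> A B \<I> \<star> \<one> \<I>)"
    by simp
  also have "\<dots> = (\<one> A \<star> (runit V B \<star> \<one> \<I>)) \<cdot> \<a> A (B \<otimes> \<I>) \<I> \<cdot> (\<a> A B \<I> \<star> \<one> \<I>)"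
    using assoc_nat_tail[of "\<one> A" "runit V B" "\<one> \<I>" "\<a> A B \<I> \<star> \<one> \<I>"] by simp
  also have "\<dots> = (\<one> A \<star> ((\<one> B \<star> lunit V \<I>) \<cdot> \<a> B \<I> \<I>)) \<cdot> \<a> A (B \<otimes> \<I>) \<I> \<cdot> (\<a> A B \<I> \<star> \<one> \<I>)"
    by (simp only: triangle assms munit_obj)
  also have "\<dots> = (\<one> A \<star> (\<one> B \<star> lunit V \<I>)) \<cdot> (\<one> A \<star> \<a> B \<I> \<I>) \<cdot> \<a> A (B \<otimes> \<I>) \<I> \<cdot> (\<a> A B \<I> \<star> \<one> \<I>)"
    by simp
  also have "\<dots> = (\<one> A \<star> (\<one> B \<star> lunit V \<I>)) \<cdot> \<a> A B (\<I> \<otimes> \<I>) \<cdot> \<a> (A \<otimes> B) \<I> \<I>"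
    by (simp only: pentagon assms munit_obj)
  also have "\<dots> = \<a> A B \<I> \<cdot> (\<one> (A \<otimes> B) \<star> lunit V \<I>) \<cdot> \<a> (A \<otimes> B) \<I> \<I>"
    using assoc_nat_tail[of "\<one> A" "\<one> B" "lunit V \<I>" "\<a> (A \<otimes> B) \<I> \<I>"] by simp
  also have "\<dots> = \<a> A B \<I> \<cdot> (runit V (A \<otimes> B) \<star> \<one> \<I>)"
    by (simp only: triangle assms munit_obj tens_obj)
  finally have "((\<one> A \<star> runit V B) \<cdot> \<a> A B \<I>) \<star> \<one> \<I> = runit V (A \<otimes> B) \<star> \<one> \<I>"
    by (rule iso_cancel_left[rotated]) simp_all
  then have "((\<one> A \<star> runit V B) \<cdot> \<a> A B \<I>) \<cdot> runit V (A \<otimes> B \<otimes> \<I>) = runit V (A \<otimes> B) \<cdot> runit V (A \<otimes> B \<otimes> \<I>)"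
    using runit_nat[of "(\<one> A \<star> runit V B) \<cdot> \<a> A B \<I>"] runit_nat[of "runit V (A \<otimes> B)"]
    by (simp del: comp_assoc)
  then show ?thesis
    by (rule iso_cancel_right[rotated]) simp_all
qed

end


section \<open>Evaluation of strings\<close>

lemma vcatD:
  assumes "is_vcat V C"
  shows "\<And>a b. a \<in> VOb C \<Longrightarrow> b \<in> VOb C \<Longrightarrow> VHom C a b \<in> Obj V"
    "\<And>a. a \<in> VOb C \<Longrightarrow> VUnit C a \<in> Arr V"
    "\<And>a. a \<in> VOb C \<Longrightarrow> Dom V (VUnit C a) = munit V"
    "\<And>a. a \<in> VOb C \<Longrightarrow> Cod V (VUnit C a) = VHom C a a"
    "\<And>a b c. a \<in> VOb C \<Longrightarrow> b \<in> VOb C \<Longrightarrow> c \<in> VOb C \<Longrightarrow> VComp C a b c \<in> Arr V"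
    "\<And>a b c. a \<in> VOb C \<Longrightarrow> b \<in> VOb C \<Longrightarrow> c \<in> VOb C \<Longrightarrow>
       Dom V (VComp C a b c) = tens_o V (VHom C b c) (VHom C a b)"
    "\<And>a b c. a \<in> VOb C \<Longrightarrow> b \<in> VOb C \<Longrightarrow> c \<in> VOb C \<Longrightarrow> Cod V (VComp C a b c) = VHom C a c"
    "\<And>a b c d. a \<in> VOb C \<Longrightarrow> b \<in> VOb C \<Longrightarrow> c \<in> VOb C \<Longrightarrow> d \<in> VOb C \<Longrightarrow>
       Comp V (VComp C a b d) (tens_a V (VComp C b c d) (Ident V (VHom C a b))) =
       Comp V (VComp C a c d) (Comp V (tens_a V (Ident V (VHom C c d)) (VComp C a b c))
         (assoc V (VHom C c d) (VHom C b c) (VHom C a b)))"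
    "\<And>a b. a \<in> VOb C \<Longrightarrow> b \<in> VOb C \<Longrightarrow>
       Comp V (VComp C a b b) (tens_a V (VUnit C b) (Ident V (VHom C a b))) = lunit V (VHom C a b)"
    "\<And>a b. a \<in> VOb C \<Longrightarrow> b \<in> VOb C \<Longrightarrow>
       Comp V (VComp C a a b) (tens_a V (Ident V (VHom C a b)) (VUnit C a)) = runit V (VHom C a b)"
  using assms unfolding is_vcat_def in_Hom_iff by blast+

lemma vfunD:
  assumes "is_vfun V T"
  shows "is_vcat V (VSrc T)" "is_vcat V (VTgt T)"
    "\<And>a. a \<in> VOb (VSrc T) \<Longrightarrow> VFo T a \<in> VOb (VTgt T)"
    "\<And>a b. a \<in> VOb (VSrc T) \<Longrightarrow> b \<in> VOb (VSrc T) \<Longrightarrow> VFh T a b \<in> Arr V"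
    "\<And>a b. a \<in> VOb (VSrc T) \<Longrightarrow> b \<in> VOb (VSrc T) \<Longrightarrow> Dom V (VFh T a b) = VHom (VSrc T) a b"
    "\<And>a b. a \<in> VOb (VSrc T) \<Longrightarrow> b \<in> VOb (VSrc T) \<Longrightarrow>
       Cod V (VFh T a b) = VHom (VTgt T) (VFo T a) (VFo T b)"
    "\<And>a. a \<in> VOb (VSrc T) \<Longrightarrow> Comp V (VFh T a a) (VUnit (VSrc T) a) = VUnit (VTgt T) (VFo T a)"
    "\<And>a b c. a \<in> VOb (VSrc T) \<Longrightarrow> b \<in> VOb (VSrc T) \<Longrightarrow> c \<in> VOb (VSrc T) \<Longrightarrow>
       Comp V (VFh T a c) (VComp (VSrc T) a b c) =
       Comp V (VComp (VTgt T) (VFo T a) (VFo T b) (VFo T c)) (tens_a V (VFh T b c) (VFh T a b))"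
    "\<And>a. a \<notin> VOb (VSrc T) \<Longrightarrow> VFo T a = undefined"
    "\<And>a b. \<not> (a \<in> VOb (VSrc T) \<and> b \<in> VOb (VSrc T)) \<Longrightarrow> VFh T a b = undefined"
  using assms unfolding is_vfun_def Let_def in_Hom_iff by blast+

locale vdiagram = mon V for V :: "('o, 'm) monoidal" +
  fixes I :: "('i, 'f) category" and F :: "('i, 'f, 'u, 'o, 'm) vdiagram"
  assumes diagram: "is_functor I (VCat V) F"
begin

sublocale I: cat I
  using functorD[OF diagram] by unfold_locales

abbreviation edges where "edges \<equiv> F_edges I F"
abbreviation E where "E \<equiv> edge_hom F"
abbreviation evo where "evo \<equiv> ev_obj V F"
abbreviation \<theta> where "\<theta> \<equiv> theta V F"

lemma vcat: "i \<in> Obj I \<Longrightarrow> is_vcat V (Fo F i)"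
  using functorD(3)[OF diagram] by (simp add: VCat_def)

lemma vfun:
  assumes "f \<in> Arr I"
  shows "is_vfun V (Fa F f)" "VSrc (Fa F f) = Fo F (Dom I f)" "VTgt (Fa F f) = Fo F (Cod I f)"
  using functorD(4-6)[OF diagram assms] by (simp_all add: VCat_def)

lemma in_edges [simp]:
  "(i, x, y) \<in> edges \<longleftrightarrow> i \<in> Obj I \<and> x \<in> VOb (Fo F i) \<and> y \<in> VOb (Fo F i)"
  by (simp add: F_edges_def)

lemma E_simp [simp]: "E (i, x, y) = VHom (Fo F i) x y"
  by (simp add: edge_hom_def)

lemma E_obj [simp]: "e \<in> edges \<Longrightarrow> E e \<in> Obj V"
  by (cases e) (simp add: vcatD(1)[OF vcat])

text \<open>No matching of endpoints is required: evaluation and \<open>\<theta>\<close> depend on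
  the edges alone, and their coherence can be settled before classes of objects come into
  play.\<close>

abbreviation str where "str s \<equiv> s \<noteq> [] \<and> set s \<subseteq> edges"

lemma evo_single [simp]: "evo [e] = E e"
  by (simp add: ev_obj_def)

lemma evo_snoc [simp]: "s \<noteq> [] \<Longrightarrow> evo (s @ [e]) = evo s \<otimes> E e"
  by (simp add: ev_obj_def)

lemma evo_snoc2 [simp]: "s \<noteq> [] \<Longrightarrow> evo (s @ [e, d]) = evo s \<otimes> E e \<otimes> E d"
  by (simp add: ev_obj_def)

lemma evo_pair [simp]: "evo [e, d] = E e \<otimes> E d"
  by (simp add: ev_obj_def)

lemma evo_obj [simp]: "s \<noteq> [] \<Longrightarrow> set s \<subseteq> edges \<Longrightarrow> evo s \<in> Obj V"
  by (induction s rule: rev_nonempty_induct) auto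

text \<open>\<open>reassoc\<close> consumes its list from the front, while evaluation grows at the
  end. This is the recursion in the other direction, with one inverse associator for each appended
  edge.\<close>

lemma reassoc_snoc:
  "reassoc V F A B m (r @ [d]) =
     (reassoc V F A B m r \<star> \<one> (E d)) \<cdot> \<b> A (foldl (\<lambda>A e. A \<otimes> E e) B r) (E d)"
  by (induction r arbitrary: B m) simp_all

lemma theta_single [simp]: "\<theta> t [e] = \<one> (evo t \<otimes> E e)"
  by (simp add: theta_def)

lemma theta_snoc:
  "s \<noteq> [] \<Longrightarrow> \<theta> t (s @ [d]) = (\<theta> t s \<star> \<one> (E d)) \<cdot> \<b> (evo t) (evo s) (E d)"
  by (simp add: theta_def reassoc_snoc Let_def ev_obj_def)

lemma theta_arr_iso:
  assumes "str t"
  shows "str s \<Longrightarrow> is_iso V (\<theta> t s) \<and> \<theta> t s \<in> Hom V (evo t \<otimes> evo s) (evo (t @ s))"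
proof (elim conjE, induction s rule: rev_nonempty_induct)
  case (snoc d s)
  then show ?case
    using assms evo_snoc[of "t @ s" d] by (simp add: theta_snoc del: evo_snoc) simp
qed (use assms in simp)

lemma theta_arr [simp]:
  assumes "t \<noteq> []" "set t \<subseteq> edges" "s \<noteq> []" "set s \<subseteq> edges"
  shows "is_iso V (\<theta> t s)" "\<theta> t s \<in> Arr V" "Dom V (\<theta> t s) = evo t \<otimes> evo s" "Cod V (\<theta> t s) = evo (t @ s)"
  using theta_arr_iso[of t s] assms by auto

text \<open>Induction on the last edge of \<open>s\<close>. In the base case an inverse associator
  meets the associator, because \<open>\<theta>\<close> is an identity on a single right-hand edge.
  The step moves \<open>\<theta> t s\<close> through an inverse associator and then uses
  \<open>pentagon_inv'\<close>.\<close>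

lemma theta_assoc:
  assumes u: "str u" and t: "str t"
  shows "str s \<Longrightarrow> \<theta> u (t @ s) \<cdot> (\<one> (evo u) \<star> \<theta> t s) \<cdot> \<a> (evo u) (evo t) (evo s) =
    \<theta> (u @ t) s \<cdot> (\<theta> u t \<star> \<one> (evo s))"
proof (elim conjE, induction s rule: rev_nonempty_induct)
  case (single d)
  then show ?case using u t by (simp add: theta_snoc)
next
  case (snoc d s)
  let ?U = "evo u" and ?T = "evo t" and ?S = "evo s" and ?D = "E d"
  note [simp] = u t snoc.hyps
  have [simp]: "set s \<subseteq> edges" "d \<in> edges" using snoc.prems by auto
  have "\<theta> u (t @ s @ [d]) \<cdot> (\<one> ?U \<star> \<theta> t (s @ [d])) \<cdot> \<a> ?U ?T (evo (s @ [d])) =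
    (\<theta> u (t @ s) \<star> \<one> ?D) \<cdot> \<b> ?U (evo (t @ s)) ?D \<cdot> (\<one> ?U \<star> (\<theta> t s \<star> \<one> ?D)) \<cdot>
      (\<one> ?U \<star> \<b> ?T ?S ?D) \<cdot> \<a> ?U ?T (?S \<otimes> ?D)"
    using theta_snoc[of "t @ s" u d] by (simp add: theta_snoc)
  also have "\<dots> = (\<theta> u (t @ s) \<star> \<one> ?D) \<cdot> (\<one> ?U \<star> \<theta> t s \<star> \<one> ?D) \<cdot>
      \<b> ?U (?T \<otimes> ?S) ?D \<cdot> (\<one> ?U \<star> \<b> ?T ?S ?D) \<cdot> \<a> ?U ?T (?S \<otimes> ?D)"
    using assoc_inv_nat_tail[of "\<one> ?U" "\<theta> t s" "\<one> ?D" "(\<one> ?U \<star> \<b> ?T ?S ?D) \<cdot> \<a> ?U ?T (?S \<otimes> ?D)"]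
    by simp
  also have "\<dots> = (\<theta> u (t @ s) \<star> \<one> ?D) \<cdot> (\<one> ?U \<star> \<theta> t s \<star> \<one> ?D) \<cdot>
      (\<a> ?U ?T ?S \<star> \<one> ?D) \<cdot> \<b> (?U \<otimes> ?T) ?S ?D"
    by (subst pentagon_inv') simp_all
  also have "\<dots> = ((\<theta> u (t @ s) \<cdot> (\<one> ?U \<star> \<theta> t s) \<cdot> \<a> ?U ?T ?S) \<star> \<one> ?D) \<cdot> \<b> (?U \<otimes> ?T) ?S ?D"
    by simp
  also have "\<dots> = ((\<theta> (u @ t) s \<cdot> (\<theta> u t \<star> \<one> ?S)) \<star> \<one> ?D) \<cdot> \<b> (?U \<otimes> ?T) ?S ?D"
    by (subst snoc.IH) simp_all
  also have "\<dots> = (\<theta> (u @ t) s \<star> \<one> ?D) \<cdot> (\<theta> u t \<star> \<one> ?S \<star> \<one> ?D) \<cdot> \<b> (?U \<otimes> ?T) ?S ?D"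
    by simp
  also have "\<dots> = (\<theta> (u @ t) s \<star> \<one> ?D) \<cdot> \<b> (evo (u @ t)) ?S ?D \<cdot> (\<theta> u t \<star> (\<one> ?S \<star> \<one> ?D))"
    using assoc_inv_nat[of "\<theta> u t" "\<one> ?S" "\<one> ?D"] by simp
  also have "\<dots> = \<theta> (u @ t) (s @ [d]) \<cdot> (\<theta> u t \<star> \<one> (evo (s @ [d])))"
    by (simp add: theta_snoc)
  finally show ?case .
qed


subsection \<open>Generators\<close>

lemma star_simps [simp]:
  "gen_src (star_left t g) = t @ gen_src g" "gen_tgt (star_left t g) = t @ gen_tgt g"
  "gen_src (star_right g s) = gen_src g @ s" "gen_tgt (star_right g s) = gen_tgt g @ s"
  "gen_ok I F (star_left t g) = gen_ok I F g" "gen_ok I F (star_right g s) = gen_ok I F g"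
  "star_left t (star_right g s) = star_right (star_left t g) s"
  "star_right (star_right g s) s' = star_right g (s @ s')"
  by (cases g; simp)+

lemma gen_nonempty [simp]: "gen_src g \<noteq> []" "gen_tgt g \<noteq> []"
  by (cases g; simp)+

lemma ev_gen_snoc: "ev_gen V F (star_right g [d]) = ev_gen V F g \<star> \<one> (E d)"
proof (cases g)
  case (Transport l f e e' r)
  then show ?thesis by (cases e) (simp add: whisker_right_def Let_def)
next
  case (Contract l i x y z r)
  then show ?thesis by (simp add: whisker_right_def Let_def)
qed

text \<open>Like \<open>str\<close>, this leaves endpoints aside, so it is stable under whiskering
  by arbitrary lists of edges.\<close>

definition wf_gen :: "('i, 'f, 'u) gen \<Rightarrow> bool" where
  "wf_gen g \<longleftrightarrow> gen_ok I F g \<and> set (gen_src g) \<subseteq> edges \<and> set (gen_tgt g) \<subseteq> edges"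

lemma wf_gen_star_right [simp]: "wf_gen (star_right g s) \<longleftrightarrow> wf_gen g \<and> set s \<subseteq> edges"
  by (auto simp: wf_gen_def)

lemma wf_gen_star_left [simp]: "wf_gen (star_left t g) \<longleftrightarrow> wf_gen g \<and> set t \<subseteq> edges"
  by (auto simp: wf_gen_def)

lemma wf_gen_edges [simp]:
  "wf_gen g \<Longrightarrow> set (gen_src g) \<subseteq> edges" "wf_gen g \<Longrightarrow> set (gen_tgt g) \<subseteq> edges"
  by (auto simp: wf_gen_def)

text \<open>Only the right context is stripped off. The base cases keep \<open>l\<close> arbitrary
  because \<open>ev_gen\<close> reassociates a contraction after a non-empty prefix, so the left
  context is not just one more identity factor.\<close>

lemma wf_gen_induct [consumes 1, case_names transport contract snoc]:
  assumes "wf_gen g"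
    and "\<And>l f i x y i' x' y'. set l \<subseteq> edges \<Longrightarrow> f \<in> Arr I \<Longrightarrow> i = Dom I f \<Longrightarrow> i' = Cod I f \<Longrightarrow>
      x \<in> VOb (Fo F i) \<Longrightarrow> y \<in> VOb (Fo F i) \<Longrightarrow> x' = VFo (Fa F f) x \<Longrightarrow> y' = VFo (Fa F f) y \<Longrightarrow>
      x' \<in> VOb (Fo F i') \<Longrightarrow> y' \<in> VOb (Fo F i') \<Longrightarrow>
      P (Transport l f (i, x, y) (i', x', y') [])"
    and "\<And>l i x y z. set l \<subseteq> edges \<Longrightarrow> i \<in> Obj I \<Longrightarrow> x \<in> VOb (Fo F i) \<Longrightarrow> y \<in> VOb (Fo F i) \<Longrightarrow>
      z \<in> VOb (Fo F i) \<Longrightarrow> P (Contract l i x y z [])"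
    and snoc: "\<And>g d. wf_gen g \<Longrightarrow> d \<in> edges \<Longrightarrow> P g \<Longrightarrow> P (star_right g [d])"
  shows "P g"
proof -
  have right: "P (star_right g r)" if "P g" "wf_gen g" "set r \<subseteq> edges" for g and r :: "('i, 'u) edge list"
    using that(3)
  proof (induction r rule: rev_induct)
    case Nil
    have "star_right g [] = g" by (cases g) simp_all
    then show ?case using that(1) by simp
  next
    case (snoc d r)
    then show ?case using that(2) assms(4)[of "star_right g r" d] by simp
  qed
  show ?thesis
  proof (cases g)
    case (Transport l f e e' r)
    obtain i x y i' x' y' where e: "e = (i, x, y)" "e' = (i', x', y')" by (metis prod_cases3)
    have "P (star_right (Transport l f e e' []) r)"
    proof (rule right)
      show "P (Transport l f e e' [])"
        using assms(1) Transport unfolding e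
        by (intro assms(2)) (auto simp: wf_gen_def edge_arrow_def)
    qed (use assms(1) Transport in \<open>auto simp: wf_gen_def\<close>)
    then show ?thesis using Transport by simp
  next
    case (Contract l i x y z r)
    have "P (star_right (Contract l i x y z []) r)"
    proof (rule right)
      show "P (Contract l i x y z [])"
        using assms(1) Contract by (intro assms(3)) (auto simp: wf_gen_def)
    qed (use assms(1) Contract in \<open>auto simp: wf_gen_def\<close>)
    then show ?thesis using Contract by simp
  qed
qed

lemma VFh_arr:
  assumes "f \<in> Arr I" "x \<in> VOb (Fo F (Dom I f))" "y \<in> VOb (Fo F (Dom I f))"
  shows "VFh (Fa F f) x y \<in> Arr V" "Dom V (VFh (Fa F f) x y) = VHom (Fo F (Dom I f)) x y"
    "Cod V (VFh (Fa F f) x y) = VHom (Fo F (Cod I f)) (VFo (Fa F f) x) (VFo (Fa F f) y)"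
  using vfunD(4-6)[OF vfun(1)[OF assms(1)], unfolded vfun(2,3)[OF assms(1)], OF assms(2,3)] by simp_all

lemma ev_gen_Hom: "wf_gen g \<Longrightarrow> ev_gen V F g \<in> Hom V (evo (gen_src g)) (evo (gen_tgt g))"
proof (induction rule: wf_gen_induct)
  case (transport l f i x y i' x' y')
  then show ?case
    by (cases "l = []") (simp_all add: VFh_arr whisker_right_def vcatD(1)[OF vcat])
next
  case (contract l i x y z)
  then show ?case
    by (cases "l = []") (simp_all add: vcatD[OF vcat] whisker_right_def)
next
  case (snoc g d)
  then show ?case by (simp add: ev_gen_snoc)
qed

lemma ev_gen_arr [simp]:
  assumes "wf_gen g"
  shows "ev_gen V F g \<in> Arr V" "Dom V (ev_gen V F g) = evo (gen_src g)" "Cod V (ev_gen V F g) = evo (gen_tgt g)"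
  using ev_gen_Hom[OF assms] by simp_all

text \<open>Each edge of \<open>s\<close> contributes one identity factor on the right, so the
  induction on \<open>s\<close> needs nothing beyond naturality of the inverse associator.\<close>

lemma ev_gen_star_right:
  assumes [simp]: "wf_gen g"
  shows "str s \<Longrightarrow> ev_gen V F (star_right g s) \<cdot> \<theta> (gen_src g) s = \<theta> (gen_tgt g) s \<cdot> (ev_gen V F g \<star> \<one> (evo s))"
proof (elim conjE, induction s rule: rev_nonempty_induct)
  case (single d)
  then show ?case by (simp add: ev_gen_snoc)
next
  case (snoc d s)
  note [simp] = snoc.hyps
  have [simp]: "set s \<subseteq> edges" "d \<in> edges" using snoc.prems by auto
  let ?S = "evo (gen_src g)" and ?T = "evo (gen_tgt g)" and ?g = "ev_gen V F g"
  have "ev_gen V F (star_right g (s @ [d])) = ev_gen V F (star_right g s) \<star> \<one> (E d)"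
    using ev_gen_snoc[of "star_right g s" d] by simp
  then have "ev_gen V F (star_right g (s @ [d])) \<cdot> \<theta> (gen_src g) (s @ [d]) =
      ((ev_gen V F (star_right g s) \<cdot> \<theta> (gen_src g) s) \<star> \<one> (E d)) \<cdot> \<b> ?S (evo s) (E d)"
    by (simp add: theta_snoc)
  also have "\<dots> = ((\<theta> (gen_tgt g) s \<cdot> (?g \<star> \<one> (evo s))) \<star> \<one> (E d)) \<cdot> \<b> ?S (evo s) (E d)"
    by (simp add: snoc.IH)
  also have "\<dots> = (\<theta> (gen_tgt g) s \<star> \<one> (E d)) \<cdot> (?g \<star> \<one> (evo s) \<star> \<one> (E d)) \<cdot> \<b> ?S (evo s) (E d)"
    by simp
  also have "\<dots> = (\<theta> (gen_tgt g) s \<star> \<one> (E d)) \<cdot> \<b> ?T (evo s) (E d) \<cdot> (?g \<star> (\<one> (evo s) \<star> \<one> (E d)))"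
    using assoc_inv_nat[of ?g "\<one> (evo s)" "\<one> (E d)"] by simp
  also have "\<dots> = \<theta> (gen_tgt g) (s @ [d]) \<cdot> (?g \<star> \<one> (evo (s @ [d])))"
    by (simp add: theta_snoc)
  finally show ?case .
qed

text \<open>Left whiskering alters the prefix of the generator, so the induction is over
  \<open>g\<close> and not over the whiskering string. Contraction after a non-empty prefix is the
  case that calls for the pentagon.\<close>

lemma ev_gen_star_left:
  assumes "str t"
  shows "wf_gen g \<Longrightarrow> ev_gen V F (star_left t g) \<cdot> \<theta> t (gen_src g) = \<theta> t (gen_tgt g) \<cdot> (\<one> (evo t) \<star> ev_gen V F g)"
proof (induction rule: wf_gen_induct)
  case (transport l f i x y i' x' y')
  let ?h = "VFh (Fa F f) x y"
  have [simp]: "x \<in> VOb (Fo F (Dom I f))" "y \<in> VOb (Fo F (Dom I f))"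
    "VFo (Fa F f) x \<in> VOb (Fo F (Cod I f))" "VFo (Fa F f) y \<in> VOb (Fo F (Cod I f))"
    using transport by simp_all
  note [simp] = assms transport(1-4,7,8) VFh_arr vcatD(1)[OF vcat]
  show ?case
  proof (cases "l = []")
    case False
    then show ?thesis
      using assoc_inv_nat[of "\<one> (evo t)" "\<one> (evo l)" ?h] by (simp add: whisker_right_def theta_snoc)
  qed (simp add: whisker_right_def)
next
  case (contract l i x y z)
  let ?h = "VComp (Fo F i) x y z"
  note [simp] = assms contract vcatD[OF vcat]
  let ?P = "VHom (Fo F i) y z" and ?Q = "VHom (Fo F i) x y" and ?R = "VHom (Fo F i) x z"
  show ?case
  proof (cases "l = []")
    case True
    \<comment> \<open>The prefix \<open>t\<close> alone makes the whiskered contraction pick up an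
      associator, which cancels the inverse associator in \<open>\<theta>\<close>.\<close>
    then show ?thesis using theta_snoc[of "[(i, y, z)]" t "(i, x, y)"] by (simp add: whisker_right_def)
  next
    case False
    note [simp] = False
    let ?A = "evo t" and ?L = "evo l" and ?M = "evo (t @ l)" and ?\<theta> = "\<theta> t l"
    have "ev_gen V F (star_left t (Contract l i x y z [])) \<cdot> \<theta> t (gen_src (Contract l i x y z [])) =
      (\<one> ?M \<star> ?h) \<cdot> \<a> ?M ?P ?Q \<cdot> (?\<theta> \<star> \<one> ?P \<star> \<one> ?Q) \<cdot> (\<b> ?A ?L ?P \<star> \<one> ?Q) \<cdot> \<b> ?A (?L \<otimes> ?P) ?Q"
      using theta_snoc[of "l @ [(i, y, z)]" t "(i, x, y)"] by (simp add: whisker_right_def theta_snoc)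
    also have "\<dots> = (\<one> ?M \<star> ?h) \<cdot> (?\<theta> \<star> (\<one> ?P \<star> \<one> ?Q)) \<cdot> \<a> (?A \<otimes> ?L) ?P ?Q \<cdot> (\<b> ?A ?L ?P \<star> \<one> ?Q) \<cdot> \<b> ?A (?L \<otimes> ?P) ?Q"
      using assoc_nat_tail[of ?\<theta> "\<one> ?P" "\<one> ?Q" "(\<b> ?A ?L ?P \<star> \<one> ?Q) \<cdot> \<b> ?A (?L \<otimes> ?P) ?Q"] by simp
    also have "\<dots> = (\<one> ?M \<star> ?h) \<cdot> (?\<theta> \<star> (\<one> ?P \<star> \<one> ?Q)) \<cdot> \<b> ?A ?L (?P \<otimes> ?Q) \<cdot> (\<one> ?A \<star> \<a> ?L ?P ?Q)"
      by (subst pentagon_inv) simp_all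
    also have "\<dots> = (?\<theta> \<star> \<one> ?R) \<cdot> (\<one> ?A \<star> \<one> ?L \<star> ?h) \<cdot> \<b> ?A ?L (?P \<otimes> ?Q) \<cdot> (\<one> ?A \<star> \<a> ?L ?P ?Q)"
      by simp
    also have "\<dots> = (?\<theta> \<star> \<one> ?R) \<cdot> \<b> ?A ?L ?R \<cdot> (\<one> ?A \<star> (\<one> ?L \<star> ?h)) \<cdot> (\<one> ?A \<star> \<a> ?L ?P ?Q)"
      using assoc_inv_nat_tail[of "\<one> ?A" "\<one> ?L" ?h "\<one> ?A \<star> \<a> ?L ?P ?Q"] by simp
    also have "\<dots> = \<theta> t (gen_tgt (Contract l i x y z [])) \<cdot> (\<one> ?A \<star> ev_gen V F (Contract l i x y z []))"
      by (simp add: whisker_right_def theta_snoc)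
    finally show ?thesis .
  qed
next
  case (snoc g d)
  note [simp] = assms snoc.hyps
  let ?S = "evo (gen_src g)" and ?T = "evo (gen_tgt g)" and ?g = "ev_gen V F g" and ?A = "evo t"
  have "ev_gen V F (star_left t (star_right g [d])) \<cdot> \<theta> t (gen_src (star_right g [d])) =
      ((ev_gen V F (star_left t g) \<cdot> \<theta> t (gen_src g)) \<star> \<one> (E d)) \<cdot> \<b> ?A ?S (E d)"
    using ev_gen_snoc[of "star_left t g" d] by (simp add: theta_snoc)
  also have "\<dots> = ((\<theta> t (gen_tgt g) \<cdot> (\<one> ?A \<star> ?g)) \<star> \<one> (E d)) \<cdot> \<b> ?A ?S (E d)"
    by (simp add: snoc.IH)
  also have "\<dots> = (\<theta> t (gen_tgt g) \<star> \<one> (E d)) \<cdot> (\<one> ?A \<star> ?g \<star> \<one> (E d)) \<cdot> \<b> ?A ?S (E d)"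
    by simp
  also have "\<dots> = (\<theta> t (gen_tgt g) \<star> \<one> (E d)) \<cdot> \<b> ?A ?T (E d) \<cdot> (\<one> ?A \<star> (?g \<star> \<one> (E d)))"
    using assoc_inv_nat[of "\<one> ?A" ?g "\<one> (E d)"] by simp
  also have "\<dots> = \<theta> t (gen_tgt (star_right g [d])) \<cdot> (\<one> ?A \<star> ev_gen V F (star_right g [d]))"
    by (simp add: theta_snoc ev_gen_snoc)
  finally show ?case .
qed

text \<open>After composing with the invertible \<open>\<theta>\<close> the two generators act on
  separate tensor factors, where their order is immaterial.\<close>

lemma ev_interchange:
  assumes [simp]: "wf_gen \<alpha>" "wf_gen \<beta>"
  shows "ev_gen V F (star_right \<beta> (gen_tgt \<alpha>)) \<cdot> ev_gen V F (star_left (gen_src \<beta>) \<alpha>) =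
    ev_gen V F (star_left (gen_tgt \<beta>) \<alpha>) \<cdot> ev_gen V F (star_right \<beta> (gen_src \<alpha>))"
proof (rule iso_cancel_right[where f = "\<theta> (gen_src \<beta>) (gen_src \<alpha>)"])
  let ?a = "ev_gen V F \<alpha>" and ?b = "ev_gen V F \<beta>"
  have "(ev_gen V F (star_right \<beta> (gen_tgt \<alpha>)) \<cdot> ev_gen V F (star_left (gen_src \<beta>) \<alpha>)) \<cdot> \<theta> (gen_src \<beta>) (gen_src \<alpha>)
    = ev_gen V F (star_right \<beta> (gen_tgt \<alpha>)) \<cdot> \<theta> (gen_src \<beta>) (gen_tgt \<alpha>) \<cdot> (\<one> (evo (gen_src \<beta>)) \<star> ?a)"
    by (simp add: ev_gen_star_left)
  also have "\<dots> = (\<theta> (gen_tgt \<beta>) (gen_tgt \<alpha>) \<cdot> (?b \<star> \<one> (evo (gen_tgt \<alpha>)))) \<cdot> (\<one> (evo (gen_src \<beta>)) \<star> ?a)"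
    by (intro comp_tail ev_gen_star_right) simp_all
  also have "\<dots> = (\<theta> (gen_tgt \<beta>) (gen_tgt \<alpha>) \<cdot> (\<one> (evo (gen_tgt \<beta>)) \<star> ?a)) \<cdot> (?b \<star> \<one> (evo (gen_src \<alpha>)))"
    by simp
  also have "\<dots> = ev_gen V F (star_left (gen_tgt \<beta>) \<alpha>) \<cdot> \<theta> (gen_tgt \<beta>) (gen_src \<alpha>) \<cdot> (?b \<star> \<one> (evo (gen_src \<alpha>)))"
    by (intro comp_tail[symmetric] ev_gen_star_left) simp_all
  also have "\<dots> = (ev_gen V F (star_left (gen_tgt \<beta>) \<alpha>) \<cdot> ev_gen V F (star_right \<beta> (gen_src \<alpha>))) \<cdot> \<theta> (gen_src \<beta>) (gen_src \<alpha>)"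
    by (simp add: ev_gen_star_right)
  finally show "(ev_gen V F (star_right \<beta> (gen_tgt \<alpha>)) \<cdot> ev_gen V F (star_left (gen_src \<beta>) \<alpha>)) \<cdot> \<theta> (gen_src \<beta>) (gen_src \<alpha>)
    = (ev_gen V F (star_left (gen_tgt \<beta>) \<alpha>) \<cdot> ev_gen V F (star_right \<beta> (gen_src \<alpha>))) \<cdot> \<theta> (gen_src \<beta>) (gen_src \<alpha>)" .
qed simp_all

end


section \<open>Tensor products of colimits\<close>

lemma prod_cat_simps [simp]:
  "Obj (prod_cat C D) = Obj C \<times> Obj D" "Arr (prod_cat C D) = Arr C \<times> Arr D"
  "Dom (prod_cat C D) (f, g) = (Dom C f, Dom D g)" "Cod (prod_cat C D) (f, g) = (Cod C f, Cod D g)"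
  "Ident (prod_cat C D) (a, b) = (Ident C a, Ident D b)"
  "Comp (prod_cat C D) (f', g') (f, g) = (Comp C f' f, Comp D g' g)"
  by (simp_all add: prod_cat_def)

lemma is_category_prod_cat:
  assumes "is_category C" "is_category D"
  shows "is_category (prod_cat C D)"
proof -
  interpret C: cat C using assms(1) by unfold_locales
  interpret D: cat D using assms(2) by unfold_locales
  show ?thesis by (auto simp: is_category_def[of "prod_cat C D"])
qed

lemma small_prod_cat:
  assumes "universe_type TYPE('u)" "small_category TYPE('u) C" "small_category TYPE('u) D"
  shows "small_category TYPE('u) (prod_cat C D)"
  using assms(2,3) by (simp add: small_category_def is_category_prod_cat small_Sigma[OF assms(1)])

lemma box_func_simps [simp]:
  "Fo (box_func V G H) (j, k) = tens_o V (Fo G j) (Fo H k)"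
  "Fa (box_func V G H) (f, g) = tens_a V (Fa G f) (Fa H g)"
  by (simp_all add: box_func_def)

context mon
begin

lemma is_functor_box:
  assumes "is_functor J V G" "is_functor J' V H"
  shows "is_functor (prod_cat J J') V (box_func V G H)"
proof -
  note G = functorD[OF assms(1)] and H = functorD[OF assms(2)]
  interpret J: cat J using G by unfold_locales
  interpret J': cat J' using H by unfold_locales
  show ?thesis
    unfolding is_functor_def
    using G(3-8) H(3-8) is_category_prod_cat[OF G(1) H(1)] is_category by auto
qed

text \<open>A morphism of the product category is split into one step in each variable, so
  naturality may be checked one variable at a time.\<close>

lemma box_cocone:
  assumes G: "is_functor J V G" and H: "is_functor J' V H" and e: "e \<in> Obj V"
    and h: "\<And>j k. j \<in> Obj J \<Longrightarrow> k \<in> Obj J' \<Longrightarrow> h j k \<in> Hom V (Fo G j \<otimes> Fo H k) e"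
    and left: "\<And>f k. f \<in> Arr J \<Longrightarrow> k \<in> Obj J' \<Longrightarrow> h (Cod J f) k \<cdot> (Fa G f \<star> \<one> (Fo H k)) = h (Dom J f) k"
    and right: "\<And>j g. j \<in> Obj J \<Longrightarrow> g \<in> Arr J' \<Longrightarrow> h j (Cod J' g) \<cdot> (\<one> (Fo G j) \<star> Fa H g) = h j (Dom J' g)"
  shows "is_cocone (prod_cat J J') V (box_func V G H) e (\<lambda>(j, k). h j k)"
proof -
  interpret J: cat J using functorD[OF G] by unfold_locales
  interpret J': cat J' using functorD[OF H] by unfold_locales
  note [simp] = functorD(3-6)[OF G] functorD(3-6)[OF H] h[simplified]
  have "h (Cod J f) (Cod J' g) \<cdot> (Fa G f \<star> Fa H g) = h (Dom J f) (Dom J' g)"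
    if [simp]: "f \<in> Arr J" "g \<in> Arr J'" for f g
  proof -
    have "h (Cod J f) (Cod J' g) \<cdot> (Fa G f \<star> Fa H g) =
      h (Cod J f) (Cod J' g) \<cdot> (Fa G f \<star> \<one> (Fo H (Cod J' g))) \<cdot> (\<one> (Fo G (Dom J f)) \<star> Fa H g)"
      by simp
    also have "\<dots> = h (Dom J f) (Cod J' g) \<cdot> (\<one> (Fo G (Dom J f)) \<star> Fa H g)"
      by (rule comp_tail[OF left]) simp_all
    finally show ?thesis by (simp add: right)
  qed
  then show ?thesis using is_functor_box[OF G H] e by (auto simp: is_cocone_def)
qed

context
  fixes U :: "'u itself"
  assumes cocontinuous: "tensor_cocontinuous TYPE('u) V"
begin

lemma tensor_left_colimit:
  assumes "small_category TYPE('u) J" "is_colimit J V G c \<iota>" "a \<in> Obj V"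
  shows "is_colimit J V (comp_func (tensor_left V a) G) (a \<otimes> c) (\<lambda>j. \<one> a \<star> \<iota> j)"
  using cocontinuous_small[OF _ assms(1,2), of V "tensor_left V a"] cocontinuous assms(3)
  by (simp add: tensor_cocontinuous_def tensor_left_def)

lemma tensor_right_colimit:
  assumes "small_category TYPE('u) J" "is_colimit J V G c \<iota>" "a \<in> Obj V"
  shows "is_colimit J V (comp_func (tensor_right V a) G) (c \<otimes> a) (\<lambda>j. \<iota> j \<star> \<one> a)"
  using cocontinuous_small[OF _ assms(1,2), of V "tensor_right V a"] cocontinuous assms(3)
  by (simp add: tensor_cocontinuous_def tensor_right_def)

text \<open>The colimit over the product is formed one variable at a time: a cocone is extended
  along \<open>\<kappa>\<close> for each fixed \<open>j\<close>, the extensions form a cocone in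
  \<open>j\<close>, and that cocone is extended along \<open>\<iota>\<close>. Joint epicness is
  obtained in the same two stages.\<close>

lemma tensor_colimit:
  assumes J: "small_category TYPE('u) J" and J': "small_category TYPE('u) J'"
    and c: "is_colimit J V G c \<iota>" and d: "is_colimit J' V H d \<kappa>"
  shows "is_colimit (prod_cat J J') V (box_func V G H) (c \<otimes> d) (\<lambda>(j, k). \<iota> j \<star> \<kappa> k)"
proof (rule is_colimitI)
  note cc = coconeD[OF colimit_cocone[OF c]] and cd = coconeD[OF colimit_cocone[OF d]]
  note G = functorD[OF cc(1)] and H = functorD[OF cd(1)]
  note [simp] = cc(2-6) cd(2-6) G(3-6) H(3-6)
  interpret J: cat J using G by unfold_locales
  interpret J': cat J' using H by unfold_locales
  have box: "is_functor (prod_cat J J') V (box_func V G H)"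
    using cc(1) cd(1) by (rule is_functor_box)
  then show "is_cocone (prod_cat J J') V (box_func V G H) (c \<otimes> d) (\<lambda>(j, k). \<iota> j \<star> \<kappa> k)"
    by (auto simp: is_cocone_def)
  note right = tensor_right_colimit[OF J c cd(2)]
  note left = tensor_left_colimit[OF J' d G(3)]
  {
    fix e h assume "is_cocone (prod_cat J J') V (box_func V G H) e h"
    note cone = coconeD[OF this]
    have l [simp]: "h (j, k) \<in> Arr V" "Dom V (h (j, k)) = Fo G j \<otimes> Fo H k" "Cod V (h (j, k)) = e"
      if "j \<in> Obj J" "k \<in> Obj J'" for j k
      using cone(3-5)[of "(j, k)"] that by simp_all
    have nat: "h (Cod J f, Cod J' g) \<cdot> (Fa G f \<star> Fa H g) = h (Dom J f, Dom J' g)"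
      if "f \<in> Arr J" "g \<in> Arr J'" for f g
      using cone(6)[of "(f, g)"] that by simp
    have natJ: "h (Cod J f, k) \<cdot> (Fa G f \<star> \<one> (Fo H k)) = h (Dom J f, k)"
      if "f \<in> Arr J" "k \<in> Obj J'" for f k
      using nat[OF that(1), of "Ident J' k"] that by (simp add: H(7))
    have natJ': "h (j, Cod J' g) \<cdot> (\<one> (Fo G j) \<star> Fa H g) = h (j, Dom J' g)"
      if "g \<in> Arr J'" "j \<in> Obj J" for g j
      using nat[of "Ident J j", OF _ that(1)] that by (simp add: G(7))
    have row: "is_cocone J' V (comp_func (tensor_left V (Fo G j)) H) e (\<lambda>k. h (j, k))"
      if "j \<in> Obj J" for j
      using that coconeD(1)[OF colimit_cocone[OF left[OF that]]] cone(2) natJ'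
      unfolding is_cocone_def by (simp add: comp_func_def tensor_left_def)
    define u where "u j = induced_arr J' V (Fo G j \<otimes> d) (\<lambda>k. \<one> (Fo G j) \<star> \<kappa> k) e (\<lambda>k. h (j, k))" for j
    note u [simp] = induced_arr[OF left row, folded u_def]
    \<comment> \<open>The common domain \<open>Fo G (Dom J f) \<otimes> d\<close> is itself a
      colimit by cocontinuity, so naturality in \<open>j\<close> is tested on the legs
      \<open>\<one> (Fo G (Dom J f)) \<star> \<kappa> k\<close>.\<close>
    have u_nat: "u (Cod J f) \<cdot> (Fa G f \<star> \<one> d) = u (Dom J f)" if [simp]: "f \<in> Arr J" for f
    proof (rule colimit_ext[OF left[OF J.dom_obj[OF that]]])
      fix k assume [simp]: "k \<in> Obj J'"
      have "(u (Cod J f) \<cdot> (Fa G f \<star> \<one> d)) \<cdot> (\<one> (Fo G (Dom J f)) \<star> \<kappa> k) =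
          u (Cod J f) \<cdot> (\<one> (Fo G (Cod J f)) \<star> \<kappa> k) \<cdot> (Fa G f \<star> \<one> (Fo H k))"
        by (simp del: u(4))
      also have "\<dots> = h (Cod J f, k) \<cdot> (Fa G f \<star> \<one> (Fo H k))"
        by (rule comp_tail) simp_all
      finally show "(u (Cod J f) \<cdot> (Fa G f \<star> \<one> d)) \<cdot> (\<one> (Fo G (Dom J f)) \<star> \<kappa> k) =
          u (Dom J f) \<cdot> (\<one> (Fo G (Dom J f)) \<star> \<kappa> k)"
        by (simp add: natJ)
    qed simp_all
    have col: "is_cocone J V (comp_func (tensor_right V d) G) e u"
      using coconeD(1)[OF colimit_cocone[OF right]] cone(2) u_nat
      unfolding is_cocone_def by (simp add: comp_func_def tensor_right_def)
    define w where "w = induced_arr J V (c \<otimes> d) (\<lambda>j. \<iota> j \<star> \<one> d) e u"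
    note w = induced_arr[OF right col, folded w_def]
    have "w \<cdot> (\<iota> j \<star> \<kappa> k) = h (j, k)" if [simp]: "j \<in> Obj J" "k \<in> Obj J'" for j k
    proof -
      have "w \<cdot> (\<iota> j \<star> \<kappa> k) = w \<cdot> (\<iota> j \<star> \<one> d) \<cdot> (\<one> (Fo G j) \<star> \<kappa> k)"
        by simp
      also have "\<dots> = u j \<cdot> (\<one> (Fo G j) \<star> \<kappa> k)"
        using w by (intro comp_tail) simp_all
      finally show ?thesis by simp
    qed
    then show "\<exists>u. u \<in> Hom V (c \<otimes> d) e \<and>
      (\<forall>j\<in>Obj (prod_cat J J'). u \<cdot> (case j of (j, k) \<Rightarrow> \<iota> j \<star> \<kappa> k) = h j)"
      using w by (intro exI[of _ w]) auto
  }
  fix u v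
  assume [simp]: "u \<in> Arr V" "v \<in> Arr V" "Dom V u = c \<otimes> d" "Dom V v = c \<otimes> d" and cod: "Cod V u = Cod V v"
    and eq: "\<And>j. j \<in> Obj (prod_cat J J') \<Longrightarrow>
      u \<cdot> (case j of (j, k) \<Rightarrow> \<iota> j \<star> \<kappa> k) = v \<cdot> (case j of (j, k) \<Rightarrow> \<iota> j \<star> \<kappa> k)"
  show "u = v"
  proof (rule colimit_ext[OF right])
    fix j assume [simp]: "j \<in> Obj J"
    show "u \<cdot> (\<iota> j \<star> \<one> d) = v \<cdot> (\<iota> j \<star> \<one> d)"
    proof (rule colimit_ext[OF left[of j]])
      fix k assume [simp]: "k \<in> Obj J'"
      show "(u \<cdot> (\<iota> j \<star> \<one> d)) \<cdot> (\<one> (Fo G j) \<star> \<kappa> k) = (v \<cdot> (\<iota> j \<star> \<one> d)) \<cdot> (\<one> (Fo G j) \<star> \<kappa> k)"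
        using eq[of "(j, k)"] by simp
    qed (simp_all add: cod)
  qed (simp_all add: cod)
qed

end

end


section \<open>The category of strings\<close>

context vdiagram
begin

text \<open>The unit edge enters at the left end, away from the end at which evaluation grows, so
  the tail \<open>r\<close> is built up edge by edge. The base case is the left unit law of
  \<open>Fo F i\<close>, and \<open>lunit_tens\<close> absorbs each further edge.\<close>

lemma ev_gen_lunit:
  assumes i: "i \<in> Obj I" and x: "x \<in> VOb (Fo F i)" and y: "y \<in> VOb (Fo F i)"
  shows "set r \<subseteq> edges \<Longrightarrow>
    ev_gen V F (Contract [] i x y y r) \<cdot> \<theta> [(i, y, y)] ((i, x, y) # r) \<cdot>
      (VUnit (Fo F i) y \<star> \<one> (evo ((i, x, y) # r))) = lunit V (evo ((i, x, y) # r))"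
proof (induction r rule: rev_induct)
  case Nil
  then show ?case using i x y by (simp add: whisker_right_def vcatD[OF vcat])
next
  case (snoc d r)
  note [simp] = i x y vcatD(1-4)[OF vcat]
  have [simp]: "set r \<subseteq> edges" "d \<in> edges" using snoc.prems by auto
  let ?s = "(i, x, y) # r" and ?j = "VUnit (Fo F i) y"
  define c where "c = ev_gen V F (Contract [] i x y y r)"
  let ?S = "evo ?s" and ?D = "E d"
  have [simp]: "?S \<in> Obj V" by (rule evo_obj) simp_all
  have [simp]: "evo ((i, x, y) # r @ [d]) = ?S \<otimes> ?D" using evo_snoc[of ?s d] by simp
  have "wf_gen (Contract [] i x y y r)" by (simp add: wf_gen_def)
  note c = ev_gen_arr[OF this, folded c_def]
  have [simp]: "c \<in> Arr V" "Dom V c = evo ([(i, y, y)] @ ?s)" "Cod V c = ?S"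
    using c by simp_all
  have [simp]: "\<theta> [(i, y, y)] ?s \<in> Arr V" "Dom V (\<theta> [(i, y, y)] ?s) = E (i, y, y) \<otimes> ?S"
    "Cod V (\<theta> [(i, y, y)] ?s) = evo ([(i, y, y)] @ ?s)"
    using theta_arr[of "[(i, y, y)]" ?s] by simp_all
  have "ev_gen V F (Contract [] i x y y (r @ [d])) = c \<star> \<one> ?D"
    using ev_gen_snoc[of "Contract [] i x y y r" d] by (simp add: c_def del: ev_gen.simps)
  moreover have "\<theta> [(i, y, y)] (?s @ [d]) = (\<theta> [(i, y, y)] ?s \<star> \<one> ?D) \<cdot> \<b> (E (i, y, y)) ?S ?D"
    using theta_snoc[of ?s "[(i, y, y)]" d] by simp
  ultimately have "ev_gen V F (Contract [] i x y y (r @ [d])) \<cdot> \<theta> [(i, y, y)] (?s @ [d]) \<cdot> (?j \<star> \<one> (evo (?s @ [d]))) =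
     (c \<star> \<one> ?D) \<cdot> (\<theta> [(i, y, y)] ?s \<star> \<one> ?D) \<cdot> \<b> (E (i, y, y)) ?S ?D \<cdot> (?j \<star> (\<one> ?S \<star> \<one> ?D))"
    by (simp del: ev_gen.simps)
  also have "\<dots> = (c \<star> \<one> ?D) \<cdot> (\<theta> [(i, y, y)] ?s \<star> \<one> ?D) \<cdot> (?j \<star> \<one> ?S \<star> \<one> ?D) \<cdot> \<b> \<I> ?S ?D"
    using assoc_inv_nat[of ?j "\<one> ?S" "\<one> ?D"] by simp
  also have "\<dots> = ((c \<cdot> \<theta> [(i, y, y)] ?s \<cdot> (?j \<star> \<one> ?S)) \<star> \<one> ?D) \<cdot> \<b> \<I> ?S ?D"
    by simp
  also have "\<dots> = (lunit V ?S \<star> \<one> ?D) \<cdot> \<b> \<I> ?S ?D"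
    using snoc.IH by (simp add: c_def del: ev_gen.simps)
  also have "\<dots> = (lunit V (?S \<otimes> ?D) \<cdot> \<a> \<I> ?S ?D) \<cdot> \<b> \<I> ?S ?D"
    by (simp only: lunit_tens \<open>?S \<in> Obj V\<close> E_obj \<open>d \<in> edges\<close>)
  also have "\<dots> = lunit V (evo (?s @ [d]))"
    by simp
  finally show ?case by (simp del: ev_gen.simps)
qed

lemma ev_gen_runit:
  assumes [simp]: "i \<in> Obj I" "x \<in> VOb (Fo F i)" "y \<in> VOb (Fo F i)" "set l \<subseteq> edges"
  shows "ev_gen V F (Contract l i x x y []) \<cdot> \<theta> (l @ [(i, x, y)]) [(i, x, x)] \<cdot>
      (\<one> (evo (l @ [(i, x, y)])) \<star> VUnit (Fo F i) x) = runit V (evo (l @ [(i, x, y)]))"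
proof (cases "l = []")
  case True
  then show ?thesis by (simp add: whisker_right_def vcatD[OF vcat])
next
  case False
  let ?h = "VComp (Fo F i) x x y" and ?X = "VHom (Fo F i) x y" and ?L = "evo l" and ?j = "VUnit (Fo F i) x"
  note [simp] = False vcatD[OF vcat]
  have "ev_gen V F (Contract l i x x y []) \<cdot> \<theta> (l @ [(i, x, y)]) [(i, x, x)] \<cdot> (\<one> (evo (l @ [(i, x, y)])) \<star> ?j) =
    (\<one> ?L \<star> ?h) \<cdot> \<a> ?L ?X (VHom (Fo F i) x x) \<cdot> (\<one> ?L \<star> \<one> ?X \<star> ?j)"
    by (simp add: whisker_right_def)
  also have "\<dots> = (\<one> ?L \<star> ?h) \<cdot> (\<one> ?L \<star> (\<one> ?X \<star> ?j)) \<cdot> \<a> ?L ?X \<I>"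
    using assoc_nat[of "\<one> ?L" "\<one> ?X" ?j] by simp
  also have "\<dots> = (\<one> ?L \<star> runit V ?X) \<cdot> \<a> ?L ?X \<I>"
    by simp
  finally show ?thesis by (simp add: runit_tens)
qed

end

text \<open>\<open>cl\<close> is any labelling of objects invariant under transport, not yet the one
  coming from a choice \<open>K\<close>. The locale can thus be interpreted both while a choice of
  colimits is being constructed and for a given choice.\<close>

locale string_diagram = vdiagram V I F
  for V :: "('o, 'm) monoidal" and I :: "('i, 'f) category" and F :: "('i, 'f, 'u, 'o, 'm) vdiagram" +
  fixes cl :: "'i \<Rightarrow> 'u \<Rightarrow> 'u"
  assumes cl_transport: "f \<in> Arr I \<Longrightarrow> x \<in> VOb (Fo F (Dom I f)) \<Longrightarrow>
    cl (Cod I f) (VFo (Fa F f) x) = cl (Dom I f) x"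
begin

abbreviation strs where "strs \<equiv> strings I F cl"
abbreviation gs where "gs \<equiv> gens I F cl"
abbreviation SC where "SC \<equiv> string_cat I F cl"

definition esrc :: "('i, 'u) edge \<Rightarrow> 'u" where "esrc e = cl (fst e) (fst (snd e))"
definition etgt :: "('i, 'u) edge \<Rightarrow> 'u" where "etgt e = cl (fst e) (snd (snd e))"

lemma ends_simps [simp]: "esrc (i, x, y) = cl i x" "etgt (i, x, y) = cl i y"
  by (simp_all add: esrc_def etgt_def)

lemma strings_iff:
  "s \<in> strs a b \<longleftrightarrow> str s \<and> esrc (last s) = a \<and> etgt (hd s) = b \<and> successively (\<lambda>e' e. esrc e' = etgt e) s"
  by (auto simp: strings_def esrc_def etgt_def case_prod_unfold)

lemma strings_append [simp]: "t \<in> strs b c \<Longrightarrow> s \<in> strs a b \<Longrightarrow> t @ s \<in> strs a c"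
  by (auto simp: strings_iff successively_append_iff)

lemma strings_split:
  assumes "t @ s \<in> strs a c" "t \<noteq> []" "s \<noteq> []"
  shows "t \<in> strs (etgt (hd s)) c" "s \<in> strs a (etgt (hd s))"
  using assms by (auto simp: strings_iff successively_append_iff)

lemma strings_single [simp]: "[e] \<in> strs a b \<longleftrightarrow> e \<in> edges \<and> esrc e = a \<and> etgt e = b"
  by (auto simp: strings_iff)

lemma contract_in_gens:
  assumes "l @ [(i, y, z), (i, x, y)] @ r \<in> strs a b"
  shows "Contract l i x y z r \<in> gs a b"
proof -
  have "l @ [(i, x, z)] @ r \<in> strs a b"
    using assms by (cases r) (auto simp: strings_iff successively_append_iff successively_Cons hd_append)
  with assms show ?thesis by (auto simp: gens_def strings_iff)
qed

lemma transport_in_gens: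
  assumes "f \<in> Arr I" "i = Dom I f" "x \<in> VOb (Fo F i)" "y \<in> VOb (Fo F i)" "[(i, x, y)] \<in> strs a b"
  shows "Transport [] f (i, x, y) (Cod I f, VFo (Fa F f) x, VFo (Fa F f) y) [] \<in> gs a b"
  using assms vfunD(3)[OF vfun(1)[OF assms(1)], unfolded vfun(2,3)[OF assms(1)]]
  by (auto simp: gens_def edge_arrow_def cl_transport)

lemma gens_wf: "g \<in> gs a b \<Longrightarrow> wf_gen g"
  unfolding gens_def wf_gen_def strings_iff by blast

lemma gens_star [simp]:
  "t \<in> strs b c \<Longrightarrow> g \<in> gs a b \<Longrightarrow> star_left t g \<in> gs a c"
  "g \<in> gs b c \<Longrightarrow> s \<in> strs a b \<Longrightarrow> star_right g s \<in> gs a c"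
  by (auto simp: gens_def)

lemma gens_ends [simp]: "g \<in> gs a b \<Longrightarrow> gen_src g \<in> strs a b" "g \<in> gs a b \<Longrightarrow> gen_tgt g \<in> strs a b"
  by (auto simp: gens_def)

lemma strings_str [simp]: "s \<in> strs a b \<Longrightarrow> s \<noteq> []" "s \<in> strs a b \<Longrightarrow> set s \<subseteq> edges"
  by (auto simp: strings_iff)

declare gens_wf [simp]

text \<open>The condition \<open>fp_rel\<close> is the well-definedness of string evaluation,
  settled by \<open>ev_interchange\<close>. Closure of \<open>gens\<close> under both whiskerings
  makes the two sides of an interchange parallel.\<close>

sublocale S: presentation_functor "strings I F cl a b" "gens I F cl a b" gen_src gen_tgt
  "interchange I F cl a b" V "ev_obj V F" "ev_gen V F" "ev_path V F" for a b
proof unfold_locales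
  fix r r' v w assume "(r, r') \<in> interchange I F cl a b"
  then obtain \<alpha> \<beta> c where *: "\<alpha> \<in> gs a c" "\<beta> \<in> gs c b"
      "r = [star_left (gen_src \<beta>) \<alpha>, star_right \<beta> (gen_tgt \<alpha>)]"
      "r' = [star_right \<beta> (gen_src \<alpha>), star_left (gen_tgt \<beta>) \<alpha>]"
    by (auto simp: interchange_def)
  have "star_left (gen_src \<beta>) \<alpha> \<in> gs a b" "star_right \<beta> (gen_tgt \<alpha>) \<in> gs a b"
    "star_right \<beta> (gen_src \<alpha>) \<in> gs a b" "star_left (gen_tgt \<beta>) \<alpha> \<in> gs a b"
    using *(1,2) by (blast intro: gens_star gens_ends)+
  then show "is_path (gs a b) gen_src gen_tgt v r w \<longleftrightarrow> is_path (gs a b) gen_src gen_tgt v r' w"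
    by (simp add: *(3,4) conj_ac)
next
  fix r r' v w assume "(r, r') \<in> interchange I F cl a b" "is_path (gs a b) gen_src gen_tgt v r w"
  then obtain \<alpha> \<beta> where *: "wf_gen \<alpha>" "wf_gen \<beta>"
      "r = [star_left (gen_src \<beta>) \<alpha>, star_right \<beta> (gen_tgt \<alpha>)]"
      "r' = [star_right \<beta> (gen_src \<alpha>), star_left (gen_tgt \<beta>) \<alpha>]"
    unfolding interchange_def by (blast dest: gens_wf)
  then show "ev_path V F v r = ev_path V F v r'"
    by (simp add: ev_interchange)
qed auto

lemma SC_P: "string_cat I F cl a b = S.P a b"
  by (simp add: string_cat_def)

lemma ev_G: "ev V F = S.G"
  by (simp add: ev_def S.G_def)

lemma SC_obj [simp]: "Obj (SC a b) = strs a b"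
  by (simp add: SC_P)

lemma ev_functor: "is_functor (SC a b) V (ev V F)"
  unfolding SC_P ev_G by (rule S.is_functor_G)

lemma ev_obj [simp]: "Fo (ev V F) = evo"
  by (simp add: ev_def)

lemma ev_cocone_iff:
  "is_cocone (SC a b) V (ev V F) c \<kappa> \<longleftrightarrow> c \<in> Obj V \<and> (\<forall>s\<in>strs a b. \<kappa> s \<in> Hom V (evo s) c) \<and>
     (\<forall>g\<in>gs a b. \<kappa> (gen_tgt g) \<cdot> ev_gen V F g = \<kappa> (gen_src g))"
  unfolding SC_P ev_G by (rule S.is_cocone_G)

text \<open>Edges form a small set, hence so do lists of edges, and a generator is a tuple whose
  entries range over small sets.\<close>

lemma small_SC:
  assumes U: "universe_type TYPE('u)" and I: "small_category TYPE('u) I"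
  shows "small_category TYPE('u) (SC a b)"
proof -
  have "small TYPE('u) (VOb (Fo F i))" if "i \<in> Obj I" for i
    using functorD(3)[OF diagram that] by (simp add: VCat_def)
  moreover have "edges = Sigma (Obj I) (\<lambda>i. VOb (Fo F i) \<times> VOb (Fo F i))"
    by (auto simp: F_edges_def)
  ultimately have edges: "small TYPE('u) edges"
    using I by (simp add: small_Sigma[OF U] small_category_def)
  have lists: "small TYPE('u) (lists edges)" using small_lists[OF U edges] .
  have Ob: "small TYPE('u) (\<Union>i\<in>Obj I. VOb (Fo F i))"
    using functorD(3)[OF diagram] I by (intro small_UN[OF U]) (auto simp: VCat_def small_category_def)
  have "strs a b \<subseteq> lists edges" by (fastforce dest: strings_str(2))
  then have X: "small TYPE('u) (strs a b)" by (rule small_subset[OF U lists])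
  let ?T = "(\<lambda>(l, f, e, e', r). Transport l f e e' r) ` (lists edges \<times> Arr I \<times> edges \<times> edges \<times> lists edges)"
  let ?O = "\<Union>i\<in>Obj I. VOb (Fo F i)"
  let ?C = "(\<lambda>(l, i, x, y, z, r). Contract l i x y z r) ` (lists edges \<times> Obj I \<times> ?O \<times> ?O \<times> ?O \<times> lists edges)"
  have "gs a b \<subseteq> ?T \<union> ?C"
  proof
    fix g assume "g \<in> gs a b"
    then have "wf_gen g" by (rule gens_wf)
    then have g: "gen_ok I F g" "gen_src g \<in> lists edges"
      unfolding wf_gen_def by (auto simp only: in_lists_conv_set)
    show "g \<in> ?T \<union> ?C"
    proof (cases g)
      case (Transport l f e e' r)
      then have "(l, f, e, e', r) \<in> lists edges \<times> Arr I \<times> edges \<times> edges \<times> lists edges"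
        using g by (auto simp: edge_arrow_def)
      then show ?thesis by (intro UnI1 rev_image_eqI[of "(l, f, e, e', r)"]) (simp_all only: Transport prod.case)
    next
      case (Contract l i x y z r)
      then have "(l, i, x, y, z, r) \<in> lists edges \<times> Obj I \<times> ?O \<times> ?O \<times> ?O \<times> lists edges"
        using g by auto
      then show ?thesis by (intro UnI2 rev_image_eqI[of "(l, i, x, y, z, r)"]) (simp_all only: Contract prod.case)
    qed
  qed
  moreover have "small TYPE('u) (?T \<union> ?C)"
    using edges lists Ob I
    by (intro small_Un[OF U] small_image[OF U] small_Sigma[OF U]) (simp_all add: small_category_def)
  ultimately have "small TYPE('u) (gs a b)" by (rule small_subset[OF U, rotated])
  then show ?thesis unfolding SC_P by (rule S.small_P[OF U X])
qed

lemma ev_natural: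
  assumes T: "is_functor V V T"
    and "\<And>s. s \<in> strs a b \<Longrightarrow> \<phi> s \<in> Hom V (Fo T (evo s)) d"
    and "\<And>g. g \<in> gs a b \<Longrightarrow> \<phi> (gen_tgt g) \<cdot> Fa T (ev_gen V F g) = \<phi> (gen_src g)"
    and "f \<in> Arr (SC a b)"
  shows "\<phi> (Cod (SC a b) f) \<cdot> Fa T (Fa (ev V F) f) = \<phi> (Dom (SC a b) f)"
  using S.natural_endofunctor[OF T assms(2,3)] assms(4) unfolding SC_P ev_G by blast

end


section \<open>The enriched category of strings\<close>

lemma VCat_simps [simp]:
  "C \<in> Obj (VCat V :: (('u, 'o, 'm) vcat, ('u, 'o, 'm) vfun) category) \<longleftrightarrow>
     is_vcat V C \<and> small TYPE('u) (VOb C)"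
  "T \<in> Arr (VCat V :: (('u, 'o, 'm) vcat, ('u, 'o, 'm) vfun) category) \<longleftrightarrow>
     is_vfun V T \<and> small TYPE('u) (VOb (VSrc T)) \<and> small TYPE('u) (VOb (VTgt T))"
  "Dom (VCat V) = VSrc" "Cod (VCat V) = VTgt" "Ident (VCat V) = vfun_id V" "Comp (VCat V) = vfun_comp V"
  by (simp_all add: VCat_def)

lemma Ob_func_simps [simp]:
  "Fo Ob_func = VOb" "Fa Ob_func T = (VOb (VSrc T), VFo T, VOb (VTgt T))"
  by (simp_all add: Ob_func_def)

text \<open>That \<open>VCat V\<close> is a category is a premise here. It comes with the diagram,
  since \<open>is_functor\<close> includes it for the target.\<close>

lemma is_functor_Ob_func:
  assumes "is_category (VCat V :: (('u, 'o, 'm) vcat, ('u, 'o, 'm) vfun) category)"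
  shows "is_functor (VCat V) Set_cat (Ob_func :: (('u, 'o, 'm) vcat, ('u, 'o, 'm) vfun, 'u set, 'u set_map) func)"
  unfolding is_functor_def
proof (intro conjI ballI impI)
  fix T :: "('u, 'o, 'm) vfun" assume T: "T \<in> Arr (VCat V)"
  then show "Fa Ob_func T \<in> Hom Set_cat (Fo Ob_func (Dom (VCat V) T)) (Fo Ob_func (Cod (VCat V) T))"
    using vfunD(3,9)[of V T] by (simp add: Set_cat_arr)
  fix S :: "('u, 'o, 'm) vfun" assume S: "S \<in> Arr (VCat V)" "Cod (VCat V) T = Dom (VCat V) S"
  then show "Fa Ob_func (Comp (VCat V) S T) = Comp Set_cat (Fa Ob_func S) (Fa Ob_func T)"
    using T by (simp add: vfun_comp_def fun_eq_iff)
qed (use assms is_category_Set_cat in \<open>simp_all add: vfun_id_def fun_eq_iff\<close>)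

context vdiagram
begin

lemma Ob_diagram: "is_functor I Set_cat (comp_func Ob_func F)"
  using is_functor_comp_func[OF diagram is_functor_Ob_func] functorD(2)[OF diagram] by blast

lemma Ob_cocone:
  assumes "is_cocone I Set_cat (comp_func Ob_func F) X \<iota>"
  shows "i \<in> Obj I \<Longrightarrow> x \<in> VOb (Fo F i) \<Longrightarrow> set_app (\<iota> i) x \<in> X"
    "f \<in> Arr I \<Longrightarrow> x \<in> VOb (Fo F (Dom I f)) \<Longrightarrow>
      set_app (\<iota> (Cod I f)) (VFo (Fa F f) x) = set_app (\<iota> (Dom I f)) x"
proof -
  note c = coconeD[OF assms]
  show "set_app (\<iota> i) x \<in> X" if "i \<in> Obj I" "x \<in> VOb (Fo F i)"
    using c(3-5)[OF that(1)] that(2) by (auto simp: Set_cat_arr comp_func_def)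
  show "set_app (\<iota> (Cod I f)) (VFo (Fa F f) x) = set_app (\<iota> (Dom I f)) x"
    if "f \<in> Arr I" "x \<in> VOb (Fo F (Dom I f))"
    using arg_cong[OF c(6)[OF that(1)], of "\<lambda>m. set_app m x"] that(2)
    by (simp add: comp_func_def vfun(2,3)[OF that(1)])
qed

text \<open>The colimit of object sets has to be chosen before the others, because its classes
  determine which strings exist.\<close>

lemma ex_colim_choice:
  assumes U: "universe_type TYPE('u)" and V: "cocomplete TYPE('u) V" and I: "small_category TYPE('u) I"
  shows "\<exists>K. is_colim_choice V I F K"
proof -
  obtain X \<iota> where X: "is_colimit I Set_cat (comp_func Ob_func F) X \<iota>"
    by (rule set_colimit_quotient[OF U I Ob_diagram])
  define cl where "cl = (\<lambda>i. set_app (\<iota> i))"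
  interpret string_diagram V I F cl
    using Ob_cocone(2)[OF colimit_cocone[OF X]] by unfold_locales (simp add: cl_def)
  define H where "H a b = (SOME p. is_colimit (SC a b) V (ev V F) (fst p) (snd p))" for a b
  have "is_colimit (SC a b) V (ev V F) (fst (H a b)) (snd (H a b))" for a b
    unfolding H_def
    by (rule someI_ex) (simp add: cocomplete_small[OF V small_SC[OF U I] ev_functor])
  note H = this
  define B where "B a b c = (SOME p. is_colimit (prod_cat (SC b c) (SC a b)) V
      (box_func V (ev V F) (ev V F)) (fst p) (snd p))" for a b c
  have "is_colimit (prod_cat (SC b c) (SC a b)) V (box_func V (ev V F) (ev V F))
      (fst (B a b c)) (snd (B a b c))" for a b c
    unfolding B_def
    by (rule someI_ex) (simp add: cocomplete_small[OF V small_prod_cat[OF U small_SC[OF U I] small_SC[OF U I]]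
          is_functor_box[OF ev_functor ev_functor]])
  note B = this
  let ?K = "\<lparr>Ob_colim = X, Ob_inj = \<iota>, 
    Hom_colim = (\<lambda>a b. fst (H a b)), Hom_inj = (\<lambda>a b. snd (H a b)),
    Box_colim = (\<lambda>a b c. fst (B a b c)), Box_inj = (\<lambda>a b c. snd (B a b c))\<rparr>"
  \<comment> \<open>The string categories behind \<open>H\<close> and \<open>B\<close> were built
    from \<open>cl\<close>; this equation makes them those of the assembled record.\<close>
  have "obj_class ?K = cl"
    by (simp add: cl_def fun_eq_iff obj_class_def)
  then have "is_colim_choice V I F ?K"
    using X H B by (simp add: is_colim_choice_def)
  then show ?thesis by blast
qed

end

locale string_colimit = vdiagram V I F
  for V :: "('o, 'm) monoidal" and I :: "('i, 'f) category" and F :: "('i, 'f, 'u, 'o, 'm) vdiagram" +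
  fixes K :: "('i, 'u, 'o, 'm) colim_choice"
  assumes universe: "universe_type TYPE('u)"
    and cocontinuous: "tensor_cocontinuous TYPE('u) V"
    and small_I: "small_category TYPE('u) I"
    and choice: "is_colim_choice V I F K"
begin

abbreviation X where "X \<equiv> Ob_colim K"
abbreviation cls where "cls \<equiv> obj_class K"
abbreviation H where "H \<equiv> Hom_colim K"
abbreviation \<iota> where "\<iota> \<equiv> Hom_inj K"

lemma Ob_colimit: "is_colimit I Set_cat (comp_func Ob_func F) X (Ob_inj K)"
  using choice by (simp add: is_colim_choice_def)

lemmas Ob_cocone_K = Ob_cocone[OF colimit_cocone[OF Ob_colimit], folded obj_class_def]

sublocale string_diagram V I F cls
  using Ob_cocone_K(2) by unfold_locales

lemma cls_in [simp]: "i \<in> Obj I \<Longrightarrow> x \<in> VOb (Fo F i) \<Longrightarrow> cls i x \<in> X"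
  by (rule Ob_cocone_K(1))

lemma cls_surj:
  assumes "a \<in> X"
  obtains i x where "i \<in> Obj I" "x \<in> VOb (Fo F i)" "cls i x = a"
  using set_colimit_surj[OF universe small_I Ob_colimit assms]
  by (auto simp: obj_class_def comp_func_def)

lemma small_X: "small TYPE('u) X"
  using coconeD(2)[OF colimit_cocone[OF Ob_colimit]] by simp

text \<open>The zigzag description of equality in the colimit is used instead of the universal
  property, so \<open>t\<close> may take values of any type: arrows of \<open>V\<close> for the
  units, objects of a target for the mediating functor.\<close>

lemma cls_invariant:
  assumes "i \<in> Obj I" "x \<in> VOb (Fo F i)" "j \<in> Obj I" "y \<in> VOb (Fo F j)" "cls i x = cls j y"
    and "\<And>f x. f \<in> Arr I \<Longrightarrow> x \<in> VOb (Fo F (Dom I f)) \<Longrightarrow> t (Cod I f) (VFo (Fa F f) x) = t (Dom I f) x"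
  shows "t i x = t j y"
proof -
  have "equivclp (colim_gen I (comp_func Ob_func F)) (i, x) (j, y)"
    using set_colimit_eq[OF universe small_I Ob_colimit, of i j x y] assms(1-5)
    by (simp add: obj_class_def comp_func_def)
  from colim_gen_invariant[OF this, of t] show ?thesis
    using assms(6) by (simp add: comp_func_def)
qed

lemma etgt_in [simp]: "e \<in> edges \<Longrightarrow> etgt e \<in> X" and esrc_in [simp]: "e \<in> edges \<Longrightarrow> esrc e \<in> X"
  by (cases e; simp)+

lemma Hom_colimit:
  "a \<in> X \<Longrightarrow> b \<in> X \<Longrightarrow> is_colimit (SC a b) V (ev V F) (H a b) (\<iota> a b)"
  using choice by (simp add: is_colim_choice_def)

lemma Box_colimit:
  "a \<in> X \<Longrightarrow> b \<in> X \<Longrightarrow> c \<in> X \<Longrightarrow> is_colimit (prod_cat (SC b c) (SC a b)) V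
     (box_func V (ev V F) (ev V F)) (Box_colim K a b c) (Box_inj K a b c)"
  using choice by (simp add: is_colim_choice_def)

lemma H_obj [simp]: "a \<in> X \<Longrightarrow> b \<in> X \<Longrightarrow> H a b \<in> Obj V"
  using coconeD(2)[OF colimit_cocone[OF Hom_colimit]] .

lemma \<iota>_arr [simp]:
  assumes "a \<in> X" "b \<in> X" "s \<in> strs a b"
  shows "\<iota> a b s \<in> Arr V" "Dom V (\<iota> a b s) = evo s" "Cod V (\<iota> a b s) = H a b"
  using coconeD(3-5)[OF colimit_cocone[OF Hom_colimit[OF assms(1,2)]]] assms(3) by simp_all

lemma \<iota>_gen: "a \<in> X \<Longrightarrow> b \<in> X \<Longrightarrow> g \<in> gs a b \<Longrightarrow> \<iota> a b (gen_tgt g) \<cdot> ev_gen V F g = \<iota> a b (gen_src g)"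
  using colimit_cocone[OF Hom_colimit, of a b] by (simp add: ev_cocone_iff)

lemma Hom_ext:
  assumes "a \<in> X" "b \<in> X" "u \<in> Arr V" "v \<in> Arr V" "Dom V u = H a b" "Dom V v = H a b" "Cod V u = Cod V v"
    and "\<And>s. s \<in> strs a b \<Longrightarrow> u \<cdot> \<iota> a b s = v \<cdot> \<iota> a b s"
  shows "u = v"
  using colimit_ext[OF Hom_colimit[OF assms(1,2)] assms(3-7)] assms(8) by simp

lemma tensor2_colimit:
  assumes "a \<in> X" "b \<in> X" "c \<in> X"
  shows "is_colimit (prod_cat (SC b c) (SC a b)) V (box_func V (ev V F) (ev V F)) (H b c \<otimes> H a b)
    (\<lambda>(t, s). \<iota> b c t \<star> \<iota> a b s)"
  by (rule tensor_colimit[OF cocontinuous small_SC[OF universe small_I] small_SC[OF universe small_I]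
        Hom_colimit[OF assms(2,3)] Hom_colimit[OF assms(1,2)]])

text \<open>Two applications of \<open>tensor_colimit\<close> make the triple tensor products of
  legs jointly epic; associativity of composition is tested on them.\<close>

lemma tensor3_ext:
  assumes "a \<in> X" "b \<in> X" "c \<in> X" "d \<in> X" "u \<in> Arr V" "v \<in> Arr V"
    "Dom V u = H c d \<otimes> H b c \<otimes> H a b" "Dom V v = H c d \<otimes> H b c \<otimes> H a b" "Cod V u = Cod V v"
    and "\<And>p t s. p \<in> strs c d \<Longrightarrow> t \<in> strs b c \<Longrightarrow> s \<in> strs a b \<Longrightarrow>
      u \<cdot> (\<iota> c d p \<star> \<iota> b c t \<star> \<iota> a b s) = v \<cdot> (\<iota> c d p \<star> \<iota> b c t \<star> \<iota> a b s)"
  shows "u = v"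
proof -
  note small = small_SC[OF universe small_I]
  show ?thesis
    by (rule colimit_ext[OF tensor_colimit[OF cocontinuous small_prod_cat[OF universe small small] small
            tensor2_colimit[OF assms(2-4)] Hom_colimit[OF assms(1,2)]] assms(5-9)])
       (use assms(10) in auto)
qed

section \<open>Composition induced by concatenation\<close>

definition cmp :: "'u \<Rightarrow> 'u \<Rightarrow> 'u \<Rightarrow> 'm" where
  "cmp a b c = colim_star_theta V I F K a b c \<cdot> mu V I F K a b c"

text \<open>In each variable \<open>ev_natural\<close> reduces naturality to a generator
  \<open>g\<close>. Whiskering \<open>g\<close> by the other string gives a generator between
  concatenated strings, so the cocone condition on \<open>\<iota> a c\<close> applies once
  \<open>\<theta>\<close> has been moved across \<open>ev_gen\<close>.\<close>

lemma star_theta_cocone: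
  assumes [simp]: "a \<in> X" "b \<in> X" "c \<in> X"
  shows "is_cocone (prod_cat (SC b c) (SC a b)) V (box_func V (ev V F) (ev V F)) (H a c)
    (\<lambda>(t, s). \<iota> a c (t @ s) \<cdot> \<theta> t s)"
proof (rule box_cocone[OF ev_functor ev_functor])
  show "\<iota> a c (t @ s) \<cdot> \<theta> t s \<in> Hom V (Fo (ev V F) t \<otimes> Fo (ev V F) s) (H a c)"
    if "t \<in> Obj (SC b c)" "s \<in> Obj (SC a b)" for t s
  proof -
    have [simp]: "t \<in> strs b c" "s \<in> strs a b" "t @ s \<in> strs a c" using that strings_append by auto
    note [simp] = strings_str[OF \<open>t \<in> strs b c\<close>] strings_str[OF \<open>s \<in> strs a b\<close>]
    show ?thesis by simp
  qed
  note hom = this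
  show "(\<iota> a c (Cod (SC b c) f @ s) \<cdot> \<theta> (Cod (SC b c) f) s) \<cdot> (Fa (ev V F) f \<star> \<one> (Fo (ev V F) s)) =
      \<iota> a c (Dom (SC b c) f @ s) \<cdot> \<theta> (Dom (SC b c) f) s"
    if f: "f \<in> Arr (SC b c)" and s: "s \<in> Obj (SC a b)" for f s
  proof -
    have [simp]: "s \<in> strs a b" using s by simp
    note [simp] = strings_str[OF this]
    have T: "is_functor V V (tensor_right V (evo s))"
      using cocontinuous by (simp add: tensor_cocontinuous_def cocontinuous_def)
    have "(\<iota> a c (gen_tgt g @ s) \<cdot> \<theta> (gen_tgt g) s) \<cdot> (ev_gen V F g \<star> \<one> (evo s)) =
        \<iota> a c (gen_src g @ s) \<cdot> \<theta> (gen_src g) s" if g: "g \<in> gs b c" for g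
    proof -
      have gr: "star_right g s \<in> gs a c" and wf [simp]: "wf_gen g"
        using g \<open>s \<in> strs a b\<close> gens_wf by (blast intro: gens_star)+
      have [simp]: "gen_tgt g @ s \<in> strs a c" using gens_ends(2)[OF gr] by simp
      have "(\<iota> a c (gen_tgt g @ s) \<cdot> \<theta> (gen_tgt g) s) \<cdot> (ev_gen V F g \<star> \<one> (evo s)) =
         \<iota> a c (gen_tgt g @ s) \<cdot> ev_gen V F (star_right g s) \<cdot> \<theta> (gen_src g) s"
        by (simp add: ev_gen_star_right)
      also have "\<dots> = \<iota> a c (gen_src g @ s) \<cdot> \<theta> (gen_src g) s"
        using \<iota>_gen[OF _ _ gr] by (intro comp_tail) simp_all
      finally show ?thesis .
    qed
    then show ?thesis
      using ev_natural[OF T _ _ f, of "\<lambda>t. \<iota> a c (t @ s) \<cdot> \<theta> t s" "H a c"] hom[OF _ s]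
      by (simp add: tensor_right_def)
  qed
  show "(\<iota> a c (t @ Cod (SC a b) f) \<cdot> \<theta> t (Cod (SC a b) f)) \<cdot> (\<one> (Fo (ev V F) t) \<star> Fa (ev V F) f) =
      \<iota> a c (t @ Dom (SC a b) f) \<cdot> \<theta> t (Dom (SC a b) f)"
    if t: "t \<in> Obj (SC b c)" and f: "f \<in> Arr (SC a b)" for f t
  proof -
    have [simp]: "t \<in> strs b c" using t by simp
    note [simp] = strings_str[OF this]
    have T: "is_functor V V (tensor_left V (evo t))"
      using cocontinuous by (simp add: tensor_cocontinuous_def cocontinuous_def)
    have "(\<iota> a c (t @ gen_tgt g) \<cdot> \<theta> t (gen_tgt g)) \<cdot> (\<one> (evo t) \<star> ev_gen V F g) =
        \<iota> a c (t @ gen_src g) \<cdot> \<theta> t (gen_src g)" if g: "g \<in> gs a b" for g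
    proof -
      have gr: "star_left t g \<in> gs a c" and wf [simp]: "wf_gen g"
        using g \<open>t \<in> strs b c\<close> gens_wf by (blast intro: gens_star)+
      have [simp]: "t @ gen_tgt g \<in> strs a c" using gens_ends(2)[OF gr] by simp
      have "(\<iota> a c (t @ gen_tgt g) \<cdot> \<theta> t (gen_tgt g)) \<cdot> (\<one> (evo t) \<star> ev_gen V F g) =
         \<iota> a c (t @ gen_tgt g) \<cdot> ev_gen V F (star_left t g) \<cdot> \<theta> t (gen_src g)"
        by (simp add: ev_gen_star_left)
      also have "\<dots> = \<iota> a c (t @ gen_src g) \<cdot> \<theta> t (gen_src g)"
        using \<iota>_gen[OF _ _ gr] by (intro comp_tail) simp_all
      finally show ?thesis .
    qed
    then show ?thesis
      using ev_natural[OF T _ _ f, of "\<lambda>s. \<iota> a c (t @ s) \<cdot> \<theta> t s" "H a c"] hom[OF t]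
      by (simp add: tensor_left_def)
  qed
qed simp

lemma
  assumes [simp]: "a \<in> X" "b \<in> X" "c \<in> X"
  shows cmp_arr [simp]: "cmp a b c \<in> Arr V" "Dom V (cmp a b c) = H b c \<otimes> H a b" "Cod V (cmp a b c) = H a c"
    and cmp_\<iota>: "t \<in> strs b c \<Longrightarrow> s \<in> strs a b \<Longrightarrow>
      cmp a b c \<cdot> (\<iota> b c t \<star> \<iota> a b s) = \<iota> a c (t @ s) \<cdot> \<theta> t s"
proof -
  note box = Box_colimit[OF assms] and ten = tensor2_colimit[OF assms]
  note inv = colimit_induced_inverse[OF box ten]
  \<comment> \<open>\<open>mu\<close> is defined as an inverse. Uniqueness of inverses turns it into
    the arrow induced by \<open>Box_inj\<close> out of the tensor product, whose values on the legs
    are known.\<close>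
  have mu: "mu V I F K a b c = induced_arr (prod_cat (SC b c) (SC a b)) V (H b c \<otimes> H a b)
      (\<lambda>(t, s). \<iota> b c t \<star> \<iota> a b s) (Box_colim K a b c) (Box_inj K a b c)"
    unfolding mu_def by (rule inv_arr_eq[OF inv])
  note m = induced_arr[OF ten colimit_cocone[OF box], folded mu]
  note st = induced_arr[OF box star_theta_cocone[OF assms], folded colim_star_theta_def]
  show "cmp a b c \<in> Arr V" "Dom V (cmp a b c) = H b c \<otimes> H a b" "Cod V (cmp a b c) = H a c"
    using m st by (simp_all add: cmp_def)
  assume ts: "t \<in> strs b c" "s \<in> strs a b"
  have "cmp a b c \<cdot> (\<iota> b c t \<star> \<iota> a b s) =
      colim_star_theta V I F K a b c \<cdot> mu V I F K a b c \<cdot> (\<iota> b c t \<star> \<iota> a b s)"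
    using m(1-3) st(1-3) ts by (simp add: cmp_def)
  also have "\<dots> = colim_star_theta V I F K a b c \<cdot> Box_inj K a b c (t, s)"
    using m(4)[of "(t, s)"] ts by simp
  also have "\<dots> = \<iota> a c (t @ s) \<cdot> \<theta> t s"
    using st(4)[of "(t, s)"] ts by simp
  finally show "cmp a b c \<cdot> (\<iota> b c t \<star> \<iota> a b s) = \<iota> a c (t @ s) \<cdot> \<theta> t s" .
qed

abbreviation SV where "SV \<equiv> string_vcat V I F K"

lemma SV_simps [simp]:
  "VOb SV = X" "a \<in> X \<Longrightarrow> b \<in> X \<Longrightarrow> VHom SV a b = H a b"
  "a \<in> X \<Longrightarrow> b \<in> X \<Longrightarrow> c \<in> X \<Longrightarrow> VComp SV a b c = cmp a b c"
  by (simp_all add: string_vcat_def cmp_def Let_def)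

text \<open>It suffices to compare along one arrow \<open>f\<close> of \<open>I\<close>. There the
  enriched functor \<open>Fa F f\<close> preserves units, and the transport of
  \<open>[(i, x, x)]\<close> along \<open>f\<close> relates the two legs.\<close>

lemma string_unit_eq:
  assumes "i \<in> Obj I" "x \<in> VOb (Fo F i)" "j \<in> Obj I" "y \<in> VOb (Fo F j)" "cls i x = cls j y"
  shows "string_unit V F K i x = string_unit V F K j y"
proof (rule cls_invariant[OF assms])
  fix f x assume f: "f \<in> Arr I" and x: "x \<in> VOb (Fo F (Dom I f))"
  let ?i = "Dom I f" and ?i' = "Cod I f" and ?x' = "VFo (Fa F f) x" and ?a = "cls (Dom I f) x"
  let ?g = "Transport [] f (?i, x, x) (?i', ?x', ?x') []"
  have a: "?a \<in> X" using f x by simp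
  have x': "?x' \<in> VOb (Fo F ?i')"
    using vfunD(3)[OF vfun(1)[OF f], unfolded vfun(2,3)[OF f], OF x] .
  have g: "?g \<in> gs ?a ?a"
    using f x by (intro transport_in_gens) simp_all
  have "VFh (Fa F f) x x \<cdot> VUnit (Fo F ?i) x = VUnit (Fo F ?i') ?x'"
    using vfunD(7)[OF vfun(1)[OF f], unfolded vfun(2,3)[OF f], OF x] .
  then have "\<iota> ?a ?a [(?i', ?x', ?x')] \<cdot> VUnit (Fo F ?i') ?x' =
      \<iota> ?a ?a [(?i', ?x', ?x')] \<cdot> VFh (Fa F f) x x \<cdot> VUnit (Fo F ?i) x"
    by simp
  also have "\<dots> = \<iota> ?a ?a [(?i, x, x)] \<cdot> VUnit (Fo F ?i) x"
    using \<iota>_gen[OF a a g] f x x' a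
    by (intro comp_tail) (simp_all add: whisker_right_def VFh_arr vcatD[OF vcat] cl_transport)
  finally show "string_unit V F K ?i' ?x' = string_unit V F K ?i x"
    using f x by (simp add: string_unit_def Let_def cl_transport)
qed

lemma VUnit_SV:
  assumes "i \<in> Obj I" "x \<in> VOb (Fo F i)"
  shows "VUnit SV (cls i x) = string_unit V F K i x"
proof -
  have "(THE u. \<exists>j\<in>Obj I. \<exists>y\<in>VOb (Fo F j). cls j y = cls i x \<and> u = string_unit V F K j y) =
      string_unit V F K i x"
    using assms string_unit_eq by (intro the_equality) blast+
  then show ?thesis using assms by (simp add: string_vcat_def Let_def)
qed

lemma string_unit_arr [simp]:
  assumes "i \<in> Obj I" "x \<in> VOb (Fo F i)"
  shows "string_unit V F K i x \<in> Arr V" "Dom V (string_unit V F K i x) = \<I>"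
    "Cod V (string_unit V F K i x) = H (cls i x) (cls i x)"
  using assms by (simp_all add: string_unit_def Let_def vcatD[OF vcat])

text \<open>Concatenation of lists is strictly associative, so on the legs both sides end in the
  same component \<open>\<iota> a d (p @ t @ s)\<close>; what remains is
  \<open>theta_assoc\<close>.\<close>

lemma cmp_assoc:
  assumes [simp]: "a \<in> X" "b \<in> X" "c \<in> X" "d \<in> X"
  shows "cmp a b d \<cdot> (cmp b c d \<star> \<one> (H a b)) =
    cmp a c d \<cdot> (\<one> (H c d) \<star> cmp a b c) \<cdot> \<a> (H c d) (H b c) (H a b)"
proof (rule tensor3_ext[OF assms])
  fix p t s assume [simp]: "p \<in> strs c d" "t \<in> strs b c" "s \<in> strs a b"
  note [simp] = strings_str[OF \<open>p \<in> strs c d\<close>] strings_str[OF \<open>t \<in> strs b c\<close>] strings_str[OF \<open>s \<in> strs a b\<close>]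
  have [simp]: "p @ t \<in> strs b d" "t @ s \<in> strs a c" "p @ t @ s \<in> strs a d"
    using strings_append[of p c d t b] strings_append[of t b c s a] strings_append[of p c d "t @ s" a] by auto
  have "(cmp a b d \<cdot> (cmp b c d \<star> \<one> (H a b))) \<cdot> (\<iota> c d p \<star> \<iota> b c t \<star> \<iota> a b s) =
      cmp a b d \<cdot> ((cmp b c d \<cdot> (\<iota> c d p \<star> \<iota> b c t)) \<star> \<iota> a b s)"
    by simp
  also have "\<dots> = cmp a b d \<cdot> (\<iota> b d (p @ t) \<star> \<iota> a b s) \<cdot> (\<theta> p t \<star> \<one> (evo s))"
    by (simp add: cmp_\<iota>)
  also have "\<dots> = (\<iota> a d ((p @ t) @ s) \<cdot> \<theta> (p @ t) s) \<cdot> (\<theta> p t \<star> \<one> (evo s))"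
    by (rule comp_tail[OF cmp_\<iota>]) simp_all
  also have "\<dots> = \<iota> a d (p @ t @ s) \<cdot> \<theta> (p @ t) s \<cdot> (\<theta> p t \<star> \<one> (evo s))"
    by simp
  also have "\<dots> = \<iota> a d (p @ t @ s) \<cdot> \<theta> p (t @ s) \<cdot> (\<one> (evo p) \<star> \<theta> t s) \<cdot> \<a> (evo p) (evo t) (evo s)"
    by (subst theta_assoc) simp_all
  also have "\<dots> = (\<iota> a d (p @ t @ s) \<cdot> \<theta> p (t @ s)) \<cdot> (\<one> (evo p) \<star> \<theta> t s) \<cdot> \<a> (evo p) (evo t) (evo s)"
    by simp
  also have "\<dots> = cmp a c d \<cdot> (\<iota> c d p \<star> \<iota> a c (t @ s)) \<cdot> (\<one> (evo p) \<star> \<theta> t s) \<cdot> \<a> (evo p) (evo t) (evo s)"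
    by (rule comp_tail[symmetric, OF cmp_\<iota>]) simp_all
  also have "\<dots> = cmp a c d \<cdot> (\<iota> c d p \<star> (cmp a b c \<cdot> (\<iota> b c t \<star> \<iota> a b s))) \<cdot> \<a> (evo p) (evo t) (evo s)"
    by (simp add: cmp_\<iota>)
  also have "\<dots> = cmp a c d \<cdot> (\<one> (H c d) \<star> cmp a b c) \<cdot>
      (\<iota> c d p \<star> (\<iota> b c t \<star> \<iota> a b s)) \<cdot> \<a> (evo p) (evo t) (evo s)"
    by simp
  also have "\<dots> = (cmp a c d \<cdot> (\<one> (H c d) \<star> cmp a b c) \<cdot> \<a> (H c d) (H b c) (H a b)) \<cdot>
      (\<iota> c d p \<star> \<iota> b c t \<star> \<iota> a b s)"
    using assoc_nat[of "\<iota> c d p" "\<iota> b c t" "\<iota> a b s"] by simp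
  finally show "(cmp a b d \<cdot> (cmp b c d \<star> \<one> (H a b))) \<cdot> (\<iota> c d p \<star> \<iota> b c t \<star> \<iota> a b s) =
      (cmp a c d \<cdot> (\<one> (H c d) \<star> cmp a b c) \<cdot> \<a> (H c d) (H b c) (H a b)) \<cdot>
      (\<iota> c d p \<star> \<iota> b c t \<star> \<iota> a b s)" .
qed simp_all

lemma cmp_lunit:
  assumes [simp]: "a \<in> X" "b \<in> X"
  shows "cmp a b b \<cdot> (VUnit SV b \<star> \<one> (H a b)) = lunit V (H a b)"
proof -
  \<comment> \<open>This representative gives the domain and codomain of the unit at
    \<open>b\<close>; a different one, adapted to each string, is used for the computation.\<close>
  obtain i' x' where i': "i' \<in> Obj I" "x' \<in> VOb (Fo F i')" "cls i' x' = b" by (rule cls_surj[OF assms(2)])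
  have unit [simp]: "VUnit SV b \<in> Arr V" "Dom V (VUnit SV b) = \<I>" "Cod V (VUnit SV b) = H b b"
    using VUnit_SV[OF i'(1,2)] string_unit_arr[OF i'(1,2)] i'(3) by simp_all
  show ?thesis
  proof (rule colimit_ext[OF tensor_left_colimit[OF cocontinuous small_SC[OF universe small_I]
          Hom_colimit[OF assms] munit_obj]])
    fix s assume "s \<in> Obj (SC a b)"
    then have s [simp]: "s \<in> strs a b" by simp
    note [simp] = strings_str[OF s]
    obtain i x y r where sr: "s = (i, x, y) # r"
      using strings_str(1)[OF s] by (metis neq_Nil_conv prod_cases3)
    have i [simp]: "i \<in> Obj I" "x \<in> VOb (Fo F i)" "y \<in> VOb (Fo F i)" "set r \<subseteq> edges"
      using strings_str(2)[OF s] by (simp_all add: sr)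
    have y [simp]: "cls i y = b" using s by (simp add: sr strings_iff del: s)
    define g :: "('i, 'f, 'u) gen" where "g = Contract [] i x y y r"
    let ?e = "[(i, y, y)]" and ?j = "VUnit (Fo F i) y"
    have e [simp]: "?e \<in> strs b b" by simp
    have es: "?e @ s \<in> strs a b" using e s by (rule strings_append)
    then have g: "g \<in> gs a b" unfolding g_def by (intro contract_in_gens) (simp add: sr)
    have [simp]: "gen_src g = ?e @ s" "gen_tgt g = s" by (simp_all add: g_def sr)
    have [simp]: "wf_gen g" using g by (rule gens_wf)
    have j [simp]: "?j \<in> Arr V" "Dom V ?j = \<I>" "Cod V ?j = evo ?e"
      using vcatD(2-4)[OF vcat] by simp_all
    have th [simp]: "\<theta> ?e s \<in> Arr V" "Dom V (\<theta> ?e s) = evo ?e \<otimes> evo s" "Cod V (\<theta> ?e s) = evo (?e @ s)"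
      using theta_arr[of ?e s] by simp_all
    \<comment> \<open>The unit does not depend on the representative of \<open>b\<close>, so the
      target \<open>y\<close> of the leftmost edge of \<open>s\<close> may serve. With it the unit
      edge can be contracted into that edge.\<close>
    have u: "VUnit SV b = \<iota> b b ?e \<cdot> ?j"
      using VUnit_SV[of i y] by (simp add: string_unit_def Let_def)
    have "(cmp a b b \<cdot> (VUnit SV b \<star> \<one> (H a b))) \<cdot> (\<one> \<I> \<star> \<iota> a b s) =
        cmp a b b \<cdot> (\<iota> b b ?e \<star> \<iota> a b s) \<cdot> (?j \<star> \<one> (evo s))"
      using \<iota>_arr[OF assms(2,2) e] unfolding u by (simp del: evo_single)
    also have "\<dots> = (\<iota> a b (?e @ s) \<cdot> \<theta> ?e s) \<cdot> (?j \<star> \<one> (evo s))"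
      using \<iota>_arr[OF assms(2,2) e] by (intro comp_tail[OF cmp_\<iota>]) (simp_all del: evo_single)
    also have "\<dots> = (\<iota> a b s \<cdot> ev_gen V F g) \<cdot> \<theta> ?e s \<cdot> (?j \<star> \<one> (evo s))"
      using \<iota>_gen[OF assms g] es th j \<iota>_arr[OF assms es] by (simp del: evo_single append.simps)
    also have "\<dots> = \<iota> a b s \<cdot> ev_gen V F g \<cdot> \<theta> ?e s \<cdot> (?j \<star> \<one> (evo s))"
      using th j by (simp del: evo_single append.simps)
    also have "\<dots> = \<iota> a b s \<cdot> lunit V (evo s)"
      using ev_gen_lunit[OF i] unfolding g_def sr by simp
    also have "\<dots> = lunit V (H a b) \<cdot> (\<one> \<I> \<star> \<iota> a b s)"
      using lunit_nat[of "\<iota> a b s"] by simp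
    finally show "(cmp a b b \<cdot> (VUnit SV b \<star> \<one> (H a b))) \<cdot> (\<one> \<I> \<star> \<iota> a b s) =
      lunit V (H a b) \<cdot> (\<one> \<I> \<star> \<iota> a b s)" .
  qed simp_all
qed

lemma cmp_runit:
  assumes [simp]: "a \<in> X" "b \<in> X"
  shows "cmp a a b \<cdot> (\<one> (H a b) \<star> VUnit SV a) = runit V (H a b)"
proof -
  obtain i' x' where i': "i' \<in> Obj I" "x' \<in> VOb (Fo F i')" "cls i' x' = a" by (rule cls_surj[OF assms(1)])
  have unit [simp]: "VUnit SV a \<in> Arr V" "Dom V (VUnit SV a) = \<I>" "Cod V (VUnit SV a) = H a a"
    using VUnit_SV[OF i'(1,2)] string_unit_arr[OF i'(1,2)] i'(3) by simp_all
  show ?thesis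
  proof (rule colimit_ext[OF tensor_right_colimit[OF cocontinuous small_SC[OF universe small_I]
          Hom_colimit[OF assms] munit_obj]])
    fix s assume "s \<in> Obj (SC a b)"
    then have s [simp]: "s \<in> strs a b" by simp
    note [simp] = strings_str[OF s]
    obtain l i x y where sl: "s = l @ [(i, x, y)]"
      using strings_str(1)[OF s] by (metis rev_exhaust prod_cases3)
    have i [simp]: "i \<in> Obj I" "x \<in> VOb (Fo F i)" "y \<in> VOb (Fo F i)" "set l \<subseteq> edges"
      using strings_str(2)[OF s] by (simp_all add: sl)
    have x [simp]: "cls i x = a" using s by (simp add: sl strings_iff del: s)
    define g :: "('i, 'f, 'u) gen" where "g = Contract l i x x y []"
    let ?e = "[(i, x, x)]" and ?j = "VUnit (Fo F i) x"
    have e [simp]: "?e \<in> strs a a" by simp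
    have se: "s @ ?e \<in> strs a b" using s e by (rule strings_append)
    then have g: "g \<in> gs a b" unfolding g_def by (intro contract_in_gens) (simp add: sl)
    have [simp]: "gen_src g = s @ ?e" "gen_tgt g = s" by (simp_all add: g_def sl)
    have [simp]: "wf_gen g" using g by (rule gens_wf)
    have j [simp]: "?j \<in> Arr V" "Dom V ?j = \<I>" "Cod V ?j = evo ?e"
      using vcatD(2-4)[OF vcat] by simp_all
    have th [simp]: "\<theta> s ?e \<in> Arr V" "Dom V (\<theta> s ?e) = evo s \<otimes> evo ?e" "Cod V (\<theta> s ?e) = evo (s @ ?e)"
      using theta_arr[of s ?e] by simp_all
    \<comment> \<open>Mirror choice: the source \<open>x\<close> of the rightmost edge of
      \<open>s\<close> represents \<open>a\<close>.\<close>
    have u: "VUnit SV a = \<iota> a a ?e \<cdot> ?j"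
      using VUnit_SV[of i x] by (simp add: string_unit_def Let_def)
    have "(cmp a a b \<cdot> (\<one> (H a b) \<star> VUnit SV a)) \<cdot> (\<iota> a b s \<star> \<one> \<I>) =
        cmp a a b \<cdot> (\<iota> a b s \<star> \<iota> a a ?e) \<cdot> (\<one> (evo s) \<star> ?j)"
      using \<iota>_arr[OF assms(1,1) e] unfolding u by (simp del: evo_single)
    also have "\<dots> = (\<iota> a b (s @ ?e) \<cdot> \<theta> s ?e) \<cdot> (\<one> (evo s) \<star> ?j)"
      using \<iota>_arr[OF assms(1,1) e] by (intro comp_tail[OF cmp_\<iota>]) (simp_all del: evo_single)
    also have "\<dots> = (\<iota> a b s \<cdot> ev_gen V F g) \<cdot> \<theta> s ?e \<cdot> (\<one> (evo s) \<star> ?j)"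
      using \<iota>_gen[OF assms g] se th j \<iota>_arr[OF assms se] by (simp del: evo_single evo_snoc theta_single)
    also have "\<dots> = \<iota> a b s \<cdot> ev_gen V F g \<cdot> \<theta> s ?e \<cdot> (\<one> (evo s) \<star> ?j)"
      using th j by (simp del: evo_single evo_snoc theta_single)
    also have "\<dots> = \<iota> a b s \<cdot> runit V (evo s)"
      using ev_gen_runit[OF i] unfolding g_def sl by simp
    also have "\<dots> = runit V (H a b) \<cdot> (\<iota> a b s \<star> \<one> \<I>)"
      using runit_nat[of "\<iota> a b s"] by simp
    finally show "(cmp a a b \<cdot> (\<one> (H a b) \<star> VUnit SV a)) \<cdot> (\<iota> a b s \<star> \<one> \<I>) =
      runit V (H a b) \<cdot> (\<iota> a b s \<star> \<one> \<I>)" .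
  qed simp_all
qed

lemma VUnit_SV_Hom:
  assumes "a \<in> X"
  shows "VUnit SV a \<in> Hom V \<I> (H a a)"
proof -
  obtain i x where "i \<in> Obj I" "x \<in> VOb (Fo F i)" "cls i x = a" by (rule cls_surj[OF assms])
  then show ?thesis using VUnit_SV[of i x] string_unit_arr[of i x] by simp
qed

lemma SV_vcat: "is_vcat V SV"
  unfolding is_vcat_def
proof (intro conjI ballI)
  show "\<forall>a b. \<not> (a \<in> VOb SV \<and> b \<in> VOb SV) \<longrightarrow> VHom SV a b = undefined"
    "\<forall>a. a \<notin> VOb SV \<longrightarrow> VUnit SV a = undefined"
    "\<forall>a b c. \<not> (a \<in> VOb SV \<and> b \<in> VOb SV \<and> c \<in> VOb SV) \<longrightarrow> VComp SV a b c = undefined"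
    by (auto simp: string_vcat_def Let_def)
qed (use VUnit_SV_Hom in \<open>simp_all add: cmp_assoc cmp_lunit cmp_runit\<close>)

section \<open>The legs of the colimit\<close>

abbreviation J where "J \<equiv> string_inj V I F K"

lemma J_simps [simp]:
  "VSrc (J i) = Fo F i" "VTgt (J i) = SV" "x \<in> VOb (Fo F i) \<Longrightarrow> VFo (J i) x = cls i x"
  "x \<in> VOb (Fo F i) \<Longrightarrow> y \<in> VOb (Fo F i) \<Longrightarrow> VFh (J i) x y = \<iota> (cls i x) (cls i y) [(i, x, y)]"
  by (simp_all add: string_inj_def)

text \<open>Compatibility with composition is the cocone condition at the contraction of two
  adjacent edges over the same \<open>i\<close>; \<open>\<theta>\<close> is an identity on a pair of
  single edges.\<close>

lemma J_vfun:
  assumes i [simp]: "i \<in> Obj I"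
  shows "is_vfun V (J i)"
proof -
  note [simp] = vcatD[OF vcat[OF i]]
  have comp: "\<iota> (cls i x) (cls i z) [(i, x, z)] \<cdot> VComp (Fo F i) x y z =
      cmp (cls i x) (cls i y) (cls i z) \<cdot>
        (\<iota> (cls i y) (cls i z) [(i, y, z)] \<star> \<iota> (cls i x) (cls i y) [(i, x, y)])"
    if [simp]: "x \<in> VOb (Fo F i)" "y \<in> VOb (Fo F i)" "z \<in> VOb (Fo F i)" for x y z
  proof -
    let ?g = "Contract [] i x y z [] :: ('i, 'f, 'u) gen"
    have st [simp]: "[(i, y, z), (i, x, y)] \<in> strs (cls i x) (cls i z)"
      using strings_append[of "[(i, y, z)]" "cls i y" "cls i z" "[(i, x, y)]" "cls i x"] by simp
    then have g: "?g \<in> gs (cls i x) (cls i z)" by (intro contract_in_gens) simp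
    from \<iota>_gen[OF _ _ g] show ?thesis
      by (simp add: cmp_\<iota> whisker_right_def)
  qed
  show ?thesis
    unfolding is_vfun_def Let_def
    using vcat[OF i] SV_vcat comp
    by (auto simp: VUnit_SV string_unit_def Let_def string_inj_def[of V I F K i])
qed

text \<open>On hom-objects this is the cocone condition at the transport of a single edge; on
  objects it is the invariance of classes.\<close>

lemma J_cocone: "is_cocone I (VCat V) F SV J"
proof -
  have "vfun_comp V (J (Cod I f)) (Fa F f) = J (Dom I f)" if f [simp]: "f \<in> Arr I" for f
  proof -
    let ?i = "Dom I f"
    note [simp] = vfun(2,3)[OF f] vfunD(3)[OF vfun(1)[OF f], unfolded vfun(2,3)[OF f]] cl_transport VFh_arr
    have "\<iota> (cls ?i x) (cls ?i y) [(Cod I f, VFo (Fa F f) x, VFo (Fa F f) y)] \<cdot> VFh (Fa F f) x y =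
        \<iota> (cls ?i x) (cls ?i y) [(?i, x, y)]"
      if [simp]: "x \<in> VOb (Fo F ?i)" "y \<in> VOb (Fo F ?i)" for x y
      using \<iota>_gen[OF _ _ transport_in_gens[OF f, of ?i x y "cls ?i x" "cls ?i y"]]
      by (simp add: whisker_right_def)
    then show ?thesis
      by (auto simp: vfun_comp_def string_inj_def[of V I F K ?i] fun_eq_iff)
  qed
  moreover have "small TYPE('u) (VOb (Fo F i))" if "i \<in> Obj I" for i
    using functorD(3)[OF diagram that] by simp
  ultimately show ?thesis
    using diagram SV_vcat small_X J_vfun by (simp add: is_cocone_def)
qed

end


section \<open>The universal property\<close>

locale string_cocone = string_colimit V I F K
  for V :: "('o, 'm) monoidal" and I :: "('i, 'f) category" and F :: "('i, 'f, 'u, 'o, 'm) vdiagram"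
    and K :: "('i, 'u, 'o, 'm) colim_choice" +
  fixes D :: "('u, 'o, 'm) vcat" and \<Gamma> :: "'i \<Rightarrow> ('u, 'o, 'm) vfun"
  assumes cocone: "is_cocone I (VCat V) F D \<Gamma>"
begin

lemma \<Gamma>_vfun:
  assumes "i \<in> Obj I"
  shows "is_vfun V (\<Gamma> i)" "VSrc (\<Gamma> i) = Fo F i" "VTgt (\<Gamma> i) = D"
  using coconeD(3-5)[OF cocone assms] by simp_all

lemma D_vcat: "is_vcat V D" and D_small: "small TYPE('u) (VOb D)"
  using coconeD(2)[OF cocone] by simp_all

context
  fixes i assumes i: "i \<in> Obj I"
begin

lemmas \<Gamma>_facts = vfunD[OF \<Gamma>_vfun(1)[OF i], unfolded \<Gamma>_vfun(2,3)[OF i]]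

end

lemma \<Gamma>_nat:
  assumes "f \<in> Arr I" "x \<in> VOb (Fo F (Dom I f))"
  shows "VFo (\<Gamma> (Cod I f)) (VFo (Fa F f) x) = VFo (\<Gamma> (Dom I f)) x"
    and "y \<in> VOb (Fo F (Dom I f)) \<Longrightarrow>
      VFh (\<Gamma> (Cod I f)) (VFo (Fa F f) x) (VFo (Fa F f) y) \<cdot> VFh (Fa F f) x y = VFh (\<Gamma> (Dom I f)) x y"
proof -
  have eq: "vfun_comp V (\<Gamma> (Cod I f)) (Fa F f) = \<Gamma> (Dom I f)"
    using coconeD(6)[OF cocone assms(1)] by simp
  show "VFo (\<Gamma> (Cod I f)) (VFo (Fa F f) x) = VFo (\<Gamma> (Dom I f)) x"
    using assms(2) vfun(2)[OF assms(1)] by (simp flip: eq add: vfun_comp_def)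
  show "VFh (\<Gamma> (Cod I f)) (VFo (Fa F f) x) (VFo (Fa F f) y) \<cdot> VFh (Fa F f) x y = VFh (\<Gamma> (Dom I f)) x y"
    if "y \<in> VOb (Fo F (Dom I f))"
    using assms(2) that vfun(2)[OF assms(1)] by (simp flip: eq add: vfun_comp_def)
qed

text \<open>The object map of the mediating functor is defined through an arbitrary representative;
  \<open>cls_invariant\<close> shows that the choice is immaterial.\<close>

definition rep :: "'u \<Rightarrow> 'i \<times> 'u" where
  "rep a = (SOME p. fst p \<in> Obj I \<and> snd p \<in> VOb (Fo F (fst p)) \<and> cls (fst p) (snd p) = a)"

definition \<phi> :: "'u \<Rightarrow> 'u" where
  "\<phi> a = VFo (\<Gamma> (fst (rep a))) (snd (rep a))"

lemma \<phi>_cls: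
  assumes "i \<in> Obj I" "x \<in> VOb (Fo F i)"
  shows "\<phi> (cls i x) = VFo (\<Gamma> i) x"
proof -
  let ?p = "rep (cls i x)"
  have "fst ?p \<in> Obj I \<and> snd ?p \<in> VOb (Fo F (fst ?p)) \<and> cls (fst ?p) (snd ?p) = cls i x"
    unfolding rep_def by (rule someI[of _ "(i, x)"]) (simp add: assms)
  then show ?thesis
    using cls_invariant[of "fst ?p" "snd ?p" i x "\<lambda>i. VFo (\<Gamma> i)"] assms \<Gamma>_nat(1)
    by (simp add: \<phi>_def)
qed

lemma \<phi>_in [simp]:
  assumes "a \<in> X"
  shows "\<phi> a \<in> VOb D"
proof -
  obtain i x where i: "i \<in> Obj I" "x \<in> VOb (Fo F i)" and "cls i x = a" by (rule cls_surj[OF assms])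
  then show ?thesis using \<Gamma>_facts(3)[OF i] \<phi>_cls[OF i] by simp
qed

abbreviation DH where "DH a b \<equiv> VHom D (\<phi> a) (\<phi> b)"
abbreviation DC where "DC a b c \<equiv> VComp D (\<phi> a) (\<phi> b) (\<phi> c)"

lemma DH_obj [simp]: "a \<in> X \<Longrightarrow> b \<in> X \<Longrightarrow> DH a b \<in> Obj V"
  using vcatD(1)[OF D_vcat] by simp

lemma DC_arr [simp]:
  assumes "a \<in> X" "b \<in> X" "c \<in> X"
  shows "DC a b c \<in> Arr V" "Dom V (DC a b c) = DH b c \<otimes> DH a b" "Cod V (DC a b c) = DH a c"
  using assms vcatD(5-7)[OF D_vcat] by simp_all

text \<open>Associativity in \<open>D\<close> for arrows into its hom-objects instead of for the
  hom-objects themselves, the form in which composites of images of edges are rebracketed.\<close>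

lemma DC_assoc:
  assumes [simp]: "a \<in> X" "b \<in> X" "c \<in> X" "d \<in> X" "p \<in> Arr V" "q \<in> Arr V" "r \<in> Arr V"
    "Cod V p = DH c d" "Cod V q = DH b c" "Cod V r = DH a b"
  shows "DC a b d \<cdot> ((DC b c d \<cdot> (p \<star> q)) \<star> r) =
    DC a c d \<cdot> (p \<star> (DC a b c \<cdot> (q \<star> r))) \<cdot> \<a> (Dom V p) (Dom V q) (Dom V r)"
proof -
  have "DC a b d \<cdot> ((DC b c d \<cdot> (p \<star> q)) \<star> r) = DC a b d \<cdot> (DC b c d \<star> \<one> (DH a b)) \<cdot> (p \<star> q \<star> r)"
    by simp
  also have "\<dots> = (DC a c d \<cdot> (\<one> (DH c d) \<star> DC a b c) \<cdot> \<a> (DH c d) (DH b c) (DH a b)) \<cdot> (p \<star> q \<star> r)"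
    by (rule comp_tail[OF vcatD(8)[OF D_vcat]]) simp_all
  also have "\<dots> = DC a c d \<cdot> (\<one> (DH c d) \<star> DC a b c) \<cdot> (p \<star> (q \<star> r)) \<cdot> \<a> (Dom V p) (Dom V q) (Dom V r)"
    using assoc_nat[of p q r] by simp
  finally show ?thesis by simp
qed

section \<open>Composing the images of edges in \<open>D\<close>\<close>

definition \<gamma> :: "('i, 'u) edge \<Rightarrow> 'm" where
  "\<gamma> e = VFh (\<Gamma> (fst e)) (fst (snd e)) (snd (snd e))"

lemma \<gamma>_arr [simp]:
  assumes "e \<in> edges"
  shows "\<gamma> e \<in> Arr V" "Dom V (\<gamma> e) = E e" "Cod V (\<gamma> e) = DH (esrc e) (etgt e)"
  using assms \<Gamma>_facts(4-6) by (cases e; simp add: \<gamma>_def \<phi>_cls)+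

text \<open>The composite in \<open>D\<close> of the images of the edges of a string.\<close>

definition gv :: "('i, 'u) edge list \<Rightarrow> 'm" where
  "gv s = foldl (\<lambda>m d. DC (esrc d) (etgt d) (etgt (hd s)) \<cdot> (m \<star> \<gamma> d)) (\<gamma> (hd s)) (tl s)"

lemma gv_single [simp]: "gv [e] = \<gamma> e"
  by (simp add: gv_def)

lemma gv_snoc: "s \<noteq> [] \<Longrightarrow> gv (s @ [d]) = DC (esrc d) (etgt d) (etgt (hd s)) \<cdot> (gv s \<star> \<gamma> d)"
  by (simp add: gv_def)

lemma strings_snoc:
  assumes "s @ [d] \<in> strs a b" "s \<noteq> []"
  shows "s \<in> strs (etgt d) b" "d \<in> edges" "esrc d = a" "etgt (hd s) = b"
proof -
  show s: "s \<in> strs (etgt d) b" using strings_split(1)[OF assms(1,2)] by simp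
  show "d \<in> edges" "esrc d = a" using strings_split(2)[OF assms(1,2)] by simp_all
  show "etgt (hd s) = b" using s unfolding strings_iff by simp
qed

text \<open>Removing the rightmost edge changes the source of a string but not its target, so
  \<open>a\<close> is generalised while \<open>b\<close> stays fixed. The inductions for
  \<open>gv_append\<close> and \<open>gv_gen\<close> follow the same pattern.\<close>

lemma gv_Hom: "s \<in> strs a b \<Longrightarrow> a \<in> X \<Longrightarrow> b \<in> X \<Longrightarrow> gv s \<in> Hom V (evo s) (DH a b)"
proof (induction s arbitrary: a rule: rev_induct)
  case Nil
  then show ?case using strings_str(1) by blast
next
  case (snoc d s)
  show ?case
  proof (cases "s = []")
    case True
    then show ?thesis using snoc.prems by simp
  next
    case False
    note d = strings_snoc[OF snoc.prems(1) False]
    show ?thesis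
      using snoc.IH[OF d(1) etgt_in[OF d(2)] snoc.prems(3)] d False snoc.prems
      by (simp add: gv_snoc)
  qed
qed

lemma gv_arr [simp]:
  assumes "s \<in> strs a b" "a \<in> X" "b \<in> X"
  shows "gv s \<in> Arr V" "Dom V (gv s) = evo s" "Cod V (gv s) = DH a b"
  using gv_Hom[OF assms] by simp_all

text \<open>Each further edge adds an inverse associator to \<open>\<theta>\<close>, which cancels
  the associator in the associativity law of \<open>D\<close>.\<close>

lemma gv_append:
  assumes t: "t \<in> strs b c" and b: "b \<in> X" and c: "c \<in> X"
  shows "s \<in> strs a b \<Longrightarrow> a \<in> X \<Longrightarrow> gv (t @ s) \<cdot> \<theta> t s = DC a b c \<cdot> (gv t \<star> gv s)"
proof (induction s arbitrary: a rule: rev_induct)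
  case Nil
  then show ?case using strings_str(1) by blast
next
  case (snoc d s)
  note [simp] = b c strings_str[OF t] gv_arr[OF t b c] snoc.prems(2)
  have hd_t [simp]: "etgt (hd t) = c" using t unfolding strings_iff by simp
  show ?case
  proof (cases "s = []")
    case True
    then show ?thesis using snoc.prems by (simp add: gv_snoc)
  next
    case [simp]: False
    let ?e = "etgt d"
    note d = strings_snoc[OF snoc.prems(1) False]
    note [simp] = d(2-4) strings_str[OF d(1)] gv_arr[OF d(1) etgt_in[OF d(2)] b]
    have ts: "t @ s \<in> strs ?e c" using t d(1) by (rule strings_append)
    note [simp] = gv_arr[OF ts etgt_in[OF d(2)] c]
    have "gv (t @ s @ [d]) \<cdot> \<theta> t (s @ [d]) =
        DC a ?e c \<cdot> ((gv (t @ s) \<cdot> \<theta> t s) \<star> \<gamma> d) \<cdot> \<b> (evo t) (evo s) (E d)"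
      using gv_snoc[of "t @ s" d] by (simp add: theta_snoc)
    also have "\<dots> = DC a ?e c \<cdot> ((DC ?e b c \<cdot> (gv t \<star> gv s)) \<star> \<gamma> d) \<cdot> \<b> (evo t) (evo s) (E d)"
      by (simp only: snoc.IH[OF d(1) etgt_in[OF d(2)]])
    also have "\<dots> = (DC a b c \<cdot> (gv t \<star> (DC a ?e b \<cdot> (gv s \<star> \<gamma> d))) \<cdot> \<a> (evo t) (evo s) (E d)) \<cdot>
        \<b> (evo t) (evo s) (E d)"
      using DC_assoc[of a ?e b c "gv t" "gv s" "\<gamma> d"] by (intro comp_tail) simp_all
    also have "\<dots> = DC a b c \<cdot> (gv t \<star> gv (s @ [d]))"
      by (simp add: gv_snoc)
    finally show ?thesis .
  qed
qed

lemma \<gamma>_transport: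
  assumes "f \<in> Arr I" "x \<in> VOb (Fo F (Dom I f))" "y \<in> VOb (Fo F (Dom I f))"
  shows "\<gamma> (Cod I f, VFo (Fa F f) x, VFo (Fa F f) y) \<cdot> VFh (Fa F f) x y = \<gamma> (Dom I f, x, y)"
  using \<Gamma>_nat(2)[OF assms] by (simp add: \<gamma>_def)

lemma \<gamma>_comp:
  assumes "i \<in> Obj I" "x \<in> VOb (Fo F i)" "y \<in> VOb (Fo F i)" "z \<in> VOb (Fo F i)"
  shows "\<gamma> (i, x, z) \<cdot> VComp (Fo F i) x y z = DC (cls i x) (cls i y) (cls i z) \<cdot> (\<gamma> (i, y, z) \<star> \<gamma> (i, x, y))"
  using \<Gamma>_facts(8)[OF assms] assms by (simp add: \<gamma>_def \<phi>_cls)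

text \<open>Transports are covered by the cocone condition on \<open>\<Gamma>\<close>, contractions
  by preservation of composition under \<open>\<Gamma> i\<close>. After a non-empty prefix the
  associator inside \<open>ev_gen\<close> is the one in the associativity law of
  \<open>D\<close>.\<close>

lemma gv_gen:
  "wf_gen g \<Longrightarrow> gen_src g \<in> strs a b \<Longrightarrow> gen_tgt g \<in> strs a b \<Longrightarrow> a \<in> X \<Longrightarrow> b \<in> X \<Longrightarrow>
    gv (gen_tgt g) \<cdot> ev_gen V F g = gv (gen_src g)"
proof (induction arbitrary: a rule: wf_gen_induct)
  case (transport l f i x y i' x' y')
  let ?h = "VFh (Fa F f) x y"
  have [simp]: "x \<in> VOb (Fo F (Dom I f))" "y \<in> VOb (Fo F (Dom I f))"
    "VFo (Fa F f) x \<in> VOb (Fo F (Cod I f))" "VFo (Fa F f) y \<in> VOb (Fo F (Cod I f))"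
    using transport(5,6,9,10) transport(3,4,7,8) by simp_all
  note [simp] = transport(1-4,7,8) VFh_arr \<gamma>_transport transport.prems(3,4)
  show ?case
  proof (cases "l = []")
    case True
    then show ?thesis by (simp add: whisker_right_def)
  next
    case [simp]: False
    note d = strings_snoc[OF _ False, of "(i, x, y)" a b]
    have l: "l \<in> strs (cls (Dom I f) y) b" and [simp]: "cls (Dom I f) x = a" "etgt (hd l) = b"
      using d transport.prems by simp_all
    note [simp] = strings_str[OF l] gv_arr[OF l] cl_transport \<gamma>_arr[of "(Dom I f, x, y)"]
      \<gamma>_arr[of "(Cod I f, VFo (Fa F f) x, VFo (Fa F f) y)"]
    show ?thesis by (simp add: whisker_right_def gv_snoc)
  qed
next
  case (contract l i x y z)
  let ?h = "VComp (Fo F i) x y z"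
  note [simp] = contract(1-5) contract.prems(3,4) vcatD[OF vcat] \<gamma>_comp
  show ?case
  proof (cases "l = []")
    case True
    then show ?thesis using gv_snoc[of "[(i, y, z)]" "(i, x, y)"] by (simp add: whisker_right_def)
  next
    case [simp]: False
    let ?x = "cls i x" and ?y = "cls i y" and ?z = "cls i z" and ?L = "evo l"
    let ?P = "VHom (Fo F i) y z" and ?Q = "VHom (Fo F i) x y"
    note d = strings_snoc[of l "(i, x, z)" a b]
    have l: "l \<in> strs ?z b" and [simp]: "etgt (hd l) = b"
      using d contract.prems by simp_all
    note [simp] = strings_str[OF l] gv_arr[OF l] \<gamma>_arr[of "(i, x, y)"] \<gamma>_arr[of "(i, y, z)"] \<gamma>_arr[of "(i, x, z)"]
    have "gv (gen_tgt (Contract l i x y z [])) \<cdot> ev_gen V F (Contract l i x y z []) =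
        DC ?x ?z b \<cdot> (gv l \<star> (DC ?x ?y ?z \<cdot> (\<gamma> (i, y, z) \<star> \<gamma> (i, x, y)))) \<cdot> \<a> ?L ?P ?Q"
      by (simp add: gv_snoc whisker_right_def)
    also have "\<dots> = DC ?x ?y b \<cdot> ((DC ?y ?z b \<cdot> (gv l \<star> \<gamma> (i, y, z))) \<star> \<gamma> (i, x, y))"
      using DC_assoc[of ?x ?y ?z b "gv l" "\<gamma> (i, y, z)" "\<gamma> (i, x, y)"] by simp
    also have "\<dots> = gv (gen_src (Contract l i x y z []))"
      using gv_snoc[of "l @ [(i, y, z)]" "(i, x, y)"] by (simp add: gv_snoc)
    finally show ?thesis .
  qed
next
  case (snoc g d)
  note src = strings_snoc[OF snoc.prems(1)[unfolded star_simps] gen_nonempty(1)]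
  note tgt = strings_snoc[OF snoc.prems(2)[unfolded star_simps] gen_nonempty(2)]
  note d = etgt_in[OF snoc.hyps(2)]
  have IH: "gv (gen_tgt g) \<cdot> ev_gen V F g = gv (gen_src g)"
    by (rule snoc.IH[OF src(1) tgt(1) d snoc.prems(4)])
  note [simp] = snoc.hyps snoc.prems(3,4) d src(3,4) tgt(4) gv_arr[OF src(1)] gv_arr[OF tgt(1)]
  show ?case
    by (simp add: gv_snoc ev_gen_snoc IH)
qed

lemma gv_cocone: "a \<in> X \<Longrightarrow> b \<in> X \<Longrightarrow> is_cocone (SC a b) V (ev V F) (DH a b) gv"
  unfolding ev_cocone_iff
  by (intro conjI ballI gv_Hom gv_gen[OF gens_wf gens_ends] DH_obj; assumption)

section \<open>The mediating enriched functor\<close>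

definition w :: "'u \<Rightarrow> 'u \<Rightarrow> 'm" where
  "w a b = induced_arr (SC a b) V (H a b) (\<iota> a b) (DH a b) gv"

lemma w_arr [simp]:
  assumes "a \<in> X" "b \<in> X"
  shows "w a b \<in> Arr V" "Dom V (w a b) = H a b" "Cod V (w a b) = DH a b"
    "s \<in> strs a b \<Longrightarrow> w a b \<cdot> \<iota> a b s = gv s"
  using induced_arr[OF Hom_colimit[OF assms] gv_cocone[OF assms], folded w_def] by simp_all

definition W :: "('u, 'o, 'm) vfun" where
  "W = \<lparr>VSrc = SV, VTgt = D, VFo = (\<lambda>a. if a \<in> X then \<phi> a else undefined),
     VFh = (\<lambda>a b. if a \<in> X \<and> b \<in> X then w a b else undefined)\<rparr>"

lemma w_unit:
  assumes "a \<in> X"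
  shows "w a a \<cdot> VUnit SV a = VUnit D (\<phi> a)"
proof -
  obtain i x where [simp]: "i \<in> Obj I" "x \<in> VOb (Fo F i)" and a: "cls i x = a" by (rule cls_surj[OF assms])
  note [simp] = vcatD(2-4)[OF vcat]
  have "w a a \<cdot> \<iota> a a [(i, x, x)] \<cdot> VUnit (Fo F i) x = gv [(i, x, x)] \<cdot> VUnit (Fo F i) x"
    using assms a by (intro comp_tail) simp_all
  also have "\<dots> = VUnit D (\<phi> a)"
    using \<Gamma>_facts(7)[of i x] by (simp add: \<gamma>_def \<phi>_cls flip: a)
  finally show ?thesis
    using VUnit_SV[of i x] a by (simp add: string_unit_def Let_def)
qed

text \<open>Tested on tensor products of legs, this becomes \<open>gv_append\<close>.\<close>

lemma w_comp:
  assumes [simp]: "a \<in> X" "b \<in> X" "c \<in> X"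
  shows "w a c \<cdot> cmp a b c = DC a b c \<cdot> (w b c \<star> w a b)"
proof (rule colimit_ext[OF tensor2_colimit[OF assms]])
  fix p assume "p \<in> Obj (prod_cat (SC b c) (SC a b))"
  then obtain t s where p: "p = (t, s)" and t [simp]: "t \<in> strs b c" and s [simp]: "s \<in> strs a b" by auto
  note [simp] = strings_str[OF t] strings_str[OF s]
  have ts [simp]: "t @ s \<in> strs a c" using t s by (rule strings_append)
  have "(w a c \<cdot> cmp a b c) \<cdot> (\<iota> b c t \<star> \<iota> a b s) = w a c \<cdot> \<iota> a c (t @ s) \<cdot> \<theta> t s"
    by (simp add: cmp_\<iota>)
  also have "\<dots> = gv (t @ s) \<cdot> \<theta> t s"
    by (intro comp_tail) simp_all
  also have "\<dots> = DC a b c \<cdot> (gv t \<star> gv s)"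
    by (rule gv_append[OF t _ _ s]) simp_all
  finally show "(w a c \<cdot> cmp a b c) \<cdot> (case p of (t, s) \<Rightarrow> \<iota> b c t \<star> \<iota> a b s) =
      (DC a b c \<cdot> (w b c \<star> w a b)) \<cdot> (case p of (t, s) \<Rightarrow> \<iota> b c t \<star> \<iota> a b s)"
    by (simp add: p)
qed simp_all

lemma W_vfun: "is_vfun V W"
  unfolding is_vfun_def Let_def
  using SV_vcat D_vcat by (auto simp: W_def w_unit w_comp)

lemma W_J: "i \<in> Obj I \<Longrightarrow> vfun_comp V W (J i) = \<Gamma> i"
proof (rule vfun.equality)
  assume i: "i \<in> Obj I"
  note g = \<Gamma>_vfun[OF i] \<Gamma>_facts(9,10)[OF i]
  show "VFo (vfun_comp V W (J i)) = VFo (\<Gamma> i)"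
    using i g by (auto simp: vfun_comp_def W_def fun_eq_iff \<phi>_cls)
  show "VFh (vfun_comp V W (J i)) = VFh (\<Gamma> i)"
    using i g by (auto simp: vfun_comp_def W_def fun_eq_iff \<gamma>_def)
qed (simp_all add: vfun_comp_def W_def \<Gamma>_vfun)

lemma W_unique:
  assumes T: "is_vfun V T" "VSrc T = SV" "VTgt T = D"
    and TJ: "\<And>i. i \<in> Obj I \<Longrightarrow> vfun_comp V T (J i) = \<Gamma> i"
  shows "T = W"
proof -
  note Tf = vfunD[OF T(1), unfolded T(2,3), simplified]
  have VFo_cls: "VFo T (cls i x) = VFo (\<Gamma> i) x" if "i \<in> Obj I" "x \<in> VOb (Fo F i)" for i x
    using that by (simp flip: TJ add: vfun_comp_def)
  have VFo_\<phi>: "VFo T a = \<phi> a" if "a \<in> X" for a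
    using cls_surj[OF that] VFo_cls by (metis \<phi>_cls)
  have arr: "VFh T a b \<in> Arr V" "Dom V (VFh T a b) = H a b" "Cod V (VFh T a b) = DH a b"
    if "a \<in> X" "b \<in> X" for a b
    using Tf(4-6)[of a b] that by (simp_all add: VFo_\<phi>)
  have single: "VFh T (cls i x) (cls i y) \<cdot> \<iota> (cls i x) (cls i y) [(i, x, y)] = VFh (\<Gamma> i) x y"
    if "i \<in> Obj I" "x \<in> VOb (Fo F i)" "y \<in> VOb (Fo F i)" for i x y
    using that by (simp flip: TJ add: vfun_comp_def)
  have edge: "VFh T (esrc e) (etgt e) \<cdot> \<iota> (esrc e) (etgt e) [e] = \<gamma> e" if "e \<in> edges" for e
    using that single by (cases e) (simp add: \<gamma>_def)
  have gv: "VFh T a b \<cdot> \<iota> a b s = gv s" if "s \<in> strs a b" "a \<in> X" "b \<in> X" for a b s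
    using that
  proof (induction s arbitrary: a rule: rev_induct)
    case Nil
    then show ?case using strings_str(1) by blast
  next
    case (snoc d s)
    show ?case
    proof (cases "s = []")
      case True
      then show ?thesis using snoc.prems edge[of d] by auto
    next
      case [simp]: False
      let ?e = "etgt d"
      note d = strings_snoc[OF snoc.prems(1) False]
      have [simp]: "?e \<in> X" using d(2) by simp
      have d' [simp]: "[d] \<in> strs a ?e" using d by simp
      note [simp] = snoc.prems d(2-4) d(1) strings_str[OF d(1)] arr
      have e: "VFh T a ?e \<cdot> \<iota> a ?e [d] = \<gamma> d" using edge[OF d(2)] by simp
      \<comment> \<open>\<open>\<theta> s [d]\<close> is an identity, so the leg at
        \<open>s @ [d]\<close> is the composite in \<open>SV\<close> of the legs at \<open>s\<close>
        and at \<open>[d]\<close>. This lets the functoriality of \<open>T\<close> drive the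
        induction.\<close>
      have "cmp a ?e b \<cdot> (\<iota> ?e b s \<star> \<iota> a ?e [d]) = \<iota> a b (s @ [d])"
        by (simp add: cmp_\<iota>)
      then have "VFh T a b \<cdot> \<iota> a b (s @ [d]) = VFh T a b \<cdot> cmp a ?e b \<cdot> (\<iota> ?e b s \<star> \<iota> a ?e [d])"
        by simp
      also have "\<dots> = (DC a ?e b \<cdot> (VFh T ?e b \<star> VFh T a ?e)) \<cdot> (\<iota> ?e b s \<star> \<iota> a ?e [d])"
        using Tf(8)[of a ?e b] by (intro comp_tail) (simp_all add: VFo_\<phi>)
      also have "\<dots> = DC a ?e b \<cdot> ((VFh T ?e b \<cdot> \<iota> ?e b s) \<star> (VFh T a ?e \<cdot> \<iota> a ?e [d]))"
        by simp
      also have "\<dots> = gv (s @ [d])"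
        using snoc.IH[OF d(1)] e by (simp add: gv_snoc)
      finally show ?thesis .
    qed
  qed
  have VFh_w: "VFh T a b = w a b" if "a \<in> X" "b \<in> X" for a b
    by (rule Hom_ext[OF that]) (use that arr gv in simp_all)
  show ?thesis
    by (rule vfun.equality) (use T Tf(9,10) VFo_\<phi> VFh_w in \<open>auto simp: W_def fun_eq_iff\<close>)
qed

end

context string_colimit
begin

lemma string_vcat_colimit: "is_colimit I (VCat V) F SV J"
  unfolding is_colimit_def
proof (intro conjI allI impI)
  fix D \<Gamma> assume "is_cocone I (VCat V) F D \<Gamma>"
  then interpret string_cocone V I F K D \<Gamma> by unfold_locales
  show "\<exists>!u. u \<in> Hom (VCat V) SV D \<and> (\<forall>j\<in>Obj I. Comp (VCat V) u (J j) = \<Gamma> j)"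
  proof (rule ex1I[of _ W])
    show "W \<in> Hom (VCat V) SV D \<and> (\<forall>j\<in>Obj I. Comp (VCat V) W (J j) = \<Gamma> j)"
      using W_vfun W_J D_small small_X by (auto simp: W_def)
    show "u = W" if "u \<in> Hom (VCat V) SV D \<and> (\<forall>j\<in>Obj I. Comp (VCat V) u (J j) = \<Gamma> j)" for u
      using that by (intro W_unique) auto
  qed
qed (rule J_cocone)

end

text \<open>Colimits are fixed only up to isomorphism, so the claim ranges over all choices, and the
  existence of a choice keeps it from being vacuous. The clause on units states that the
  \<open>THE\<close> in \<open>string_vcat\<close> selects the prescribed map, whichever
  representative is taken.\<close>

theorem corollary4p21:
  fixes V :: "('o, 'm) monoidal"
    and I :: "('i, 'f) category"
    and F :: "('i, 'f, 'u, 'o, 'm) vdiagram"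
  assumes "universe_type TYPE('u)"
    and "monoidal_category V"
    and "cocomplete TYPE('u) V"
    and "locally_small TYPE('u) V"
    and "tensor_cocontinuous TYPE('u) V"
    and "small_category TYPE('u) I"
    and "is_functor I (VCat V) F"
  shows "(\<exists>K. is_colim_choice V I F K) \<and>
    (\<forall>K. is_colim_choice V I F K \<longrightarrow>
       (\<forall>i\<in>Obj I. \<forall>x\<in>VOb (Fo F i).
          VUnit (string_vcat V I F K) (obj_class K i x) = string_unit V F K i x) \<and>
       is_colimit I (VCat V) F (string_vcat V I F K) (string_inj V I F K))"
proof -
  interpret vdiagram V I F
    using assms(2,7) by unfold_locales (auto simp: monoidal_category_def)
  have "(\<forall>i\<in>Obj I. \<forall>x\<in>VOb (Fo F i).
          VUnit (string_vcat V I F K) (obj_class K i x) = string_unit V F K i x) \<and>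
       is_colimit I (VCat V) F (string_vcat V I F K) (string_inj V I F K)"
    if "is_colim_choice V I F K" for K
  proof -
    interpret string_colimit V I F K
      using assms(1,5,6) that by unfold_locales
    show ?thesis using VUnit_SV string_vcat_colimit by blast
  qed
  then show ?thesis using ex_colim_choice[OF assms(1,3,6)] by blast
qed

end
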